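(* Let $K$ be an algebraically closed field of characteristic $2$, $D=D(S_3)$ the Drinfel'd double over $K$ of the symmetric group on three letters, and $\mathcal Z^m(\Sigma_1)=\mathrm{Ext}^m_D(K,L)$ with $L=D^*$, for $m\ge0$. Then $$\mathcal Z^m(\Sigma_1)\cong\begin{cases}K\oplus K[\mathbb P^1_2]\oplus K[\mathbb P^1_3]&: m=0\\ K\oplus K[\mathbb P^1_2]&: m\neq0\end{cases}$$ as $\mathrm{SL}(2,\mathbb Z)$-modules.
   Context: For a finite group $G$ with unit $e$, $D(G)$ has basis $\delta_a\otimes b$ ($a,b\in G$), product $(\delta_a\otimes b)(\delta_c\otimes d)=\delta_{a,bcb^{-1}}\,\delta_a\otimes bd$, unit $\varepsilon\otimes e$ with $\varepsilon=\sum_a\delta_a$, and counit $\delta_a\otimes b\mapsto\delta_{a,e}$, which makes $K$ a (trivial) $D$-module. $L=D^*$ has the dual basis $u(a,b)$ ($a,b\in G$) and carries the left coadjoint action $(\varepsilon\otimes h).u(a,b)=u(hah^{-1},hbh^{-1})$, $(\delta_h\otimes e).u(a,b)=\delta_{h,\,b^{-1}aba^{-1}}\,u(a,b)$. The mapping class group $\Gamma_1$ of the torus $\Sigma_1$ is identified with $\mathrm{SL}(2,\mathbb Z)$ via its action on first homology. It acts on the derived block space $\mathcal Z^m(\Sigma_1)=\mathrm{Ext}^m_D(K,L)$ as follows: the maps $\tilde{\mathfrak T}(u(c,d))=u(c,cd)$ and $\tilde{\mathfrak S}(u(c,d))=u(d,d^{-1}c^{-1}d)$ are $D$-linear automorphisms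 of $L$, and there is an action of $\mathrm{SL}(2,\mathbb Z)$ on $\mathrm{Ext}^m_D(K,L)$ in which $\begin{pmatrix}1&1\\0&1\end{pmatrix}$ acts by $\mathrm{Ext}^m_D(K,\tilde{\mathfrak T})$ and $\begin{pmatrix}0&-1\\1&0\end{pmatrix}$ acts by $\mathrm{Ext}^m_D(K,\tilde{\mathfrak S})$. $K$ denotes the trivial $\mathrm{SL}(2,\mathbb Z)$-module. For a prime $n$, $\mathbb P^1_n$ is the set of one-dimensional subspaces of $\mathbb Z_n^2$, $\mathbb{Z}_n = \mathbb{Z}/n\mathbb{Z}$, and $K[\mathbb P^1_n]$ is the permutation module with basis $\mathbb P^1_n$, on which $\mathrm{SL}(2,\mathbb Z)$ acts through its natural action on $\mathbb Z_n^2$ modulo $n$. *)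

theory Defs
  imports
    "HOL-Algebra.Algebraic_Closure_Type"
    "HOL-Algebra.Sym_Groups"
    "HOL-Analysis.Determinants"
begin

section \<open>Left modules over rings that need not be commutative\<close>

text \<open>The module locale of HOL-Algebra requires a commutative ring of scalars.  Its records are
  reused here; the fields \<open>mult\<close> and \<open>one\<close> of a module record are irrelevant.\<close>

locale left_module = R?: ring R + M?: abelian_group M
  for R :: "('r, 'a) ring_scheme" (structure) and M :: "('r, 'm, 'b) module_scheme" (structure) +
  assumes lsmult_closed:
      "\<lbrakk>r \<in> carrier R; x \<in> carrier M\<rbrakk> \<Longrightarrow> r \<odot>\<^bsub>M\<^esub> x \<in> carrier M"
    and lsmult_l_distr:
      "\<lbrakk>r \<in> carrier R; s \<in> carrier R; x \<in> carrier M\<rbrakk> \<Longrightarrow>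
        (r \<oplus> s) \<odot>\<^bsub>M\<^esub> x = r \<odot>\<^bsub>M\<^esub> x \<oplus>\<^bsub>M\<^esub> s \<odot>\<^bsub>M\<^esub> x"
    and lsmult_r_distr:
      "\<lbrakk>r \<in> carrier R; x \<in> carrier M; y \<in> carrier M\<rbrakk> \<Longrightarrow>
        r \<odot>\<^bsub>M\<^esub> (x \<oplus>\<^bsub>M\<^esub> y) = r \<odot>\<^bsub>M\<^esub> x \<oplus>\<^bsub>M\<^esub> r \<odot>\<^bsub>M\<^esub> y"
    and lsmult_assoc:
      "\<lbrakk>r \<in> carrier R; s \<in> carrier R; x \<in> carrier M\<rbrakk> \<Longrightarrow>
        (r \<otimes> s) \<odot>\<^bsub>M\<^esub> x = r \<odot>\<^bsub>M\<^esub> (s \<odot>\<^bsub>M\<^esub> x)"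
    and lsmult_one: "x \<in> carrier M \<Longrightarrow> \<one> \<odot>\<^bsub>M\<^esub> x = x"

text \<open>Linear maps are extensional functions, so that equal maps are equal as HOL functions.\<close>

definition mod_hom ::
    "('r, 'a) ring_scheme \<Rightarrow> ('r, 'm, 'b) module_scheme \<Rightarrow> ('r, 'n, 'c) module_scheme \<Rightarrow> ('m \<Rightarrow> 'n) set"
  where "mod_hom R M N =
    {f \<in> carrier M \<rightarrow>\<^sub>E carrier N.
      (\<forall>x\<in>carrier M. \<forall>y\<in>carrier M. f (x \<oplus>\<^bsub>M\<^esub> y) = f x \<oplus>\<^bsub>N\<^esub> f y) \<and>
      (\<forall>r\<in>carrier R. \<forall>x\<in>carrier M. f (r \<odot>\<^bsub>M\<^esub> x) = r \<odot>\<^bsub>N\<^esub> f x)}"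

definition free_module :: "('r, 'a) ring_scheme \<Rightarrow> 'i set \<Rightarrow> ('r, 'i \<Rightarrow> 'r) module"
  where "free_module R I =
    \<lparr>carrier = {f \<in> I \<rightarrow>\<^sub>E carrier R. finite {i \<in> I. f i \<noteq> \<zero>\<^bsub>R\<^esub>}},
     monoid.mult = undefined, one = undefined,
     zero = (\<lambda>i\<in>I. \<zero>\<^bsub>R\<^esub>), add = (\<lambda>f g. \<lambda>i\<in>I. f i \<oplus>\<^bsub>R\<^esub> g i),
     module.smult = (\<lambda>r f. \<lambda>i\<in>I. r \<otimes>\<^bsub>R\<^esub> f i)\<rparr>"

text \<open>Projective modules are the direct summands of free modules.  It is no restriction that the
  basis of the free module is taken from the type of the elements of \<open>P\<close>: if \<open>P\<close> is a summand of
  any free module at all, then it is a summand of the free module on the set \<open>carrier P\<close>.\<close>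

definition projective_module :: "('r, 'a) ring_scheme \<Rightarrow> ('r, 'm) module \<Rightarrow> bool"
  where "projective_module R P \<longleftrightarrow> left_module R P \<and>
    (\<exists>I :: 'm set. \<exists>\<iota> \<in> mod_hom R P (free_module R I). \<exists>\<pi> \<in> mod_hom R (free_module R I) P.
      \<forall>x\<in>carrier P. \<pi> (\<iota> x) = x)"

text \<open>Exactness of
  \<open>\<dots> \<rightarrow> P 2 \<rightarrow> P 1 \<rightarrow> P 0 \<rightarrow> M \<rightarrow> 0\<close> with \<open>d n : P (n + 1) \<rightarrow> P n\<close> and \<open>aug : P 0 \<rightarrow> M\<close>.\<close>

definition projective_resolution ::
    "('r, 'a) ring_scheme \<Rightarrow> (nat \<Rightarrow> ('r, 'm) module) \<Rightarrow> (nat \<Rightarrow> 'm \<Rightarrow> 'm) \<Rightarrow> ('m \<Rightarrow> 'x)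
      \<Rightarrow> ('r, 'x) module \<Rightarrow> bool"
  where "projective_resolution R P d aug M \<longleftrightarrow>
    (\<forall>n. projective_module R (P n)) \<and>
    (\<forall>n. d n \<in> mod_hom R (P (Suc n)) (P n)) \<and>
    aug \<in> mod_hom R (P 0) M \<and>
    aug ` carrier (P 0) = carrier M \<and>
    d 0 ` carrier (P (Suc 0)) = a_kernel (P 0) M aug \<and>
    (\<forall>n. d (Suc n) ` carrier (P (Suc (Suc n))) = a_kernel (P (Suc n)) (P n) (d n))"

definition quot_module :: "('r, 'm, 'a) module_scheme \<Rightarrow> 'm set \<Rightarrow> ('r, 'm set) module"
  where "quot_module M B =
    \<lparr>carrier = a_rcosets\<^bsub>M\<^esub> B, monoid.mult = undefined, one = undefined,
     zero = B, add = set_add M,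
     module.smult = (\<lambda>r C. \<Union>x\<in>C. B +>\<^bsub>M\<^esub> (r \<odot>\<^bsub>M\<^esub> x))\<rparr>"


section \<open>Ext over an algebra, computed from a projective resolution\<close>

text \<open>Throughout, \<open>R\<close> is an algebra over a field \<open>'k\<close> and \<open>\<eta> : 'k \<rightarrow> R\<close>, \<open>k \<mapsto> k \<cdot> 1\<close>, is its
  structure map; it turns every \<open>R\<close>-module, and hence \<open>Hom\<^sub>R(M, N)\<close>, into a vector space.
  The pair \<open>(P, d)\<close> is a projective resolution of \<open>M\<close>, and \<open>ext_module\<close> is then
  \<open>Ext\<^sup>m\<^sub>R(M, N)\<close>, the cohomology of the complex \<open>Hom\<^sub>R(P, N)\<close>.\<close>

definition hom_module ::
    "('k \<Rightarrow> 'r) \<Rightarrow> ('r, 'a) ring_scheme \<Rightarrow> ('r, 'm) module \<Rightarrow> ('r, 'n) module \<Rightarrow> ('k, 'm \<Rightarrow> 'n) module"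
  where "hom_module \<eta> R M N =
    \<lparr>carrier = mod_hom R M N, monoid.mult = undefined, one = undefined,
     zero = (\<lambda>x\<in>carrier M. \<zero>\<^bsub>N\<^esub>),
     add = (\<lambda>f g. \<lambda>x\<in>carrier M. f x \<oplus>\<^bsub>N\<^esub> g x),
     module.smult = (\<lambda>k f. \<lambda>x\<in>carrier M. \<eta> k \<odot>\<^bsub>N\<^esub> f x)\<rparr>"

definition cocycles ::
    "('r, 'a) ring_scheme \<Rightarrow> (nat \<Rightarrow> ('r, 'm) module) \<Rightarrow> (nat \<Rightarrow> 'm \<Rightarrow> 'm) \<Rightarrow> nat \<Rightarrow> ('r, 'n) module
      \<Rightarrow> ('m \<Rightarrow> 'n) set"
  where "cocycles R P d m N =
    {f \<in> mod_hom R (P m) N. \<forall>x\<in>carrier (P (Suc m)). f (d m x) = \<zero>\<^bsub>N\<^esub>}"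

fun coboundaries ::
    "('r, 'a) ring_scheme \<Rightarrow> (nat \<Rightarrow> ('r, 'm) module) \<Rightarrow> (nat \<Rightarrow> 'm \<Rightarrow> 'm) \<Rightarrow> nat \<Rightarrow> ('r, 'n) module
      \<Rightarrow> ('m \<Rightarrow> 'n) set"
  where
    "coboundaries R P d 0 N = {\<lambda>x\<in>carrier (P 0). \<zero>\<^bsub>N\<^esub>}"
  | "coboundaries R P d (Suc m) N =
      (\<lambda>f. compose (carrier (P (Suc m))) f (d m)) ` mod_hom R (P m) N"

definition ext_module ::
    "('k \<Rightarrow> 'r) \<Rightarrow> ('r, 'a) ring_scheme \<Rightarrow> (nat \<Rightarrow> ('r, 'm) module) \<Rightarrow> (nat \<Rightarrow> 'm \<Rightarrow> 'm) \<Rightarrow> nat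
      \<Rightarrow> ('r, 'n) module \<Rightarrow> ('k, ('m \<Rightarrow> 'n) set) module"
  where "ext_module \<eta> R P d m N =
    quot_module ((hom_module \<eta> R (P m) N) \<lparr>carrier := cocycles R P d m N\<rparr>) (coboundaries R P d m N)"

text \<open>The map \<open>Ext\<^sup>m\<^sub>R(M, \<phi>)\<close> for an \<open>R\<close>-linear endomorphism \<open>\<phi>\<close> of \<open>N\<close>: it sends the class of a
  cocycle \<open>f\<close> to the class of \<open>\<phi> \<circ> f\<close>.\<close>

definition ext_map ::
    "('k \<Rightarrow> 'r) \<Rightarrow> ('r, 'a) ring_scheme \<Rightarrow> (nat \<Rightarrow> ('r, 'm) module) \<Rightarrow> (nat \<Rightarrow> 'm \<Rightarrow> 'm) \<Rightarrow> nat
      \<Rightarrow> ('r, 'n) module \<Rightarrow> ('n \<Rightarrow> 'n) \<Rightarrow> ('m \<Rightarrow> 'n) set \<Rightarrow> ('m \<Rightarrow> 'n) set"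
  where "ext_map \<eta> R P d m N \<phi> =
    (\<lambda>C \<in> carrier (ext_module \<eta> R P d m N).
      \<Union>f\<in>C. coboundaries R P d m N +>\<^bsub>hom_module \<eta> R (P m) N\<^esub> compose (carrier (P m)) \<phi> f)"


section \<open>The Drinfel'd double of a finite group\<close>

definition unit_at :: "'a \<Rightarrow> 'a \<Rightarrow> 'k::field"
  where "unit_at p = (\<lambda>q. if q = p then 1 else 0)"

text \<open>An element of \<open>D(G)\<close> is given by its coefficients with respect to the basis
  \<open>\<delta>\<^sub>a \<otimes> b\<close>; the basis element \<open>\<delta>\<^sub>a \<otimes> b\<close> itself is \<open>unit_at (a, b)\<close>.\<close>

definition drinfeld_double :: "('g, 'z) monoid_scheme \<Rightarrow> ('g \<times> 'g \<Rightarrow> 'k::field) ring"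
  where "drinfeld_double G =
    \<lparr>carrier = {x. \<forall>p. p \<notin> carrier G \<times> carrier G \<longrightarrow> x p = 0},
     monoid.mult = (\<lambda>x y q. \<Sum>(a, b) \<in> carrier G \<times> carrier G. \<Sum>(c, d) \<in> carrier G \<times> carrier G.
       x (a, b) * y (c, d) *
       (if a = b \<otimes>\<^bsub>G\<^esub> c \<otimes>\<^bsub>G\<^esub> inv\<^bsub>G\<^esub> b then unit_at (a, b \<otimes>\<^bsub>G\<^esub> d) q else 0)),
     one = (\<lambda>q. \<Sum>a \<in> carrier G. unit_at (a, \<one>\<^bsub>G\<^esub>) q),
     zero = (\<lambda>_. 0),
     add = (\<lambda>x y q. x q + y q)\<rparr>"

definition double_scalar :: "('g, 'z) monoid_scheme \<Rightarrow> 'k::field \<Rightarrow> ('g \<times> 'g \<Rightarrow> 'k)"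
  where "double_scalar G k = (\<lambda>q. k * \<one>\<^bsub>drinfeld_double G\<^esub> q)"

definition double_counit :: "('g, 'z) monoid_scheme \<Rightarrow> ('g \<times> 'g \<Rightarrow> 'k::field) \<Rightarrow> 'k"
  where "double_counit G x =
    (\<Sum>(a, b) \<in> carrier G \<times> carrier G. x (a, b) * (if a = \<one>\<^bsub>G\<^esub> then 1 else 0))"

definition double_trivial :: "('g, 'z) monoid_scheme \<Rightarrow> ('g \<times> 'g \<Rightarrow> 'k::field, 'k) module"
  where "double_trivial G =
    \<lparr>carrier = UNIV, monoid.mult = undefined, one = undefined, zero = 0, add = (+),
     module.smult = (\<lambda>x k. double_counit G x * k)\<rparr>"

text \<open>The dual \<open>D(G)\<^sup>*\<close> with the left coadjoint action.  A linear form \<open>l\<close> is given by its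
  coefficients with respect to the dual basis \<open>u(a, b)\<close>, that is, by its values on the
  \<open>\<delta>\<^sub>a \<otimes> b\<close>; so \<open>u(a, b)\<close> is again \<open>unit_at (a, b)\<close>.  The action of \<open>\<delta>\<^sub>h \<otimes> g\<close> is obtained from the
  actions of \<open>\<epsilon> \<otimes> g\<close> and \<open>\<delta>\<^sub>h \<otimes> e\<close> by means of \<open>\<delta>\<^sub>h \<otimes> g = (\<delta>\<^sub>h \<otimes> e) (\<epsilon> \<otimes> g)\<close>.\<close>

definition coadjoint_basis ::
    "('g, 'z) monoid_scheme \<Rightarrow> 'g \<times> 'g \<Rightarrow> 'g \<times> 'g \<Rightarrow> ('g \<times> 'g \<Rightarrow> 'k::field)"
  where "coadjoint_basis G = (\<lambda>(h, g) (a, b).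
    let a' = g \<otimes>\<^bsub>G\<^esub> a \<otimes>\<^bsub>G\<^esub> inv\<^bsub>G\<^esub> g; b' = g \<otimes>\<^bsub>G\<^esub> b \<otimes>\<^bsub>G\<^esub> inv\<^bsub>G\<^esub> g
    in if h = inv\<^bsub>G\<^esub> b' \<otimes>\<^bsub>G\<^esub> a' \<otimes>\<^bsub>G\<^esub> b' \<otimes>\<^bsub>G\<^esub> inv\<^bsub>G\<^esub> a' then unit_at (a', b') else (\<lambda>_. 0))"

definition double_dual :: "('g, 'z) monoid_scheme \<Rightarrow> ('g \<times> 'g \<Rightarrow> 'k::field, 'g \<times> 'g \<Rightarrow> 'k) module"
  where "double_dual G =
    \<lparr>carrier = {l. \<forall>p. p \<notin> carrier G \<times> carrier G \<longrightarrow> l p = 0},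
     monoid.mult = undefined, one = undefined,
     zero = (\<lambda>_. 0),
     add = (\<lambda>l l' q. l q + l' q),
     module.smult = (\<lambda>x l q. \<Sum>p \<in> carrier G \<times> carrier G. \<Sum>r \<in> carrier G \<times> carrier G.
       x p * l r * coadjoint_basis G p r q)\<rparr>"

definition T_tilde :: "('g, 'z) monoid_scheme \<Rightarrow> ('g \<times> 'g \<Rightarrow> 'k::field) \<Rightarrow> ('g \<times> 'g \<Rightarrow> 'k)"
  where "T_tilde G =
    (\<lambda>l \<in> carrier (double_dual G). \<lambda>q. \<Sum>(c, d) \<in> carrier G \<times> carrier G.
       l (c, d) * unit_at (c, c \<otimes>\<^bsub>G\<^esub> d) q)"

definition S_tilde :: "('g, 'z) monoid_scheme \<Rightarrow> ('g \<times> 'g \<Rightarrow> 'k::field) \<Rightarrow> ('g \<times> 'g \<Rightarrow> 'k)"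
  where "S_tilde G =
    (\<lambda>l \<in> carrier (double_dual G). \<lambda>q. \<Sum>(c, d) \<in> carrier G \<times> carrier G.
       l (c, d) * unit_at (d, inv\<^bsub>G\<^esub> d \<otimes>\<^bsub>G\<^esub> inv\<^bsub>G\<^esub> c \<otimes>\<^bsub>G\<^esub> d) q)"


section \<open>Representations over the field \<open>'k\<close>\<close>

text \<open>A representation is a pair consisting of a vector space and an action.\<close>

type_synonym ('g, 'k, 'v) rep = "('k, 'v) module \<times> ('g \<Rightarrow> 'v \<Rightarrow> 'v)"

definition is_rep :: "('g, 'z) monoid_scheme \<Rightarrow> ('g, 'k::field, 'v) rep \<Rightarrow> bool"
  where "is_rep \<Gamma> = (\<lambda>(V, \<rho>).
    left_module (ring_of_type_algebra :: 'k ring) V \<and>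
    (\<forall>g\<in>carrier \<Gamma>. \<rho> g \<in> mod_hom (ring_of_type_algebra :: 'k ring) V V) \<and>
    (\<forall>v\<in>carrier V. \<rho> \<one>\<^bsub>\<Gamma>\<^esub> v = v) \<and>
    (\<forall>g\<in>carrier \<Gamma>. \<forall>h\<in>carrier \<Gamma>. \<forall>v\<in>carrier V. \<rho> (g \<otimes>\<^bsub>\<Gamma>\<^esub> h) v = \<rho> g (\<rho> h v)))"

definition rep_isomorphic ::
    "('g, 'z) monoid_scheme \<Rightarrow> ('g, 'k::field, 'v) rep \<Rightarrow> ('g, 'k, 'w) rep \<Rightarrow> bool"
  where "rep_isomorphic \<Gamma> = (\<lambda>(V, \<rho>) (W, \<sigma>).
    \<exists>\<phi> \<in> mod_hom (ring_of_type_algebra :: 'k ring) V W.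
      bij_betw \<phi> (carrier V) (carrier W) \<and>
      (\<forall>g\<in>carrier \<Gamma>. \<forall>v\<in>carrier V. \<phi> (\<rho> g v) = \<sigma> g (\<phi> v)))"

definition trivial_rep :: "('g, 'k::field, 'k) rep"
  where "trivial_rep =
    (\<lparr>carrier = UNIV, monoid.mult = undefined, one = undefined, zero = 0, add = (+), module.smult = (*)\<rparr>,
     \<lambda>_ v. v)"

text \<open>The permutation module \<open>'k[Y]\<close> on a \<open>\<Gamma>\<close>-set \<open>Y\<close>: finitely supported functions on \<open>Y\<close>,
  the basis vector \<open>x\<close> being \<open>unit_at x\<close>, which \<open>g\<close> sends to \<open>unit_at (act g x)\<close>.\<close>

definition perm_rep :: "'x set \<Rightarrow> ('g \<Rightarrow> 'x \<Rightarrow> 'x) \<Rightarrow> ('g, 'k::field, 'x \<Rightarrow> 'k) rep"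
  where "perm_rep Y act =
    (let C = {v. finite {x. v x \<noteq> 0} \<and> {x. v x \<noteq> 0} \<subseteq> Y} in
     (\<lparr>carrier = C, monoid.mult = undefined, one = undefined,
       zero = (\<lambda>_. 0), add = (\<lambda>v w x. v x + w x), module.smult = (\<lambda>k v x. k * v x)\<rparr>,
      \<lambda>g. \<lambda>v\<in>C. \<lambda>y. \<Sum>x | v x \<noteq> 0. v x * unit_at (act g x) y))"

definition rep_sum ::
    "('g, 'k::field, 'v) rep \<Rightarrow> ('g, 'k, 'w) rep \<Rightarrow> ('g, 'k, 'v \<times> 'w) rep"  (infixr \<open>\<oplus>\<^sub>r\<close> 65)
  where "rep_sum = (\<lambda>(V, \<rho>) (W, \<sigma>).
    (\<lparr>carrier = carrier V \<times> carrier W, monoid.mult = undefined, one = undefined,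
      zero = (\<zero>\<^bsub>V\<^esub>, \<zero>\<^bsub>W\<^esub>),
      add = (\<lambda>(v, w) (v', w'). (v \<oplus>\<^bsub>V\<^esub> v', w \<oplus>\<^bsub>W\<^esub> w')),
      module.smult = (\<lambda>k (v, w). (k \<odot>\<^bsub>V\<^esub> v, k \<odot>\<^bsub>W\<^esub> w))\<rparr>,
     \<lambda>g. \<lambda>(v, w) \<in> carrier V \<times> carrier W. (\<rho> g v, \<sigma> g w)))"


section \<open>The modular group and its action on projective lines\<close>

definition SL2Z :: "(int ^ 2 ^ 2) monoid"
  where "SL2Z = \<lparr>carrier = {A. det A = 1}, monoid.mult = (**), one = mat 1\<rparr>"

definition T_mat :: "int ^ 2 ^ 2"
  where "T_mat = vector [vector [1, 1], vector [0, 1]]"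

definition S_mat :: "int ^ 2 ^ 2"
  where "S_mat = vector [vector [0, -1], vector [1, 0]]"

text \<open>The elements of \<open>\<int>/n\<close> are represented by \<open>0, \<dots>, n - 1\<close>.\<close>

definition vec_mod :: "int \<Rightarrow> int ^ 2 \<Rightarrow> int ^ 2"
  where "vec_mod n v = (\<chi> i. v $ i mod n)"

text \<open>For prime \<open>n\<close>, the one-dimensional subspaces of \<open>(\<int>/n)\<^sup>2\<close>, that is, the spans of the nonzero
  vectors.\<close>

definition proj_line :: "int \<Rightarrow> (int ^ 2) set set"
  where "proj_line n = {{vec_mod n (k *s v) | k. k \<in> {0..<n}} | v. v \<in> range (vec_mod n) \<and> v \<noteq> 0}"

definition proj_line_act :: "int \<Rightarrow> int ^ 2 ^ 2 \<Rightarrow> (int ^ 2) set \<Rightarrow> (int ^ 2) set"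
  where "proj_line_act n A U = (\<lambda>v. vec_mod n (A *v v)) ` U"


section \<open>The derived block spaces of the torus\<close>

text \<open>\<open>\<Z>\<^sup>m(\<Sigma>\<^sub>1) = Ext\<^sup>m\<^sub>D(K, L)\<close> for \<open>D = D(G)\<close> and \<open>L = D\<^sup>*\<close>, where \<open>(P, d)\<close> is a
  projective resolution of the trivial module.\<close>

definition torus_block_space ::
    "('g, 'z) monoid_scheme \<Rightarrow> (nat \<Rightarrow> ('g \<times> 'g \<Rightarrow> 'k::field, 'p) module) \<Rightarrow> (nat \<Rightarrow> 'p \<Rightarrow> 'p) \<Rightarrow> nat
      \<Rightarrow> ('k, ('p \<Rightarrow> 'g \<times> 'g \<Rightarrow> 'k) set) module"
  where "torus_block_space G P d m =
    ext_module (double_scalar G) (drinfeld_double G) P d m (double_dual G)"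

text \<open>Because \<open>T_mat\<close> and \<open>S_mat\<close> generate \<open>SL2Z\<close>, this determines \<open>\<rho>\<close> on \<open>SL2Z\<close>.\<close>

definition mapping_class_action ::
    "('g, 'z) monoid_scheme \<Rightarrow> (nat \<Rightarrow> ('g \<times> 'g \<Rightarrow> 'k::field, 'p) module) \<Rightarrow> (nat \<Rightarrow> 'p \<Rightarrow> 'p) \<Rightarrow> nat
      \<Rightarrow> (int ^ 2 ^ 2 \<Rightarrow> ('p \<Rightarrow> 'g \<times> 'g \<Rightarrow> 'k) set \<Rightarrow> ('p \<Rightarrow> 'g \<times> 'g \<Rightarrow> 'k) set) \<Rightarrow> bool"
  where "mapping_class_action G P d m \<rho> \<longleftrightarrow>
    is_rep SL2Z (torus_block_space G P d m, \<rho>) \<and>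
    \<rho> T_mat = ext_map (double_scalar G) (drinfeld_double G) P d m (double_dual G) (T_tilde G) \<and>
    \<rho> S_mat = ext_map (double_scalar G) (drinfeld_double G) P d m (double_dual G) (S_tilde G)"

end

theory Submission
  imports Defs
begin

text \<open>
  Write \<open>\<delta>\<^sub>e\<close> for the unit mass at the neutral element.  The algebra \<open>D = D(S\<^sub>3)\<close> contains the
  integral \<open>\<Lambda> = \<delta>\<^sub>e \<otimes> \<Sum>g\<close> (\<open>g\<close> in \<open>S\<^sub>3\<close>), which satisfies \<open>a \<Lambda> = \<Lambda> a = \<epsilon>(a) \<Lambda>\<close>, and the element
  \<open>f = \<delta>\<^sub>e \<otimes> \<Sum>g\<close> (\<open>g\<close> in \<open>A\<^sub>3\<close>).  In characteristic 2 the order of \<open>A\<^sub>3\<close> is 1 in \<open>K\<close>, so \<open>f\<close> is a central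
  idempotent, and \<open>f D = K f + K \<Lambda>\<close> with \<open>\<Lambda>\<^sup>2 = 6 \<Lambda> = 0\<close> is a copy of the group algebra of \<open>C\<^sub>2\<close>.
  Hence \<open>K\<close> has the periodic projective resolution
  \<open>\<dots> \<rightarrow> f D \<rightarrow> f D \<rightarrow> f D \<rightarrow> K\<close>, all of whose differentials are multiplication by \<open>\<Lambda>\<close>.
  For a \<open>D\<close>-module \<open>N\<close> put \<open>Z = {v. f v = v \<and> \<Lambda> v = 0}\<close>, which is the space of invariants
  \<open>Hom(K, N)\<close>.  Then \<open>Ext\<^sup>0(K, N) = Z\<close> and \<open>Ext\<^sup>m(K, N) = Z / \<Lambda> N\<close> for \<open>m > 0\<close>, naturally in \<open>N\<close>.
  For an arbitrary projective resolution \<open>P\<close> this identification is evaluation of cocycles at certain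
  elements \<open>x\<^sub>m\<close> of \<open>P\<^sub>m\<close>; this is \<open>ext_evaluation\<close>, and \<open>ext_classification\<close> puts it in the form
  in which it is applied.

  For \<open>N = L\<close> the space \<open>Z\<close> consists of the functions on commuting pairs \<open>(a, b)\<close> that are invariant
  under simultaneous conjugation.  A commuting pair of \<open>S\<^sub>3\<close> is the neutral pair, or it is conjugate to
  \<open>(t\<^sup>y, t\<^sup>x)\<close> with a fixed transposition \<open>t\<close> and \<open>(x, y)\<close> nonzero modulo 2, or it is \<open>(c\<^sup>y, c\<^sup>x)\<close> with a
  fixed 3-cycle \<open>c\<close> and \<open>(x, y)\<close> nonzero modulo 3.  Conjugation by \<open>t\<close> identifies \<open>(x, y)\<close> with
  \<open>(-x, -y)\<close> in the last case, so the orbits are one point, the points of the projective line modulo 2, and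
  the points of the projective line modulo 3.  The maps \<open>T_tilde\<close> and \<open>S_tilde\<close> act on the column of exponents
  \<open>(x, y)\<close> through the matrices \<open>T_mat\<close> and \<open>S_mat\<close>, so that \<open>Z\<close> is the sum of three permutation modules.
  This is the result in degree 0.  The element \<open>\<Lambda>\<close> sends the basis vector of a commuting pair to the sum of
  its orbit times the order of its stabiliser.  These orders are 6, 2 and 3, so in characteristic 2 the
  subspace \<open>\<Lambda> L\<close> of \<open>Z\<close> is exactly the third summand (\<open>integral_multiple_iff\<close>), and it is lost in positive
  degrees.

  Finally, \<open>T_mat\<close> and \<open>S_mat\<close> generate the modular group.  Therefore an action on the block space with the
  prescribed values on them is unique, and transporting the permutation action shows that it exists
  (\<open>SL2Z_rep_from_generators\<close>).
\<close>

section \<open>Linear maps\<close>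

lemma mod_hom_closed: "f \<in> mod_hom R M N \<Longrightarrow> x \<in> carrier M \<Longrightarrow> f x \<in> carrier N"
  by (auto simp: mod_hom_def)

lemma mod_hom_add:
  "f \<in> mod_hom R M N \<Longrightarrow> x \<in> carrier M \<Longrightarrow> y \<in> carrier M \<Longrightarrow> f (x \<oplus>\<^bsub>M\<^esub> y) = f x \<oplus>\<^bsub>N\<^esub> f y"
  by (auto simp: mod_hom_def)

lemma mod_hom_smult:
  "f \<in> mod_hom R M N \<Longrightarrow> r \<in> carrier R \<Longrightarrow> x \<in> carrier M \<Longrightarrow> f (r \<odot>\<^bsub>M\<^esub> x) = r \<odot>\<^bsub>N\<^esub> f x"
  by (auto simp: mod_hom_def)

lemma mod_hom_ext:
  assumes "f \<in> mod_hom R M N" "g \<in> mod_hom R M N" "\<And>x. x \<in> carrier M \<Longrightarrow> f x = g x"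
  shows "f = g"
  using assms by (auto simp: mod_hom_def intro: PiE_ext)

lemma mod_homI:
  assumes "\<And>x y. x \<in> carrier M \<Longrightarrow> y \<in> carrier M \<Longrightarrow> x \<oplus>\<^bsub>M\<^esub> y \<in> carrier M"
    and "\<And>r x. r \<in> carrier R \<Longrightarrow> x \<in> carrier M \<Longrightarrow> r \<odot>\<^bsub>M\<^esub> x \<in> carrier M"
    and "\<And>x. x \<in> carrier M \<Longrightarrow> f x \<in> carrier N"
    and "\<And>x y. x \<in> carrier M \<Longrightarrow> y \<in> carrier M \<Longrightarrow> f (x \<oplus>\<^bsub>M\<^esub> y) = f x \<oplus>\<^bsub>N\<^esub> f y"
    and "\<And>r x. r \<in> carrier R \<Longrightarrow> x \<in> carrier M \<Longrightarrow> f (r \<odot>\<^bsub>M\<^esub> x) = r \<odot>\<^bsub>N\<^esub> f x"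
  shows "restrict f (carrier M) \<in> mod_hom R M N"
  using assms by (auto simp: mod_hom_def)

lemma left_module_abelian_group: "left_module R M \<Longrightarrow> abelian_group M"
  by (simp add: left_module_def)

lemma left_module_ring: "left_module R M \<Longrightarrow> ring R"
  by (simp add: left_module_def)

lemma left_module_add_closed:
  "left_module R M \<Longrightarrow> x \<in> carrier M \<Longrightarrow> y \<in> carrier M \<Longrightarrow> x \<oplus>\<^bsub>M\<^esub> y \<in> carrier M"
  by (simp add: left_module_abelian_group abelian_group.axioms(1) abelian_monoid.a_closed)

lemma left_module_mod_homI:
  assumes "left_module R M"
    and "\<And>x. x \<in> carrier M \<Longrightarrow> f x \<in> carrier N"
    and "\<And>x y. x \<in> carrier M \<Longrightarrow> y \<in> carrier M \<Longrightarrow> f (x \<oplus>\<^bsub>M\<^esub> y) = f x \<oplus>\<^bsub>N\<^esub> f y"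
    and "\<And>r x. r \<in> carrier R \<Longrightarrow> x \<in> carrier M \<Longrightarrow> f (r \<odot>\<^bsub>M\<^esub> x) = r \<odot>\<^bsub>N\<^esub> f x"
  shows "restrict f (carrier M) \<in> mod_hom R M N"
  using assms by (intro mod_homI) (auto intro: left_module_add_closed left_module.lsmult_closed)

lemma mod_hom_compose:
  assumes "left_module R M" "f \<in> mod_hom R M N" "g \<in> mod_hom R N N'"
  shows "compose (carrier M) g f \<in> mod_hom R M N'"
  unfolding compose_def using assms
  by (intro left_module_mod_homI)
    (auto simp: mod_hom_closed[OF assms(2)] mod_hom_closed[OF assms(3)]
      mod_hom_add[OF assms(2)] mod_hom_add[OF assms(3)] mod_hom_smult[OF assms(2)] mod_hom_smult[OF assms(3)])

lemma mod_hom_group_hom: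
  assumes "left_module R M" "left_module R N" "f \<in> mod_hom R M N"
  shows "abelian_group_hom M N f"
proof -
  interpret M: abelian_group M by (rule left_module_abelian_group) fact
  interpret N: abelian_group N by (rule left_module_abelian_group) fact
  show ?thesis
    using assms(3) M.a_group N.a_group M.abelian_group_axioms N.abelian_group_axioms
    by (intro abelian_group_homI group_hom.intro group_hom_axioms.intro)
      (auto simp: hom_def mod_hom_closed mod_hom_add)
qed

lemma mod_hom_zero:
  assumes "left_module R M" "left_module R N" "f \<in> mod_hom R M N"
  shows "f \<zero>\<^bsub>M\<^esub> = \<zero>\<^bsub>N\<^esub>"
  using abelian_group_hom.hom_zero[OF mod_hom_group_hom[OF assms]] .

lemma mod_hom_minus:
  assumes "left_module R M" "left_module R N" "f \<in> mod_hom R M N" "x \<in> carrier M" "y \<in> carrier M"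
  shows "f (x \<ominus>\<^bsub>M\<^esub> y) = f x \<ominus>\<^bsub>N\<^esub> f y"
proof -
  interpret abelian_group_hom M N f by (rule mod_hom_group_hom) fact+
  show ?thesis using assms(4,5) by (simp add: a_minus_def)
qed

context left_module
begin

lemma smult_zero_r: "r \<in> carrier R \<Longrightarrow> r \<odot>\<^bsub>M\<^esub> \<zero>\<^bsub>M\<^esub> = \<zero>\<^bsub>M\<^esub>"
  by (metis M.add.r_cancel_one' M.l_zero M.zero_closed lsmult_closed lsmult_r_distr)

lemma smult_zero_l: "x \<in> carrier M \<Longrightarrow> \<zero> \<odot>\<^bsub>M\<^esub> x = \<zero>\<^bsub>M\<^esub>"
  by (metis M.add.r_cancel_one' R.l_zero R.zero_closed lsmult_closed lsmult_l_distr)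

lemma smult_uminus_l: "r \<in> carrier R \<Longrightarrow> x \<in> carrier M \<Longrightarrow> (\<ominus> r) \<odot>\<^bsub>M\<^esub> x = \<ominus>\<^bsub>M\<^esub> (r \<odot>\<^bsub>M\<^esub> x)"
  by (metis M.minus_equality R.a_inv_closed R.l_neg lsmult_closed lsmult_l_distr smult_zero_l)

lemma smult_minus_l:
  "r \<in> carrier R \<Longrightarrow> q \<in> carrier R \<Longrightarrow> x \<in> carrier M \<Longrightarrow>
    (r \<ominus> q) \<odot>\<^bsub>M\<^esub> x = r \<odot>\<^bsub>M\<^esub> x \<ominus>\<^bsub>M\<^esub> q \<odot>\<^bsub>M\<^esub> x"
  by (simp add: a_minus_def lsmult_l_distr smult_uminus_l)

lemma smult_uminus_r: "r \<in> carrier R \<Longrightarrow> x \<in> carrier M \<Longrightarrow> r \<odot>\<^bsub>M\<^esub> (\<ominus>\<^bsub>M\<^esub> x) = \<ominus>\<^bsub>M\<^esub> (r \<odot>\<^bsub>M\<^esub> x)"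
  by (metis M.add.inv_closed M.l_neg M.minus_equality lsmult_closed lsmult_r_distr smult_zero_r)

lemma smult_minus_r:
  "r \<in> carrier R \<Longrightarrow> x \<in> carrier M \<Longrightarrow> y \<in> carrier M \<Longrightarrow>
    r \<odot>\<^bsub>M\<^esub> (x \<ominus>\<^bsub>M\<^esub> y) = r \<odot>\<^bsub>M\<^esub> x \<ominus>\<^bsub>M\<^esub> r \<odot>\<^bsub>M\<^esub> y"
  by (simp add: a_minus_def lsmult_r_distr smult_uminus_r)

lemma smult_finsum:
  assumes "finite S" "r \<in> carrier R" "\<And>i. i \<in> S \<Longrightarrow> x i \<in> carrier M"
  shows "r \<odot>\<^bsub>M\<^esub> finsum M x S = finsum M (\<lambda>i. r \<odot>\<^bsub>M\<^esub> x i) S"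
  using assms
proof (induction S rule: finite_induct)
  case empty
  then show ?case by (simp add: smult_zero_r)
next
  case (insert i S)
  have "finsum M x S \<in> carrier M" using insert by (auto intro!: M.finsum_closed)
  then show ?case using insert by (simp add: lsmult_closed lsmult_r_distr Pi_def)
qed

end

lemma mod_hom_diff:
  assumes "left_module R N" "left_module R N'" "g \<in> mod_hom R N N'" "g' \<in> mod_hom R N N'"
  shows "restrict (\<lambda>y. g y \<ominus>\<^bsub>N'\<^esub> g' y) (carrier N) \<in> mod_hom R N N'"
proof -
  interpret N': left_module R N' by fact
  show ?thesis
  proof (rule left_module_mod_homI[OF assms(1)])
    fix x y assume "x \<in> carrier N" "y \<in> carrier N"
    then show "g (x \<oplus>\<^bsub>N\<^esub> y) \<ominus>\<^bsub>N'\<^esub> g' (x \<oplus>\<^bsub>N\<^esub> y) =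
        (g x \<ominus>\<^bsub>N'\<^esub> g' x) \<oplus>\<^bsub>N'\<^esub> (g y \<ominus>\<^bsub>N'\<^esub> g' y)"
      using mod_hom_closed[OF assms(3)] mod_hom_closed[OF assms(4)]
      by (simp add: mod_hom_add[OF assms(3)] mod_hom_add[OF assms(4)] a_minus_def
          N'.M.minus_add N'.M.a_ac)
  next
    fix r x assume "r \<in> carrier R" "x \<in> carrier N"
    then show "g (r \<odot>\<^bsub>N\<^esub> x) \<ominus>\<^bsub>N'\<^esub> g' (r \<odot>\<^bsub>N\<^esub> x) = r \<odot>\<^bsub>N'\<^esub> (g x \<ominus>\<^bsub>N'\<^esub> g' x)"
      using mod_hom_closed[OF assms(3)] mod_hom_closed[OF assms(4)]
      by (simp add: mod_hom_smult[OF assms(3)] mod_hom_smult[OF assms(4)] N'.smult_minus_r)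
  qed (use assms in \<open>auto simp: mod_hom_closed\<close>)
qed

lemma (in abelian_group) minus_zero_right: "x \<in> carrier G \<Longrightarrow> x \<ominus> \<zero> = x"
  using add.inv_one by (simp add: minus_eq)

lemma (in abelian_group) eq_add_if_minus_minus_zero:
  assumes "\<zero> = (a \<ominus> b) \<ominus> c" "a \<in> carrier G" "b \<in> carrier G" "c \<in> carrier G"
  shows "a = b \<oplus> c"
proof -
  have "a = ((a \<ominus> b) \<ominus> c) \<oplus> (b \<oplus> c)"
    using assms(2-4) by (simp add: minus_eq a_ac r_neg r_neg1 r_neg2)
  then show ?thesis using assms by (metis a_closed l_zero)
qed

section \<open>Lifting along projective modules\<close>

definition free_unit :: "('r, 'a) ring_scheme \<Rightarrow> 'i set \<Rightarrow> 'i \<Rightarrow> ('i \<Rightarrow> 'r)"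
  where "free_unit R I i = (\<lambda>j\<in>I. if j = i then \<one>\<^bsub>R\<^esub> else \<zero>\<^bsub>R\<^esub>)"

text \<open>The linear map out of a free module that sends the basis element \<open>i\<close> to \<open>a i\<close>.\<close>

definition free_extension ::
    "('r, 'm, 'b) module_scheme \<Rightarrow> ('r, 'a) ring_scheme \<Rightarrow> 'i set \<Rightarrow> ('i \<Rightarrow> 'm) \<Rightarrow> ('i \<Rightarrow> 'r) \<Rightarrow> 'm"
  where "free_extension A R I a =
    (\<lambda>x\<in>carrier (free_module R I). finsum A (\<lambda>i. x i \<odot>\<^bsub>A\<^esub> a i) {i \<in> I. x i \<noteq> \<zero>\<^bsub>R\<^esub>})"

context ring
begin

lemma free_module_add_closed:
  assumes "x \<in> carrier (free_module R I)" "y \<in> carrier (free_module R I)"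
  shows "x \<oplus>\<^bsub>free_module R I\<^esub> y \<in> carrier (free_module R I)"
proof -
  have "{i \<in> I. x i \<oplus> y i \<noteq> \<zero>} \<subseteq> {i \<in> I. x i \<noteq> \<zero>} \<union> {i \<in> I. y i \<noteq> \<zero>}"
    by auto
  moreover have "{i \<in> I. (x \<oplus>\<^bsub>free_module R I\<^esub> y) i \<noteq> \<zero>} = {i \<in> I. x i \<oplus> y i \<noteq> \<zero>}"
    by (auto simp: free_module_def)
  ultimately have "finite {i \<in> I. (x \<oplus>\<^bsub>free_module R I\<^esub> y) i \<noteq> \<zero>}"
    using assms by (auto simp: free_module_def intro: finite_subset)
  then show ?thesis using assms by (auto simp: free_module_def)
qed

lemma free_module_smult_closed:
  assumes "r \<in> carrier R" "x \<in> carrier (free_module R I)"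
  shows "r \<odot>\<^bsub>free_module R I\<^esub> x \<in> carrier (free_module R I)"
proof -
  have "{i \<in> I. r \<otimes> x i \<noteq> \<zero>} \<subseteq> {i \<in> I. x i \<noteq> \<zero>}"
    using assms by auto
  moreover have "{i \<in> I. (r \<odot>\<^bsub>free_module R I\<^esub> x) i \<noteq> \<zero>} = {i \<in> I. r \<otimes> x i \<noteq> \<zero>}"
    by (auto simp: free_module_def)
  ultimately have "finite {i \<in> I. (r \<odot>\<^bsub>free_module R I\<^esub> x) i \<noteq> \<zero>}"
    using assms by (auto simp: free_module_def intro: finite_subset)
  then show ?thesis using assms by (auto simp: free_module_def)
qed

lemma free_unit_closed: "free_unit R I i \<in> carrier (free_module R I)"
proof -
  have "finite {j \<in> I. free_unit R I i j \<noteq> \<zero>}"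
    by (rule finite_subset[of _ "{i}"]) (auto simp: free_unit_def)
  then show ?thesis by (auto simp: free_module_def free_unit_def)
qed

text \<open>By induction on the support: an element is a multiple of one basis element plus an element with
  smaller support.\<close>

lemma free_module_hom_eqI:
  assumes F: "F \<in> mod_hom R (free_module R I) B" and G: "G \<in> mod_hom R (free_module R I) B"
    and B: "left_module R B"
    and eq: "\<And>i. i \<in> I \<Longrightarrow> F (free_unit R I i) = G (free_unit R I i)"
    and x: "x \<in> carrier (free_module R I)"
  shows "F x = G x"
proof -
  let ?F = "free_module R I"
  interpret B: left_module R B by fact
  have zero: "H (\<lambda>i\<in>I. \<zero>) = \<zero>\<^bsub>B\<^esub>" if H: "H \<in> mod_hom R ?F B" for H
  proof -
    have z: "(\<lambda>i\<in>I. \<zero>) \<in> carrier ?F" by (auto simp: free_module_def)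
    have "(\<lambda>i\<in>I. \<zero>) = \<zero> \<odot>\<^bsub>?F\<^esub> (\<lambda>i\<in>I. \<zero>)" by (auto simp: free_module_def)
    then have "H (\<lambda>i\<in>I. \<zero>) = \<zero> \<odot>\<^bsub>B\<^esub> H (\<lambda>i\<in>I. \<zero>)"
      using mod_hom_smult[OF H _ z] by (metis zero_closed)
    then show ?thesis using mod_hom_closed[OF H z] by (simp add: B.smult_zero_l)
  qed
  have "F x = G x" if "finite S" "x \<in> carrier ?F" "{i \<in> I. x i \<noteq> \<zero>} \<subseteq> S" for S x
    using that
  proof (induction S arbitrary: x rule: finite_induct)
    case empty
    then have "x = (\<lambda>i\<in>I. \<zero>)"
      by (intro extensionalityI[of _ I]) (auto simp: free_module_def PiE_def)
    then show ?case using zero[OF F] zero[OF G] by metis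
  next
    case (insert i S)
    show ?case
    proof (cases "i \<in> I")
      case False
      then show ?thesis using insert by (intro insert.IH) auto
    next
      case True
      define x' where "x' = (\<lambda>j\<in>I. if j = i then \<zero> else x j)"
      have xc: "x j \<in> carrier R" if "j \<in> I" for j
        using insert.prems(1) that by (auto simp: free_module_def)
      have sub: "{j \<in> I. x' j \<noteq> \<zero>} \<subseteq> {j \<in> I. x j \<noteq> \<zero>}"
        by (auto simp: x'_def)
      then have "finite {j \<in> I. x' j \<noteq> \<zero>}"
        using insert.prems(1) by (auto simp: free_module_def intro: finite_subset)
      then have x': "x' \<in> carrier ?F"
        using xc by (auto simp: free_module_def x'_def)
      have "{j \<in> I. x' j \<noteq> \<zero>} \<subseteq> S"
        using insert.prems(2) by (auto simp: x'_def)
      then have IH: "F x' = G x'" by (rule insert.IH[OF x'])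
      have e: "x i \<odot>\<^bsub>?F\<^esub> free_unit R I i \<in> carrier ?F"
        using xc[OF True] free_unit_closed by (rule free_module_smult_closed)
      have "x = x' \<oplus>\<^bsub>?F\<^esub> (x i \<odot>\<^bsub>?F\<^esub> free_unit R I i)"
        using insert.prems(1) xc True
        by (intro extensionalityI[of _ I]) (auto simp: free_module_def x'_def free_unit_def PiE_def)
      then have "H x = H x' \<oplus>\<^bsub>B\<^esub> x i \<odot>\<^bsub>B\<^esub> H (free_unit R I i)" if "H \<in> mod_hom R ?F B" for H
        using mod_hom_add[OF that x' e] mod_hom_smult[OF that xc[OF True] free_unit_closed] by metis
      from this[OF F] this[OF G] show ?thesis using IH eq[OF True] by simp
    qed
  qed
  from this[of "{i \<in> I. x i \<noteq> \<zero>}" x] x show ?thesis by (auto simp: free_module_def)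
qed

end

text \<open>Summation over a set that contains the support makes the formula additive, because it allows the same
  set to be used for both summands.\<close>

lemma free_extension_superset:
  assumes "left_module R A" "\<And>i. i \<in> I \<Longrightarrow> a i \<in> carrier A" "x \<in> carrier (free_module R I)"
    and "finite S" "S \<subseteq> I" "{i \<in> I. x i \<noteq> \<zero>\<^bsub>R\<^esub>} \<subseteq> S"
  shows "free_extension A R I a x = finsum A (\<lambda>i. x i \<odot>\<^bsub>A\<^esub> a i) S"
proof -
  interpret A: left_module R A by fact
  have xc: "x j \<in> carrier R" if "j \<in> I" for j
    using assms(3) that by (auto simp: free_module_def)
  show ?thesis unfolding free_extension_def using assms xc
    by (simp, intro A.M.add.finprod_mono_neutral_cong_left) (auto simp: A.smult_zero_l A.lsmult_closed)
qed

lemma free_extension_hom: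
  assumes A: "left_module R A" and a: "\<And>i. i \<in> I \<Longrightarrow> a i \<in> carrier A"
  shows "free_extension A R I a \<in> mod_hom R (free_module R I) A"
proof -
  let ?F = "free_module R I"
  interpret A: left_module R A by fact
  note ext = free_extension_superset[OF A a]
  have xc: "x j \<in> carrier R" if "x \<in> carrier ?F" "j \<in> I" for j x
    using that by (auto simp: free_module_def)
  have fin: "finite {i \<in> I. x i \<noteq> \<zero>\<^bsub>R\<^esub>}" if "x \<in> carrier ?F" for x
    using that by (auto simp: free_module_def)
  have "restrict (free_extension A R I a) (carrier ?F) \<in> mod_hom R ?F A"
  proof (rule mod_homI)
    fix x y assume xy: "x \<in> carrier ?F" "y \<in> carrier ?F"
    let ?S = "{i \<in> I. x i \<noteq> \<zero>\<^bsub>R\<^esub>} \<union> {i \<in> I. y i \<noteq> \<zero>\<^bsub>R\<^esub>}"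
    have S: "finite ?S" "?S \<subseteq> I" using fin[OF xy(1)] fin[OF xy(2)] by auto
    have xyc: "x \<oplus>\<^bsub>?F\<^esub> y \<in> carrier ?F" by (rule A.R.free_module_add_closed) fact+
    have sum: "(x \<oplus>\<^bsub>?F\<^esub> y) i = x i \<oplus>\<^bsub>R\<^esub> y i" if "i \<in> I" for i
      using that by (simp add: free_module_def)
    show "x \<oplus>\<^bsub>?F\<^esub> y \<in> carrier ?F" by fact
    have "free_extension A R I a (x \<oplus>\<^bsub>?F\<^esub> y) = finsum A (\<lambda>i. (x \<oplus>\<^bsub>?F\<^esub> y) i \<odot>\<^bsub>A\<^esub> a i) ?S"
      using xyc S sum by (intro ext) auto
    also have "\<dots> = finsum A (\<lambda>i. x i \<odot>\<^bsub>A\<^esub> a i \<oplus>\<^bsub>A\<^esub> y i \<odot>\<^bsub>A\<^esub> a i) ?S"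
      using S xc xy a by (intro A.M.finsum_cong') (auto simp: sum A.lsmult_l_distr A.lsmult_closed)
    also have "\<dots> = finsum A (\<lambda>i. x i \<odot>\<^bsub>A\<^esub> a i) ?S \<oplus>\<^bsub>A\<^esub> finsum A (\<lambda>i. y i \<odot>\<^bsub>A\<^esub> a i) ?S"
      using S xc xy a by (intro A.M.finsum_addf) (auto simp: A.lsmult_closed)
    also have "\<dots> = free_extension A R I a x \<oplus>\<^bsub>A\<^esub> free_extension A R I a y"
      using ext[OF _ xy(1) S] ext[OF _ xy(2) S] by auto
    finally show "free_extension A R I a (x \<oplus>\<^bsub>?F\<^esub> y) =
        free_extension A R I a x \<oplus>\<^bsub>A\<^esub> free_extension A R I a y" .
  next
    fix r x assume r: "r \<in> carrier R" and x: "x \<in> carrier ?F"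
    let ?S = "{i \<in> I. x i \<noteq> \<zero>\<^bsub>R\<^esub>}"
    have S: "finite ?S" "?S \<subseteq> I" using fin[OF x] by auto
    have rx: "r \<odot>\<^bsub>?F\<^esub> x \<in> carrier ?F" by (rule A.R.free_module_smult_closed) fact+
    have sum: "(r \<odot>\<^bsub>?F\<^esub> x) i = r \<otimes>\<^bsub>R\<^esub> x i" if "i \<in> I" for i
      using that by (simp add: free_module_def)
    show "r \<odot>\<^bsub>?F\<^esub> x \<in> carrier ?F" by fact
    have "free_extension A R I a (r \<odot>\<^bsub>?F\<^esub> x) = finsum A (\<lambda>i. (r \<odot>\<^bsub>?F\<^esub> x) i \<odot>\<^bsub>A\<^esub> a i) ?S"
      using rx S sum r by (intro ext) auto
    also have "\<dots> = finsum A (\<lambda>i. r \<odot>\<^bsub>A\<^esub> (x i \<odot>\<^bsub>A\<^esub> a i)) ?S"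
      using S xc x a r by (intro A.M.finsum_cong') (auto simp: sum A.lsmult_assoc A.lsmult_closed)
    also have "\<dots> = r \<odot>\<^bsub>A\<^esub> finsum A (\<lambda>i. x i \<odot>\<^bsub>A\<^esub> a i) ?S"
      using S xc x a r by (intro A.smult_finsum[symmetric]) (auto simp: A.lsmult_closed)
    also have "\<dots> = r \<odot>\<^bsub>A\<^esub> free_extension A R I a x"
      using ext[OF _ x S] by auto
    finally show "free_extension A R I a (r \<odot>\<^bsub>?F\<^esub> x) = r \<odot>\<^bsub>A\<^esub> free_extension A R I a x" .
  next
    fix x assume x: "x \<in> carrier ?F"
    show "free_extension A R I a x \<in> carrier A"
      using x xc[OF x] a by (auto simp: free_extension_def A.lsmult_closed intro!: A.M.finsum_closed)
  qed
  then show ?thesis by (simp add: free_extension_def)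
qed

lemma free_extension_unit:
  assumes A: "left_module R A" and a: "\<And>i. i \<in> I \<Longrightarrow> a i \<in> carrier A" and i: "i \<in> I"
  shows "free_extension A R I a (free_unit R I i) = a i"
proof -
  interpret A: left_module R A by fact
  have "free_extension A R I a (free_unit R I i) =
      finsum A (\<lambda>j. free_unit R I i j \<odot>\<^bsub>A\<^esub> a j) {i}"
    using A.R.free_unit_closed i by (intro free_extension_superset[OF A a]) (auto simp: free_unit_def)
  also have "\<dots> = free_unit R I i i \<odot>\<^bsub>A\<^esub> a i"
    using i a by (simp add: free_unit_def A.lsmult_one)
  finally show ?thesis using i a by (simp add: free_unit_def A.lsmult_one)
qed

text \<open>For a free module one lifts the images of the basis elements; a direct summand inherits the property.
  Only the image of \<open>g\<close> has to lie in the image of \<open>p\<close>, which is the form needed when lifting into an exact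
  sequence.\<close>

lemma projective_lift:
  fixes P :: "('r, 'p) module"
  assumes P: "projective_module R P" and A: "left_module R A" and B: "left_module R B"
    and p: "p \<in> mod_hom R A B" and g: "g \<in> mod_hom R P B"
    and im: "\<And>x. x \<in> carrier P \<Longrightarrow> g x \<in> p ` carrier A"
  obtains h where "h \<in> mod_hom R P A" "\<And>x. x \<in> carrier P \<Longrightarrow> p (h x) = g x"
proof -
  interpret A: left_module R A by fact
  have Pm: "left_module R P" using P by (simp add: projective_module_def)
  obtain I :: "'p set" and \<iota> \<pi> where \<iota>: "\<iota> \<in> mod_hom R P (free_module R I)"
    and \<pi>: "\<pi> \<in> mod_hom R (free_module R I) P" and \<pi>\<iota>: "\<And>x. x \<in> carrier P \<Longrightarrow> \<pi> (\<iota> x) = x"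
    using P unfolding projective_module_def by blast
  let ?F = "free_module R I"
  have "\<exists>y\<in>carrier A. p y = g (\<pi> (free_unit R I i))" for i
    using im[OF mod_hom_closed[OF \<pi> A.R.free_unit_closed], of i] by auto
  then obtain a where a: "\<And>i. a i \<in> carrier A" "\<And>i. p (a i) = g (\<pi> (free_unit R I i))"
    by metis
  let ?H = "free_extension A R I a"
  have H: "?H \<in> mod_hom R ?F A" using A a by (intro free_extension_hom)
  have pH: "restrict (\<lambda>x. p (?H x)) (carrier ?F) \<in> mod_hom R ?F B"
    using A.R.free_module_add_closed A.R.free_module_smult_closed
    by (intro mod_homI) (auto simp: mod_hom_closed[OF H] mod_hom_closed[OF p] mod_hom_add[OF H]
        mod_hom_add[OF p] mod_hom_smult[OF H] mod_hom_smult[OF p])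
  have g\<pi>: "restrict (\<lambda>x. g (\<pi> x)) (carrier ?F) \<in> mod_hom R ?F B"
    using A.R.free_module_add_closed A.R.free_module_smult_closed
    by (intro mod_homI) (auto simp: mod_hom_closed[OF \<pi>] mod_hom_closed[OF g] mod_hom_add[OF \<pi>]
        mod_hom_add[OF g] mod_hom_smult[OF \<pi>] mod_hom_smult[OF g])
  have eq: "p (?H x) = g (\<pi> x)" if "x \<in> carrier ?F" for x
    using A.R.free_module_hom_eqI[OF pH g\<pi> B _ that] that
    by (simp add: A.R.free_unit_closed free_extension_unit[OF A] a)
  show thesis
  proof
    show "compose (carrier P) ?H \<iota> \<in> mod_hom R P A"
      using Pm \<iota> H by (rule mod_hom_compose)
    show "p (compose (carrier P) ?H \<iota> x) = g x" if "x \<in> carrier P" for x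
      using that eq[OF mod_hom_closed[OF \<iota> that]] \<pi>\<iota> by (simp add: compose_def)
  qed
qed

section \<open>Null-homotopies\<close>

locale resolved_module =
  fixes R :: "('r, 'a) ring_scheme" and P :: "nat \<Rightarrow> ('r, 'p) module" and d :: "nat \<Rightarrow> 'p \<Rightarrow> 'p"
    and aug :: "'p \<Rightarrow> 'x" and M :: "('r, 'x) module"
  assumes resolution: "projective_resolution R P d aug M" and M: "left_module R M"
begin

lemma projective: "projective_module R (P n)"
  using resolution by (simp add: projective_resolution_def)

lemma P: "left_module R (P n)"
  using projective by (simp add: projective_module_def)

lemma d: "d n \<in> mod_hom R (P (Suc n)) (P n)"
  using resolution by (simp add: projective_resolution_def)

lemma aug: "aug \<in> mod_hom R (P 0) M"
  using resolution by (simp add: projective_resolution_def)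

lemma aug_surj: "z \<in> carrier M \<Longrightarrow> \<exists>y\<in>carrier (P 0). aug y = z"
  using resolution unfolding projective_resolution_def by (metis imageE)

lemma exact_0: "y \<in> carrier (P 0) \<Longrightarrow> y \<in> d 0 ` carrier (P (Suc 0)) \<longleftrightarrow> aug y = \<zero>\<^bsub>M\<^esub>"
  using resolution by (simp add: projective_resolution_def a_kernel_def')

lemma exact_Suc:
  "y \<in> carrier (P (Suc n)) \<Longrightarrow> y \<in> d (Suc n) ` carrier (P (Suc (Suc n))) \<longleftrightarrow> d n y = \<zero>\<^bsub>P n\<^esub>"
  using resolution by (simp add: projective_resolution_def a_kernel_def')

lemma aug_d: "y \<in> carrier (P (Suc 0)) \<Longrightarrow> aug (d 0 y) = \<zero>\<^bsub>M\<^esub>"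
  using exact_0[OF mod_hom_closed[OF d]] by blast

lemma d_d: "y \<in> carrier (P (Suc (Suc n))) \<Longrightarrow> d n (d (Suc n) y) = \<zero>\<^bsub>P n\<^esub>"
  using exact_Suc[OF mod_hom_closed[OF d]] by blast

text \<open>An endomorphism of a projective resolution that covers the zero map is null-homotopic.  The homotopy is
  built degree by degree: the difference between \<open>\<psi>\<close> and the part of the homotopy already constructed takes
  values in cycles, hence in boundaries, and so lifts along \<open>d\<close>.\<close>

lemma null_homotopy:
  assumes \<psi>: "\<And>n. \<psi> n \<in> mod_hom R (P n) (P n)"
    and chain: "\<And>n y. y \<in> carrier (P (Suc n)) \<Longrightarrow> d n (\<psi> (Suc n) y) = \<psi> n (d n y)"
    and aug_\<psi>: "\<And>y. y \<in> carrier (P 0) \<Longrightarrow> aug (\<psi> 0 y) = \<zero>\<^bsub>M\<^esub>"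
  obtains h where "\<And>n. h n \<in> mod_hom R (P n) (P (Suc n))"
    and "\<And>y. y \<in> carrier (P 0) \<Longrightarrow> d 0 (h 0 y) = \<psi> 0 y"
    and "\<And>n y. y \<in> carrier (P (Suc n)) \<Longrightarrow>
      d (Suc n) (h (Suc n) y) = \<psi> (Suc n) y \<ominus>\<^bsub>P (Suc n)\<^esub> h n (d n y)"
proof -
  \<comment> \<open>The second clause is what makes the next difference take values in cycles.\<close>
  define J where "J n h \<longleftrightarrow> h \<in> mod_hom R (P n) (P (Suc n)) \<and>
    (\<forall>y\<in>carrier (P (Suc n)). d n (h (d n y)) = \<psi> n (d n y)) \<and>
    (n = 0 \<longrightarrow> (\<forall>y\<in>carrier (P 0). d 0 (h y) = \<psi> 0 y))" for n h
  define Q where "Q n h h' \<longleftrightarrow> (\<forall>y\<in>carrier (P (Suc n)).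
    d (Suc n) (h' y) = \<psi> (Suc n) y \<ominus>\<^bsub>P (Suc n)\<^esub> h (d n y))" for n h h'
  have "\<exists>h. \<forall>n. J n (h n) \<and> Q n (h n) (h (Suc n))"
  proof (rule dependent_nat_choice)
    have "\<psi> 0 y \<in> d 0 ` carrier (P (Suc 0))" if "y \<in> carrier (P 0)" for y
      using that exact_0 aug_\<psi> mod_hom_closed[OF \<psi>] by blast
    from projective_lift[OF projective P P d \<psi> this]
    obtain h where "h \<in> mod_hom R (P 0) (P (Suc 0))"
      and "\<And>y. y \<in> carrier (P 0) \<Longrightarrow> d 0 (h y) = \<psi> 0 y"
      by blast
    then show "\<exists>h. J 0 h" using mod_hom_closed[OF d, of _ 0] by (auto simp: J_def)
  next
    fix h n assume J: "J n h"
    interpret Pn: left_module R "P n" by (rule P)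
    interpret Pn1: left_module R "P (Suc n)" by (rule P)
    have h: "h \<in> mod_hom R (P n) (P (Suc n))" using J by (simp add: J_def)
    have hd: "compose (carrier (P (Suc n))) h (d n) \<in> mod_hom R (P (Suc n)) (P (Suc n))"
      using P d h by (rule mod_hom_compose)
    let ?g = "restrict (\<lambda>y. \<psi> (Suc n) y \<ominus>\<^bsub>P (Suc n)\<^esub> compose (carrier (P (Suc n))) h (d n) y)
      (carrier (P (Suc n)))"
    have g: "?g \<in> mod_hom R (P (Suc n)) (P (Suc n))"
      by (rule mod_hom_diff[OF P P \<psi> hd])
    have geq: "?g y = \<psi> (Suc n) y \<ominus>\<^bsub>P (Suc n)\<^esub> h (d n y)" if "y \<in> carrier (P (Suc n))" for y
      using that by (simp add: compose_def)
    have "?g y \<in> d (Suc n) ` carrier (P (Suc (Suc n)))" if y: "y \<in> carrier (P (Suc n))" for y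
    proof -
      have hdy: "h (d n y) \<in> carrier (P (Suc n))"
        using y mod_hom_closed[OF d] mod_hom_closed[OF h] by blast
      have c: "\<psi> n (d n y) \<in> carrier (P n)"
        using y mod_hom_closed[OF d] mod_hom_closed[OF \<psi>] by blast
      have "d n (?g y) = d n (\<psi> (Suc n) y) \<ominus>\<^bsub>P n\<^esub> d n (h (d n y))"
        unfolding geq[OF y] by (rule mod_hom_minus[OF P P d mod_hom_closed[OF \<psi> y] hdy])
      also have "\<dots> = \<psi> n (d n y) \<ominus>\<^bsub>P n\<^esub> \<psi> n (d n y)"
        using J y chain by (simp add: J_def)
      also have "\<dots> = \<zero>\<^bsub>P n\<^esub>" using c by (simp add: a_minus_def Pn.M.r_neg)
      finally show ?thesis using exact_Suc[OF mod_hom_closed[OF g y]] by simp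
    qed
    from projective_lift[OF projective P P d g this]
    obtain h' where h': "h' \<in> mod_hom R (P (Suc n)) (P (Suc (Suc n)))"
      and dh': "\<And>y. y \<in> carrier (P (Suc n)) \<Longrightarrow> d (Suc n) (h' y) = ?g y"
      by blast
    have "d (Suc n) (h' (d (Suc n) y)) = \<psi> (Suc n) (d (Suc n) y)"
      if y: "y \<in> carrier (P (Suc (Suc n)))" for y
    proof -
      have dy: "d (Suc n) y \<in> carrier (P (Suc n))" using y mod_hom_closed[OF d] by blast
      show ?thesis
        using dh'[OF dy] geq[OF dy] d_d[OF y] mod_hom_zero[OF P P h] mod_hom_closed[OF \<psi> dy]
        by (simp add: a_minus_def)
    qed
    then have "J (Suc n) h'" using h' by (simp add: J_def)
    moreover have "Q n h h'" using dh' geq by (simp add: Q_def)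
    ultimately show "\<exists>h'. J (Suc n) h' \<and> Q n h h'" by blast
  qed
  then obtain h where "\<And>n. J n (h n)" "\<And>n. Q n (h n) (h (Suc n))" by blast
  then show thesis by (intro that[of h]) (auto simp: J_def Q_def)
qed

end

section \<open>Modules with a periodic resolution\<close>

definition regular_module :: "('r, 'a) ring_scheme \<Rightarrow> ('r, 'r) module"
  where "regular_module R = \<lparr>carrier = carrier R, monoid.mult = undefined, one = undefined,
    zero = \<zero>\<^bsub>R\<^esub>, add = (\<oplus>\<^bsub>R\<^esub>), module.smult = (\<otimes>\<^bsub>R\<^esub>)\<rparr>"

lemma regular_module_simps [simp]:
  "carrier (regular_module R) = carrier R" "\<zero>\<^bsub>regular_module R\<^esub> = \<zero>\<^bsub>R\<^esub>"
  "x \<oplus>\<^bsub>regular_module R\<^esub> y = x \<oplus>\<^bsub>R\<^esub> y" "x \<odot>\<^bsub>regular_module R\<^esub> y = x \<otimes>\<^bsub>R\<^esub> y"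
  by (simp_all add: regular_module_def)

lemma (in ring) left_module_regular: "left_module R (regular_module R)"
proof -
  have "abelian_group (regular_module R)"
    by (rule abelian_groupI) (auto simp: a_ac intro: l_neg)
  then show ?thesis
    by (intro left_module.intro left_module_axioms.intro ring_axioms)
      (auto simp: l_distr r_distr m_assoc)
qed

text \<open>The conditions say that \<open>\<dots> \<rightarrow> f R \<rightarrow> f R \<rightarrow> f R \<rightarrow> M\<close> is a resolution of \<open>M\<close>, where the
  augmentation is \<open>a \<mapsto> a z\<close> and all other maps are multiplication by the central element \<open>s\<close>.  The pair
  \<open>(P, d)\<close> is any projective resolution of the same module; the two are compared below.\<close>

locale periodic_resolution = resolved_module R P d aug M
  for R :: "('r, 'a) ring_scheme" (structure) and P :: "nat \<Rightarrow> ('r, 'p) module" and d aug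
    and M :: "('r, 'x) module" +
  fixes z :: 'x and f s :: 'r
  assumes z: "z \<in> carrier M" and generator: "y \<in> carrier M \<Longrightarrow> \<exists>a\<in>carrier R. y = a \<odot>\<^bsub>M\<^esub> z"
    and f: "f \<in> carrier R" and f_central: "a \<in> carrier R \<Longrightarrow> f \<otimes> a = a \<otimes> f"
    and f_idem: "f \<otimes> f = f" and f_z: "f \<odot>\<^bsub>M\<^esub> z = z"
    and s: "s \<in> carrier R" and s_central: "a \<in> carrier R \<Longrightarrow> s \<otimes> a = a \<otimes> s"
    and f_s: "f \<otimes> s = s" and s_s: "s \<otimes> s = \<zero>" and s_z: "s \<odot>\<^bsub>M\<^esub> z = \<zero>\<^bsub>M\<^esub>"
    and annihilator_z: "a \<in> carrier R \<Longrightarrow> f \<otimes> a = a \<Longrightarrow> a \<odot>\<^bsub>M\<^esub> z = \<zero>\<^bsub>M\<^esub> \<Longrightarrow> \<exists>b\<in>carrier R. a = s \<otimes> b"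
    and annihilator_s: "a \<in> carrier R \<Longrightarrow> f \<otimes> a = a \<Longrightarrow> s \<otimes> a = \<zero> \<Longrightarrow> \<exists>b\<in>carrier R. a = s \<otimes> b"
begin

lemma R: "ring R"
  using M by (rule left_module_ring)

text \<open>A chain map from the periodic resolution to \<open>P\<close> is given by the images \<open>x n\<close> of the generators \<open>f\<close>.
  The next one exists because \<open>s x n\<close> is a cycle, by \<open>s s = 0\<close>.\<close>

lemma cycle_sequence:
  obtains x where "\<And>n. x n \<in> carrier (P n)" "\<And>n. f \<odot>\<^bsub>P n\<^esub> x n = x n" "aug (x 0) = z"
    "\<And>n. d n (x (Suc n)) = s \<odot>\<^bsub>P n\<^esub> x n"
proof -
  interpret ring R by (rule R)
  interpret M: left_module R M by (rule M)
  define J where "J n x \<longleftrightarrow> x \<in> carrier (P n) \<and> f \<odot>\<^bsub>P n\<^esub> x = x \<and> (n = 0 \<longrightarrow> aug x = z) \<and>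
    s \<odot>\<^bsub>P n\<^esub> x \<in> d n ` carrier (P (Suc n))" for n x
  define Q where "Q n x x' \<longleftrightarrow> d n x' = s \<odot>\<^bsub>P n\<^esub> x" for n x x'
  have fixed: "f \<odot>\<^bsub>P n\<^esub> (f \<odot>\<^bsub>P n\<^esub> x) = f \<odot>\<^bsub>P n\<^esub> x" if "x \<in> carrier (P n)" for n x
    using left_module.lsmult_assoc[OF P f f that] by (simp add: f_idem)
  have "\<exists>x. \<forall>n. J n (x n) \<and> Q n (x n) (x (Suc n))"
  proof (rule dependent_nat_choice)
    interpret P0: left_module R "P 0" by (rule P)
    obtain y where y: "y \<in> carrier (P 0)" "aug y = z" using aug_surj z by blast
    let ?x = "f \<odot>\<^bsub>P 0\<^esub> y"
    have x: "?x \<in> carrier (P 0)" using y f P0.lsmult_closed by blast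
    have augx: "aug ?x = z" using mod_hom_smult[OF aug f y(1)] y f_z by simp
    have "aug (s \<odot>\<^bsub>P 0\<^esub> ?x) = \<zero>\<^bsub>M\<^esub>" using mod_hom_smult[OF aug s x] augx s_z by simp
    then have "s \<odot>\<^bsub>P 0\<^esub> ?x \<in> d 0 ` carrier (P (Suc 0))"
      using exact_0 P0.lsmult_closed[OF s x] by blast
    then show "\<exists>x. J 0 x" using x augx fixed[OF y(1)] by (auto simp: J_def)
  next
    fix x n assume J: "J n x"
    interpret Pn: left_module R "P n" by (rule P)
    interpret Pn1: left_module R "P (Suc n)" by (rule P)
    obtain y where y: "y \<in> carrier (P (Suc n))" "d n y = s \<odot>\<^bsub>P n\<^esub> x"
      using J by (auto simp: J_def)
    have x: "x \<in> carrier (P n)" using J by (simp add: J_def)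
    let ?x = "f \<odot>\<^bsub>P (Suc n)\<^esub> y"
    have x': "?x \<in> carrier (P (Suc n))" using y f Pn1.lsmult_closed by blast
    have dx': "d n ?x = s \<odot>\<^bsub>P n\<^esub> x"
      using mod_hom_smult[OF d f y(1)] y(2) Pn.lsmult_assoc[OF f s x] f_s by simp
    have "d n (s \<odot>\<^bsub>P (Suc n)\<^esub> ?x) = s \<odot>\<^bsub>P n\<^esub> (s \<odot>\<^bsub>P n\<^esub> x)"
      using mod_hom_smult[OF d s x'] dx' by simp
    also have "\<dots> = \<zero>\<^bsub>P n\<^esub>"
      using Pn.lsmult_assoc[OF s s x] by (simp add: s_s Pn.smult_zero_l x)
    finally have "s \<odot>\<^bsub>P (Suc n)\<^esub> ?x \<in> d (Suc n) ` carrier (P (Suc (Suc n)))"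
      using exact_Suc Pn1.lsmult_closed[OF s x'] by blast
    then show "\<exists>x'. J (Suc n) x' \<and> Q n x x'" using x' dx' fixed[OF y(1)] by (auto simp: J_def Q_def)
  qed
  then obtain x where "\<And>n. J n (x n)" "\<And>n. Q n (x n) (x (Suc n))" by blast
  then show thesis by (intro that[of x]) (auto simp: J_def Q_def)
qed

lemma f_multiple_hom:
  assumes "\<alpha> \<in> mod_hom R N (regular_module R)" "left_module R N"
  shows "restrict (\<lambda>y. f \<otimes> \<alpha> y) (carrier N) \<in> mod_hom R N (regular_module R)"
proof -
  interpret ring R by (rule R)
  have c: "\<alpha> y \<in> carrier R" if "y \<in> carrier N" for y
    using mod_hom_closed[OF assms(1) that] by simp
  have "f \<otimes> (r \<otimes> \<alpha> y) = r \<otimes> (f \<otimes> \<alpha> y)" if "r \<in> carrier R" "y \<in> carrier N" for r y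
    using that c f f_central[OF that(1)] by (simp add: m_assoc[symmetric])
  then show ?thesis
    using f c by (intro left_module_mod_homI[OF assms(2)])
      (auto simp: mod_hom_add[OF assms(1)] mod_hom_smult[OF assms(1)] r_distr)
qed

text \<open>A chain map from \<open>P\<close> back to the periodic resolution.  Multiplying a lift by \<open>f\<close> moves its values into
  the summand \<open>f R\<close> without disturbing the chain condition, since \<open>f s = s\<close>.\<close>

lemma comparison_sequence:
  obtains \<alpha> where "\<And>n. \<alpha> n \<in> mod_hom R (P n) (regular_module R)"
    "\<And>n y. y \<in> carrier (P n) \<Longrightarrow> f \<otimes> \<alpha> n y = \<alpha> n y"
    "\<And>y. y \<in> carrier (P 0) \<Longrightarrow> \<alpha> 0 y \<odot>\<^bsub>M\<^esub> z = aug y"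
    "\<And>n y. y \<in> carrier (P (Suc n)) \<Longrightarrow> s \<otimes> \<alpha> (Suc n) y = \<alpha> n (d n y)"
proof -
  interpret ring R by (rule R)
  interpret M: left_module R M by (rule M)
  note reg = left_module_regular
  define J where "J n \<alpha> \<longleftrightarrow> \<alpha> \<in> mod_hom R (P n) (regular_module R) \<and>
    (\<forall>y\<in>carrier (P n). f \<otimes> \<alpha> y = \<alpha> y) \<and> (n = 0 \<longrightarrow> (\<forall>y\<in>carrier (P 0). \<alpha> y \<odot>\<^bsub>M\<^esub> z = aug y)) \<and>
    (\<forall>y\<in>carrier (P (Suc n)). \<exists>b\<in>carrier R. \<alpha> (d n y) = s \<otimes> b)" for n \<alpha>
  define Q where "Q n \<alpha> \<alpha>' \<longleftrightarrow> (\<forall>y\<in>carrier (P (Suc n)). s \<otimes> \<alpha>' y = \<alpha> (d n y))"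
    for n and \<alpha> \<alpha>' :: "'p \<Rightarrow> 'r"
  have idem: "f \<otimes> (f \<otimes> a) = f \<otimes> a" if "a \<in> carrier R" for a
    using that f by (simp add: m_assoc[symmetric] f_idem)
  have "\<exists>\<alpha>. \<forall>n. J n (\<alpha> n) \<and> Q n (\<alpha> n) (\<alpha> (Suc n))"
  proof (rule dependent_nat_choice)
    let ?p = "restrict (\<lambda>a. a \<odot>\<^bsub>M\<^esub> z) (carrier (regular_module R))"
    have p: "?p \<in> mod_hom R (regular_module R) M"
      using z by (intro left_module_mod_homI[OF reg])
        (auto simp: M.lsmult_closed M.lsmult_l_distr M.lsmult_assoc)
    have "aug y \<in> ?p ` carrier (regular_module R)" if "y \<in> carrier (P 0)" for y
      using generator[OF mod_hom_closed[OF aug that]] by auto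
    from projective_lift[OF projective reg M p aug this]
    obtain \<beta> where \<beta>: "\<beta> \<in> mod_hom R (P 0) (regular_module R)"
      and p\<beta>: "\<And>y. y \<in> carrier (P 0) \<Longrightarrow> ?p (\<beta> y) = aug y"
      by blast
    have c: "\<beta> y \<in> carrier R" if "y \<in> carrier (P 0)" for y
      using mod_hom_closed[OF \<beta> that] by simp
    let ?\<alpha> = "restrict (\<lambda>y. f \<otimes> \<beta> y) (carrier (P 0))"
    have \<alpha>: "?\<alpha> \<in> mod_hom R (P 0) (regular_module R)" using \<beta> P by (rule f_multiple_hom)
    have aug_\<alpha>: "?\<alpha> y \<odot>\<^bsub>M\<^esub> z = aug y" if y: "y \<in> carrier (P 0)" for y
    proof -
      have "?\<alpha> y \<odot>\<^bsub>M\<^esub> z = (\<beta> y \<otimes> f) \<odot>\<^bsub>M\<^esub> z" using y c by (simp add: f_central)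
      also have "\<dots> = \<beta> y \<odot>\<^bsub>M\<^esub> z" using y c f z f_z by (simp add: M.lsmult_assoc)
      finally show ?thesis using p\<beta>[OF y] y c by simp
    qed
    have "\<exists>b\<in>carrier R. ?\<alpha> (d 0 y) = s \<otimes> b" if y: "y \<in> carrier (P (Suc 0))" for y
    proof (rule annihilator_z)
      have dy: "d 0 y \<in> carrier (P 0)" using y mod_hom_closed[OF d] by blast
      show "?\<alpha> (d 0 y) \<in> carrier R" "f \<otimes> ?\<alpha> (d 0 y) = ?\<alpha> (d 0 y)"
        using dy c f by (simp_all add: idem)
      show "?\<alpha> (d 0 y) \<odot>\<^bsub>M\<^esub> z = \<zero>\<^bsub>M\<^esub>" using aug_\<alpha>[OF dy] aug_d[OF y] by simp
    qed
    then show "\<exists>\<alpha>. J 0 \<alpha>" using \<alpha> aug_\<alpha> idem c by (intro exI[of _ ?\<alpha>]) (simp add: J_def)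
  next
    fix \<alpha> n assume J: "J n \<alpha>"
    have \<alpha>: "\<alpha> \<in> mod_hom R (P n) (regular_module R)" using J by (simp add: J_def)
    let ?p = "restrict (\<lambda>a. s \<otimes> a) (carrier (regular_module R))"
    have p: "?p \<in> mod_hom R (regular_module R) (regular_module R)"
      using s by (intro left_module_mod_homI[OF reg]) (auto simp: r_distr s_central m_assoc)
    have \<alpha>d: "compose (carrier (P (Suc n))) \<alpha> (d n) \<in> mod_hom R (P (Suc n)) (regular_module R)"
      using P d \<alpha> by (rule mod_hom_compose)
    have "compose (carrier (P (Suc n))) \<alpha> (d n) y \<in> ?p ` carrier (regular_module R)"
      if "y \<in> carrier (P (Suc n))" for y
      using J that by (auto simp: J_def compose_def)
    from projective_lift[OF projective reg reg p \<alpha>d this]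
    obtain \<beta> where \<beta>: "\<beta> \<in> mod_hom R (P (Suc n)) (regular_module R)"
      and p\<beta>: "\<And>y. y \<in> carrier (P (Suc n)) \<Longrightarrow> ?p (\<beta> y) = compose (carrier (P (Suc n))) \<alpha> (d n) y"
      by blast
    have c: "\<beta> y \<in> carrier R" if "y \<in> carrier (P (Suc n))" for y
      using mod_hom_closed[OF \<beta> that] by simp
    let ?\<alpha>' = "restrict (\<lambda>y. f \<otimes> \<beta> y) (carrier (P (Suc n)))"
    have \<alpha>': "?\<alpha>' \<in> mod_hom R (P (Suc n)) (regular_module R)" using \<beta> P by (rule f_multiple_hom)
    have s\<alpha>': "s \<otimes> ?\<alpha>' y = \<alpha> (d n y)" if y: "y \<in> carrier (P (Suc n))" for y
    proof -
      have "s \<otimes> ?\<alpha>' y = f \<otimes> s \<otimes> \<beta> y"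
        using y c f s by (simp add: m_assoc[symmetric] s_central)
      also have "\<dots> = \<alpha> (d n y)" using p\<beta>[OF y] y c by (simp add: f_s compose_def)
      finally show ?thesis .
    qed
    have "\<exists>b\<in>carrier R. ?\<alpha>' (d (Suc n) y) = s \<otimes> b" if y: "y \<in> carrier (P (Suc (Suc n)))" for y
    proof (rule annihilator_s)
      have dy: "d (Suc n) y \<in> carrier (P (Suc n))" using y mod_hom_closed[OF d] by blast
      show "?\<alpha>' (d (Suc n) y) \<in> carrier R" "f \<otimes> ?\<alpha>' (d (Suc n) y) = ?\<alpha>' (d (Suc n) y)"
        using dy c f by (simp_all add: idem)
      show "s \<otimes> ?\<alpha>' (d (Suc n) y) = \<zero>"
        using s\<alpha>'[OF dy] d_d[OF y] mod_hom_zero[OF P reg \<alpha>] by simp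
    qed
    then have "J (Suc n) ?\<alpha>'" using \<alpha>' idem c by (simp add: J_def)
    moreover have "Q n \<alpha> ?\<alpha>'" using s\<alpha>' by (simp add: Q_def)
    ultimately show "\<exists>\<alpha>'. J (Suc n) \<alpha>' \<and> Q n \<alpha> \<alpha>'" by blast
  qed
  then obtain \<alpha> where "\<And>n. J n (\<alpha> n)" "\<And>n. Q n (\<alpha> n) (\<alpha> (Suc n))" by blast
  then show thesis by (intro that[of \<alpha>]) (auto simp: J_def Q_def)
qed

text \<open>Evaluation at \<open>x m\<close> identifies cocycles modulo coboundaries with the cohomology of the complex
  \<open>f N \<rightarrow> f N \<rightarrow> f N \<rightarrow> \<dots>\<close> with differential \<open>s\<close>.  With the comparison map \<open>\<alpha>\<close>, a cocycle with value \<open>v\<close>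
  is \<open>y \<mapsto> \<alpha> m y v\<close>, because \<open>\<alpha> m (x m)\<close> and \<open>f\<close> differ by a multiple of \<open>s\<close>.  Conversely
  \<open>y \<mapsto> y - \<alpha> n y x n\<close> covers the zero map and is null-homotopic, so a cocycle \<open>g\<close> is cohomologous to
  \<open>y \<mapsto> \<alpha> m y g (x m)\<close>.\<close>

theorem ext_evaluation:
  obtains x where "\<And>n. x n \<in> carrier (P n)"
    "\<And>m (N :: ('r, 'e) module) g. left_module R N \<Longrightarrow> g \<in> cocycles R P d m N \<Longrightarrow>
      f \<odot>\<^bsub>N\<^esub> g (x m) = g (x m) \<and> s \<odot>\<^bsub>N\<^esub> g (x m) = \<zero>\<^bsub>N\<^esub>"
    "\<And>m (N :: ('r, 'e) module) v. left_module R N \<Longrightarrow> v \<in> carrier N \<Longrightarrow> f \<odot>\<^bsub>N\<^esub> v = v \<Longrightarrow> s \<odot>\<^bsub>N\<^esub> v = \<zero>\<^bsub>N\<^esub> \<Longrightarrow>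
      \<exists>g\<in>cocycles R P d m N. g (x m) = v"
    "\<And>(N :: ('r, 'e) module) g. left_module R N \<Longrightarrow> g \<in> cocycles R P d 0 N \<Longrightarrow>
      g \<in> coboundaries R P d 0 N \<longleftrightarrow> g (x 0) = \<zero>\<^bsub>N\<^esub>"
    "\<And>m (N :: ('r, 'e) module) g. left_module R N \<Longrightarrow> g \<in> cocycles R P d (Suc m) N \<Longrightarrow>
      g \<in> coboundaries R P d (Suc m) N \<longleftrightarrow> (\<exists>w\<in>carrier N. g (x (Suc m)) = s \<odot>\<^bsub>N\<^esub> w)"
proof -
  interpret ring R by (rule R)
  interpret M: left_module R M by (rule M)
  note reg = left_module_regular
  obtain x where x: "\<And>n. x n \<in> carrier (P n)" and fx: "\<And>n. f \<odot>\<^bsub>P n\<^esub> x n = x n"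
    and aug_x: "aug (x 0) = z" and dx: "\<And>n. d n (x (Suc n)) = s \<odot>\<^bsub>P n\<^esub> x n"
    using cycle_sequence by blast
  obtain \<alpha> where \<alpha>: "\<And>n. \<alpha> n \<in> mod_hom R (P n) (regular_module R)"
    and f\<alpha>: "\<And>n y. y \<in> carrier (P n) \<Longrightarrow> f \<otimes> \<alpha> n y = \<alpha> n y"
    and \<alpha>z: "\<And>y. y \<in> carrier (P 0) \<Longrightarrow> \<alpha> 0 y \<odot>\<^bsub>M\<^esub> z = aug y"
    and s\<alpha>: "\<And>n y. y \<in> carrier (P (Suc n)) \<Longrightarrow> s \<otimes> \<alpha> (Suc n) y = \<alpha> n (d n y)"
    using comparison_sequence by blast
  have \<alpha>c: "\<alpha> n y \<in> carrier R" if "y \<in> carrier (P n)" for n y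
    using mod_hom_closed[OF \<alpha> that] by simp
  have mult_hom: "restrict (\<lambda>y. \<alpha> n y \<odot>\<^bsub>N\<^esub> v) (carrier (P n)) \<in> mod_hom R (P n) N"
    if "left_module R N" "v \<in> carrier N" for n N v
    using that \<alpha>c
    by (intro left_module_mod_homI[OF P])
      (auto simp: mod_hom_add[OF \<alpha>] mod_hom_smult[OF \<alpha>] left_module.lsmult_closed
        left_module.lsmult_l_distr left_module.lsmult_assoc)
  \<comment> \<open>The composite of the two comparison maps is the identity of the periodic resolution up to multiples of \<open>s\<close>.\<close>
  have \<alpha>x: "\<exists>b\<in>carrier R. \<alpha> n (x n) \<ominus> f = s \<otimes> b" for n
  proof (induction n)
    case 0
    show ?case
    proof (rule annihilator_z)
      show "\<alpha> 0 (x 0) \<ominus> f \<in> carrier R" using \<alpha>c x f by simp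
      show "f \<otimes> (\<alpha> 0 (x 0) \<ominus> f) = \<alpha> 0 (x 0) \<ominus> f"
        using \<alpha>c[OF x] f f\<alpha>[OF x] f_idem by (simp add: a_minus_def r_distr r_minus)
      show "(\<alpha> 0 (x 0) \<ominus> f) \<odot>\<^bsub>M\<^esub> z = \<zero>\<^bsub>M\<^esub>"
        using \<alpha>c[OF x] f z f_z \<alpha>z[OF x] aug_x
        by (simp add: M.smult_minus_l) (simp add: a_minus_def M.M.r_neg)
    qed
  next
    case (Suc n)
    then obtain b where b: "b \<in> carrier R" "\<alpha> n (x n) \<ominus> f = s \<otimes> b" by blast
    have sb: "s \<otimes> (s \<otimes> b) = \<zero>" using b s s_s by (simp add: m_assoc[symmetric])
    have "s \<otimes> \<alpha> (Suc n) (x (Suc n)) = s \<otimes> \<alpha> n (x n)"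
      using s\<alpha>[OF x, of n] dx[of n] mod_hom_smult[OF \<alpha> s x, of n] by simp
    moreover have "s \<otimes> (\<alpha> n (x n) \<ominus> f) = \<zero>" using sb b by simp
    ultimately have "s \<otimes> (\<alpha> (Suc n) (x (Suc n)) \<ominus> f) = \<zero>"
      using \<alpha>c[OF x] s f by (simp add: a_minus_def r_distr r_minus)
    moreover have "f \<otimes> (\<alpha> (Suc n) (x (Suc n)) \<ominus> f) = \<alpha> (Suc n) (x (Suc n)) \<ominus> f"
      using \<alpha>c[OF x] f f\<alpha>[OF x] f_idem by (simp add: a_minus_def r_distr r_minus)
    ultimately show ?case using \<alpha>c[OF x] f by (intro annihilator_s) simp_all
  qed
  \<comment> \<open>The inner restrictions exhibit \<open>\<psi> n\<close> as a difference of two elements of \<open>mod_hom\<close>.\<close>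
  define \<psi> where "\<psi> n = restrict (\<lambda>y. (\<lambda>y\<in>carrier (P n). y) y \<ominus>\<^bsub>P n\<^esub>
    (\<lambda>y\<in>carrier (P n). \<alpha> n y \<odot>\<^bsub>P n\<^esub> x n) y) (carrier (P n))" for n
  have \<psi>_eq: "\<psi> n y = y \<ominus>\<^bsub>P n\<^esub> \<alpha> n y \<odot>\<^bsub>P n\<^esub> x n" if "y \<in> carrier (P n)" for n y
    using that by (simp add: \<psi>_def)
  have id_hom: "(\<lambda>y\<in>carrier (P n). y) \<in> mod_hom R (P n) (P n)" for n
    by (intro left_module_mod_homI[OF P]) auto
  have \<psi>: "\<psi> n \<in> mod_hom R (P n) (P n)" for n
    unfolding \<psi>_def by (rule mod_hom_diff[OF P P id_hom mult_hom[OF P x]])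
  have \<psi>_chain: "d n (\<psi> (Suc n) y) = \<psi> n (d n y)" if y: "y \<in> carrier (P (Suc n))" for n y
  proof -
    interpret Pn: left_module R "P n" by (rule P)
    interpret Pn1: left_module R "P (Suc n)" by (rule P)
    have dy: "d n y \<in> carrier (P n)" using y mod_hom_closed[OF d] by blast
    have "d n (\<psi> (Suc n) y) = d n y \<ominus>\<^bsub>P n\<^esub> \<alpha> (Suc n) y \<odot>\<^bsub>P n\<^esub> (s \<odot>\<^bsub>P n\<^esub> x n)"
      using y \<alpha>c[OF y] x
      by (simp add: \<psi>_eq mod_hom_minus[OF P P d] Pn1.lsmult_closed mod_hom_smult[OF d] dx)
    also have "\<alpha> (Suc n) y \<odot>\<^bsub>P n\<^esub> (s \<odot>\<^bsub>P n\<^esub> x n) = \<alpha> n (d n y) \<odot>\<^bsub>P n\<^esub> x n"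
      using s\<alpha>[OF y] s_central[OF \<alpha>c[OF y]] Pn.lsmult_assoc[OF \<alpha>c[OF y] s x] by simp
    finally show ?thesis using dy by (simp add: \<psi>_eq)
  qed
  have \<psi>_aug: "aug (\<psi> 0 y) = \<zero>\<^bsub>M\<^esub>" if y: "y \<in> carrier (P 0)" for y
  proof -
    interpret P0: left_module R "P 0" by (rule P)
    have "aug (\<psi> 0 y) = aug y \<ominus>\<^bsub>M\<^esub> \<alpha> 0 y \<odot>\<^bsub>M\<^esub> z"
      using y \<alpha>c[OF y] x
      by (simp add: \<psi>_eq mod_hom_minus[OF P M aug] P0.lsmult_closed mod_hom_smult[OF aug] aug_x)
    then show ?thesis using \<alpha>z[OF y] mod_hom_closed[OF aug y] by (simp add: a_minus_def M.M.r_neg)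
  qed
  obtain h where h: "\<And>n. h n \<in> mod_hom R (P n) (P (Suc n))"
    and h0: "\<And>y. y \<in> carrier (P 0) \<Longrightarrow> d 0 (h 0 y) = \<psi> 0 y"
    and hS: "\<And>n y. y \<in> carrier (P (Suc n)) \<Longrightarrow>
      d (Suc n) (h (Suc n) y) = \<psi> (Suc n) y \<ominus>\<^bsub>P (Suc n)\<^esub> h n (d n y)"
    using null_homotopy[OF \<psi> \<psi>_chain \<psi>_aug] by blast
  show thesis
  proof (rule that[of x])
    show "x n \<in> carrier (P n)" for n by (rule x)
  next
    fix m and N :: "('r, 'e) module" and g
    assume N: "left_module R N" and g: "g \<in> cocycles R P d m N"
    have gh: "g \<in> mod_hom R (P m) N" and g0: "\<And>y. y \<in> carrier (P (Suc m)) \<Longrightarrow> g (d m y) = \<zero>\<^bsub>N\<^esub>"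
      using g by (auto simp: cocycles_def)
    show "f \<odot>\<^bsub>N\<^esub> g (x m) = g (x m) \<and> s \<odot>\<^bsub>N\<^esub> g (x m) = \<zero>\<^bsub>N\<^esub>"
      using mod_hom_smult[OF gh f x] mod_hom_smult[OF gh s x] fx g0[OF x] dx by simp
  next
    fix m and N :: "('r, 'e) module" and v
    assume N: "left_module R N" and v: "v \<in> carrier N" "f \<odot>\<^bsub>N\<^esub> v = v" "s \<odot>\<^bsub>N\<^esub> v = \<zero>\<^bsub>N\<^esub>"
    interpret N: left_module R N by fact
    let ?g = "restrict (\<lambda>y. \<alpha> m y \<odot>\<^bsub>N\<^esub> v) (carrier (P m))"
    have "?g (d m y) = \<zero>\<^bsub>N\<^esub>" if y: "y \<in> carrier (P (Suc m))" for y
    proof -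
      have "?g (d m y) = (\<alpha> (Suc m) y \<otimes> s) \<odot>\<^bsub>N\<^esub> v"
        using mod_hom_closed[OF d y] s\<alpha>[OF y] s_central[OF \<alpha>c[OF y]] by simp
      then show ?thesis using \<alpha>c[OF y] s v by (simp add: N.lsmult_assoc N.smult_zero_r)
    qed
    then have "?g \<in> cocycles R P d m N" using mult_hom[OF N v(1)] by (simp add: cocycles_def)
    moreover have "?g (x m) = v"
    proof -
      obtain b where b: "b \<in> carrier R" "\<alpha> m (x m) \<ominus> f = s \<otimes> b" using \<alpha>x by blast
      have "\<alpha> m (x m) = f \<oplus> b \<otimes> s"
        using b(2) f s b(1) \<alpha>c[OF x, of m] s_central[OF b(1)]
        by (intro eq_add_if_minus_minus_zero) (simp_all add: minus_eq r_neg)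
      then have "\<alpha> m (x m) \<odot>\<^bsub>N\<^esub> v = v"
        using b f s v by (simp add: N.lsmult_l_distr N.lsmult_assoc N.smult_zero_r)
      then show ?thesis using x by simp
    qed
    ultimately show "\<exists>g\<in>cocycles R P d m N. g (x m) = v" by blast
  next
    fix N :: "('r, 'e) module" and g
    assume N: "left_module R N" and g: "g \<in> cocycles R P d 0 N"
    interpret N: left_module R N by fact
    interpret P0: left_module R "P 0" by (rule P)
    have gh: "g \<in> mod_hom R (P 0) N" and g0: "\<And>y. y \<in> carrier (P (Suc 0)) \<Longrightarrow> g (d 0 y) = \<zero>\<^bsub>N\<^esub>"
      using g by (auto simp: cocycles_def)
    show "g \<in> coboundaries R P d 0 N \<longleftrightarrow> g (x 0) = \<zero>\<^bsub>N\<^esub>"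
    proof
      assume "g (x 0) = \<zero>\<^bsub>N\<^esub>"
      then have "g y = \<zero>\<^bsub>N\<^esub>" if y: "y \<in> carrier (P 0)" for y
        using g0[OF mod_hom_closed[OF h y]] y \<alpha>c[OF y] x mod_hom_closed[OF gh y]
        by (simp add: h0 \<psi>_eq mod_hom_minus[OF P N gh] P0.lsmult_closed mod_hom_smult[OF gh]
            N.smult_zero_r N.M.minus_zero_right)
      then show "g \<in> coboundaries R P d 0 N" using gh by (auto simp: mod_hom_def PiE_def extensional_def)
    qed (use x in simp)
  next
    fix m and N :: "('r, 'e) module" and g
    assume N: "left_module R N" and g: "g \<in> cocycles R P d (Suc m) N"
    interpret N: left_module R N by fact
    interpret Pm: left_module R "P m" by (rule P)
    interpret Pm1: left_module R "P (Suc m)" by (rule P)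
    have gh: "g \<in> mod_hom R (P (Suc m)) N"
      and g0: "\<And>y. y \<in> carrier (P (Suc (Suc m))) \<Longrightarrow> g (d (Suc m) y) = \<zero>\<^bsub>N\<^esub>"
      using g by (auto simp: cocycles_def)
    show "g \<in> coboundaries R P d (Suc m) N \<longleftrightarrow> (\<exists>w\<in>carrier N. g (x (Suc m)) = s \<odot>\<^bsub>N\<^esub> w)"
    proof
      assume "g \<in> coboundaries R P d (Suc m) N"
      then obtain g' where g': "g' \<in> mod_hom R (P m) N" "g = compose (carrier (P (Suc m))) g' (d m)"
        by auto
      then have "g (x (Suc m)) = s \<odot>\<^bsub>N\<^esub> g' (x m)"
        using x by (simp add: compose_def dx mod_hom_smult[OF g'(1) s])
      then show "\<exists>w\<in>carrier N. g (x (Suc m)) = s \<odot>\<^bsub>N\<^esub> w" using mod_hom_closed[OF g'(1) x] by blast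
    next
      assume "\<exists>w\<in>carrier N. g (x (Suc m)) = s \<odot>\<^bsub>N\<^esub> w"
      then obtain w where w: "w \<in> carrier N" "g (x (Suc m)) = s \<odot>\<^bsub>N\<^esub> w" by blast
      \<comment> \<open>Solving \<open>0 = g (d (h y)) = g y - \<alpha> y (s w) - g (h (d y))\<close> for \<open>g y\<close>, with \<open>\<alpha> y s = \<alpha> (d y)\<close>.\<close>
      let ?g' = "restrict (\<lambda>y. \<alpha> m y \<odot>\<^bsub>N\<^esub> w \<oplus>\<^bsub>N\<^esub> g (h m y)) (carrier (P m))"
      have g': "?g' \<in> mod_hom R (P m) N"
      proof (rule left_module_mod_homI[OF P])
        fix y assume y: "y \<in> carrier (P m)"
        show "\<alpha> m y \<odot>\<^bsub>N\<^esub> w \<oplus>\<^bsub>N\<^esub> g (h m y) \<in> carrier N"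
          using \<alpha>c[OF y] w mod_hom_closed[OF gh mod_hom_closed[OF h y]] by (simp add: N.lsmult_closed)
      next
        fix y y' assume y: "y \<in> carrier (P m)" and y': "y' \<in> carrier (P m)"
        note c = mod_hom_closed[OF h y] mod_hom_closed[OF h y']
        note c' = mod_hom_closed[OF gh c(1)] mod_hom_closed[OF gh c(2)]
        show "\<alpha> m (y \<oplus>\<^bsub>P m\<^esub> y') \<odot>\<^bsub>N\<^esub> w \<oplus>\<^bsub>N\<^esub> g (h m (y \<oplus>\<^bsub>P m\<^esub> y')) =
          (\<alpha> m y \<odot>\<^bsub>N\<^esub> w \<oplus>\<^bsub>N\<^esub> g (h m y)) \<oplus>\<^bsub>N\<^esub> (\<alpha> m y' \<odot>\<^bsub>N\<^esub> w \<oplus>\<^bsub>N\<^esub> g (h m y'))"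
          using y y' c c' \<alpha>c[OF y] \<alpha>c[OF y'] w
          by (simp add: mod_hom_add[OF \<alpha>] mod_hom_add[OF h] mod_hom_add[OF gh]
              N.lsmult_l_distr N.lsmult_closed N.M.a_ac)
      next
        fix r y assume r: "r \<in> carrier R" and y: "y \<in> carrier (P m)"
        note c = mod_hom_closed[OF h y]
        show "\<alpha> m (r \<odot>\<^bsub>P m\<^esub> y) \<odot>\<^bsub>N\<^esub> w \<oplus>\<^bsub>N\<^esub> g (h m (r \<odot>\<^bsub>P m\<^esub> y)) =
          r \<odot>\<^bsub>N\<^esub> (\<alpha> m y \<odot>\<^bsub>N\<^esub> w \<oplus>\<^bsub>N\<^esub> g (h m y))"
          using y r c \<alpha>c[OF y] w mod_hom_closed[OF gh c]
          by (simp add: mod_hom_smult[OF \<alpha>] mod_hom_smult[OF h] mod_hom_smult[OF gh]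
              N.lsmult_r_distr N.lsmult_assoc N.lsmult_closed)
      qed
      have "g y = ?g' (d m y)" if y: "y \<in> carrier (P (Suc m))" for y
      proof -
        note dy = mod_hom_closed[OF d y]
        note hdy = mod_hom_closed[OF h dy]
        note c = \<alpha>c[OF y] x[of "Suc m"] mod_hom_closed[OF gh y] mod_hom_closed[OF gh hdy]
        have "\<zero>\<^bsub>N\<^esub> = g (\<psi> (Suc m) y \<ominus>\<^bsub>P (Suc m)\<^esub> h m (d m y))"
          using g0[OF mod_hom_closed[OF h y]] hS[OF y] by simp
        also have "\<dots> = (g y \<ominus>\<^bsub>N\<^esub> \<alpha> (Suc m) y \<odot>\<^bsub>N\<^esub> (s \<odot>\<^bsub>N\<^esub> w)) \<ominus>\<^bsub>N\<^esub> g (h m (d m y))"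
          using mod_hom_closed[OF \<psi> y] hdy y c
          by (simp add: mod_hom_minus[OF P N gh]) (simp add: \<psi>_eq mod_hom_minus[OF P N gh] Pm1.lsmult_closed
              mod_hom_smult[OF gh] w)
        also have "\<alpha> (Suc m) y \<odot>\<^bsub>N\<^esub> (s \<odot>\<^bsub>N\<^esub> w) = \<alpha> m (d m y) \<odot>\<^bsub>N\<^esub> w"
          using s\<alpha>[OF y] s_central[OF \<alpha>c[OF y]] N.lsmult_assoc[OF \<alpha>c[OF y] s w(1)] by simp
        finally have "g y = \<alpha> m (d m y) \<odot>\<^bsub>N\<^esub> w \<oplus>\<^bsub>N\<^esub> g (h m (d m y))"
          using c \<alpha>c[OF dy] w
          by (intro N.M.eq_add_if_minus_minus_zero) (simp_all add: N.lsmult_closed)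
        then show ?thesis using dy by simp
      qed
      then have "g = compose (carrier (P (Suc m))) ?g' (d m)"
        using gh by (auto simp: mod_hom_def PiE_def extensional_def compose_def)
      then show "g \<in> coboundaries R P d (Suc m) N" using g' by auto
    qed
  qed
qed

end

section \<open>Quotients as spaces of fibres\<close>

lemma left_module_transport:
  assumes W: "left_module R W" and bij: "bij_betw \<phi> (carrier W) (carrier V)"
    and add: "\<And>x y. x \<in> carrier W \<Longrightarrow> y \<in> carrier W \<Longrightarrow> \<phi> (x \<oplus>\<^bsub>W\<^esub> y) = \<phi> x \<oplus>\<^bsub>V\<^esub> \<phi> y"
    and smult: "\<And>r x. r \<in> carrier R \<Longrightarrow> x \<in> carrier W \<Longrightarrow> \<phi> (r \<odot>\<^bsub>W\<^esub> x) = r \<odot>\<^bsub>V\<^esub> \<phi> x"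
    and zero: "\<phi> \<zero>\<^bsub>W\<^esub> = \<zero>\<^bsub>V\<^esub>"
  shows "left_module R V"
proof -
  interpret W: left_module R W by fact
  have V: "carrier V = \<phi> ` carrier W" using bij by (simp add: bij_betw_def)
  have "abelian_group V"
  proof (rule abelian_groupI)
    fix v assume "v \<in> carrier V"
    then obtain w where w: "w \<in> carrier W" "v = \<phi> w" using V by auto
    have "\<phi> (\<ominus>\<^bsub>W\<^esub> w) \<oplus>\<^bsub>V\<^esub> v = \<zero>\<^bsub>V\<^esub>"
      using w zero by (simp add: add[symmetric] W.M.l_neg)
    then show "\<exists>y\<in>carrier V. y \<oplus>\<^bsub>V\<^esub> v = \<zero>\<^bsub>V\<^esub>" using V w by blast
  qed (auto simp: V add[symmetric] zero[symmetric] W.M.a_ac)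
  then show ?thesis
    by (intro left_module.intro left_module_axioms.intro W.R.ring_axioms)
      (auto simp: V add[symmetric] smult[symmetric] W.lsmult_closed W.lsmult_l_distr
        W.lsmult_r_distr W.lsmult_assoc W.lsmult_one)
qed

text \<open>The cosets of the kernel of \<open>\<Psi>\<close> are its fibres, so \<open>w \<mapsto> fibre Z \<Psi> w\<close> is the inverse of the
  isomorphism from the quotient to the image.\<close>

definition fibre :: "'a set \<Rightarrow> ('a \<Rightarrow> 'b) \<Rightarrow> 'b \<Rightarrow> 'a set"
  where "fibre Z \<Psi> w = {g \<in> Z. \<Psi> g = w}"

text \<open>The homomorphism theorem in the form that is used for cohomology.  The module structure of the quotient is
  transported from \<open>W\<close>, so that none of the axioms has to be checked on cosets.\<close>

lemma quotient_by_kernel: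
  assumes M: "abelian_group M"
    and smult_closed: "\<And>r g. r \<in> carrier K \<Longrightarrow> g \<in> carrier M \<Longrightarrow> r \<odot>\<^bsub>M\<^esub> g \<in> carrier M"
    and W: "left_module K W"
    and \<Psi>: "\<Psi> ` carrier M = carrier W"
    and add: "\<And>g h. g \<in> carrier M \<Longrightarrow> h \<in> carrier M \<Longrightarrow> \<Psi> (g \<oplus>\<^bsub>M\<^esub> h) = \<Psi> g \<oplus>\<^bsub>W\<^esub> \<Psi> h"
    and smult: "\<And>r g. r \<in> carrier K \<Longrightarrow> g \<in> carrier M \<Longrightarrow> \<Psi> (r \<odot>\<^bsub>M\<^esub> g) = r \<odot>\<^bsub>W\<^esub> \<Psi> g"
    and B: "B = {g \<in> carrier M. \<Psi> g = \<zero>\<^bsub>W\<^esub>}"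
  shows coset_eq_fibre: "\<And>g. g \<in> carrier M \<Longrightarrow> B +>\<^bsub>M\<^esub> g = fibre (carrier M) \<Psi> (\<Psi> g)"
    and bij_betw_fibre: "bij_betw (fibre (carrier M) \<Psi>) (carrier W) (carrier (quot_module M B))"
    and fibre_hom: "restrict (fibre (carrier M) \<Psi>) (carrier W) \<in> mod_hom K W (quot_module M B)"
    and left_module_quot: "left_module K (quot_module M B)"
proof -
  interpret M: abelian_group M by fact
  interpret W: left_module K W by fact
  let ?fib = "fibre (carrier M) \<Psi>"
  have \<Psi>c: "\<Psi> g \<in> carrier W" if "g \<in> carrier M" for g using that \<Psi> by blast
  have "group_hom (add_monoid M) (add_monoid W) \<Psi>"
    using add \<Psi>c by (auto intro!: group_hom.intro M.a_group W.M.a_group simp: group_hom_axioms_def hom_def)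
  then have "abelian_group_hom M W \<Psi>"
    using M W.M.abelian_group_axioms by (intro abelian_group_homI)
  then interpret \<Psi>: abelian_group_hom M W \<Psi> .
  have diff: "\<Psi> (g \<ominus>\<^bsub>M\<^esub> h) = \<Psi> g \<ominus>\<^bsub>W\<^esub> \<Psi> h" if "g \<in> carrier M" "h \<in> carrier M" for g h
    using that by (simp add: a_minus_def)
  have cancel: "(g \<ominus>\<^bsub>M\<^esub> h) \<oplus>\<^bsub>M\<^esub> h = g" if "g \<in> carrier M" "h \<in> carrier M" for g h
    using that by (simp add: a_minus_def M.a_assoc M.l_neg)
  show coset: "B +>\<^bsub>M\<^esub> g = ?fib (\<Psi> g)" if g: "g \<in> carrier M" for g
  proof
    show "B +>\<^bsub>M\<^esub> g \<subseteq> ?fib (\<Psi> g)"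
      using g \<Psi>c by (auto simp: a_r_coset_def' fibre_def B add)
    show "?fib (\<Psi> g) \<subseteq> B +>\<^bsub>M\<^esub> g"
    proof
      fix h assume "h \<in> ?fib (\<Psi> g)"
      then have h: "h \<in> carrier M" "\<Psi> h = \<Psi> g" by (auto simp: fibre_def)
      have "h \<ominus>\<^bsub>M\<^esub> g \<in> B" using h g \<Psi>c by (simp add: B diff a_minus_def W.M.r_neg)
      then show "h \<in> B +>\<^bsub>M\<^esub> g" using cancel[OF h(1) g] by (force simp: a_r_coset_def')
    qed
  qed
  have surj: "\<exists>g\<in>carrier M. \<Psi> g = w" if "w \<in> carrier W" for w
    using that unfolding \<Psi>[symmetric] by auto
  have carrier_quot: "carrier (quot_module M B) = ?fib ` carrier W"
    using coset by (auto simp: quot_module_def A_RCOSETS_def' \<Psi>[symmetric])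
  have "inj_on ?fib (carrier W)"
    using surj by (auto simp: inj_on_def fibre_def)
  then show bij: "bij_betw ?fib (carrier W) (carrier (quot_module M B))"
    by (simp add: bij_betw_def carrier_quot)
  have fib_add: "?fib (w \<oplus>\<^bsub>W\<^esub> w') = ?fib w \<oplus>\<^bsub>quot_module M B\<^esub> ?fib w'"
    if w: "w \<in> carrier W" "w' \<in> carrier W" for w w'
  proof
    show "?fib (w \<oplus>\<^bsub>W\<^esub> w') \<subseteq> ?fib w \<oplus>\<^bsub>quot_module M B\<^esub> ?fib w'"
    proof
      fix g assume "g \<in> ?fib (w \<oplus>\<^bsub>W\<^esub> w')"
      then have g: "g \<in> carrier M" "\<Psi> g = w \<oplus>\<^bsub>W\<^esub> w'" by (auto simp: fibre_def)
      obtain h where h: "h \<in> carrier M" "\<Psi> h = w'" using surj w by blast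
      have "\<Psi> (g \<ominus>\<^bsub>M\<^esub> h) = w"
        using g h w by (simp add: diff a_minus_def W.M.a_assoc W.M.r_neg)
      then show "g \<in> ?fib w \<oplus>\<^bsub>quot_module M B\<^esub> ?fib w'"
        using g h cancel[OF g(1) h(1), symmetric]
        by (simp add: quot_module_def set_add_def' fibre_def) blast
    qed
  qed (use w in \<open>auto simp: quot_module_def set_add_def' fibre_def add\<close>)
  have fib_smult: "?fib (r \<odot>\<^bsub>W\<^esub> w) = r \<odot>\<^bsub>quot_module M B\<^esub> ?fib w"
    if r: "r \<in> carrier K" and w: "w \<in> carrier W" for r w
  proof -
    have "B +>\<^bsub>M\<^esub> (r \<odot>\<^bsub>M\<^esub> g) = ?fib (r \<odot>\<^bsub>W\<^esub> w)" if "g \<in> ?fib w" for g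
      using that coset[OF smult_closed[OF r]] smult[OF r] by (auto simp: fibre_def)
    moreover obtain g where "g \<in> ?fib w" using surj[OF w] by (auto simp: fibre_def)
    ultimately show ?thesis by (auto simp: quot_module_def)
  qed
  show "restrict ?fib (carrier W) \<in> mod_hom K W (quot_module M B)"
    using carrier_quot by (intro left_module_mod_homI[OF W]) (auto simp: fib_add fib_smult)
  show "left_module K (quot_module M B)"
    by (rule left_module_transport[OF W bij fib_add fib_smult]) (auto simp: B quot_module_def fibre_def)
qed

section \<open>The cohomology of a module with a periodic resolution\<close>

context resolved_module
begin

lemma cocycle_group:
  assumes N: "left_module R N"
  shows "abelian_group (hom_module \<eta> R (P m) N \<lparr>carrier := cocycles R P d m N\<rparr>)" (is "abelian_group ?H")
proof -
  interpret N: left_module R N by fact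
  have coc: "restrict F (carrier (P m)) \<in> cocycles R P d m N"
    if "\<And>y. y \<in> carrier (P m) \<Longrightarrow> F y \<in> carrier N"
      "\<And>y y'. y \<in> carrier (P m) \<Longrightarrow> y' \<in> carrier (P m) \<Longrightarrow> F (y \<oplus>\<^bsub>P m\<^esub> y') = F y \<oplus>\<^bsub>N\<^esub> F y'"
      "\<And>r y. r \<in> carrier R \<Longrightarrow> y \<in> carrier (P m) \<Longrightarrow> F (r \<odot>\<^bsub>P m\<^esub> y) = r \<odot>\<^bsub>N\<^esub> F y"
      "\<And>y. y \<in> carrier (P (Suc m)) \<Longrightarrow> F (d m y) = \<zero>\<^bsub>N\<^esub>" for F
    using left_module_mod_homI[OF P, of m F N] that mod_hom_closed[OF d]
    by (auto simp: cocycles_def)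
  have ext: "g = g'" if "g \<in> cocycles R P d m N" "g' \<in> cocycles R P d m N"
    "\<And>y. y \<in> carrier (P m) \<Longrightarrow> g y = g' y" for g g'
    using mod_hom_ext[of g R "P m" N g'] that by (auto simp: cocycles_def)
  have hom: "g \<in> mod_hom R (P m) N" if "g \<in> cocycles R P d m N" for g
    using that by (simp add: cocycles_def)
  have c0: "g (d m y) = \<zero>\<^bsub>N\<^esub>" if "g \<in> cocycles R P d m N" "y \<in> carrier (P (Suc m))" for g y
    using that by (simp add: cocycles_def)
  have add_closed: "restrict (\<lambda>x. g x \<oplus>\<^bsub>N\<^esub> h x) (carrier (P m)) \<in> cocycles R P d m N"
    if gh: "g \<in> cocycles R P d m N" "h \<in> cocycles R P d m N" for g h
  proof (rule coc)
    fix y assume y: "y \<in> carrier (P m)"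
    note c = mod_hom_closed[OF hom[OF gh(1)] y] mod_hom_closed[OF hom[OF gh(2)] y]
    then show "g y \<oplus>\<^bsub>N\<^esub> h y \<in> carrier N" by simp
    show "g (r \<odot>\<^bsub>P m\<^esub> y) \<oplus>\<^bsub>N\<^esub> h (r \<odot>\<^bsub>P m\<^esub> y) = r \<odot>\<^bsub>N\<^esub> (g y \<oplus>\<^bsub>N\<^esub> h y)" if "r \<in> carrier R" for r
      using that c y
      by (simp add: mod_hom_smult[OF hom[OF gh(1)]] mod_hom_smult[OF hom[OF gh(2)]] N.lsmult_r_distr)
    show "g (y \<oplus>\<^bsub>P m\<^esub> y') \<oplus>\<^bsub>N\<^esub> h (y \<oplus>\<^bsub>P m\<^esub> y') = (g y \<oplus>\<^bsub>N\<^esub> h y) \<oplus>\<^bsub>N\<^esub> (g y' \<oplus>\<^bsub>N\<^esub> h y')"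
      if y': "y' \<in> carrier (P m)" for y'
      using c y y' mod_hom_closed[OF hom[OF gh(1)] y'] mod_hom_closed[OF hom[OF gh(2)] y']
      by (simp add: mod_hom_add[OF hom[OF gh(1)]] mod_hom_add[OF hom[OF gh(2)]] N.M.a_ac)
  qed (simp add: c0[OF gh(1)] c0[OF gh(2)])
  have zero: "restrict (\<lambda>x. \<zero>\<^bsub>N\<^esub>) (carrier (P m)) \<in> cocycles R P d m N"
    by (rule coc) (auto simp: N.smult_zero_r)
  have neg: "restrict (\<lambda>x. \<ominus>\<^bsub>N\<^esub> g x) (carrier (P m)) \<in> cocycles R P d m N"
    if g: "g \<in> cocycles R P d m N" for g
    using hom[OF g] c0[OF g]
    by (intro coc) (auto simp: mod_hom_closed mod_hom_add mod_hom_smult N.M.minus_add N.smult_uminus_r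
        N.M.add.inv_one[simplified])
  show ?thesis
  proof (rule abelian_groupI)
    fix g assume g: "g \<in> carrier ?H"
    then have "restrict (\<lambda>x. \<ominus>\<^bsub>N\<^esub> g x) (carrier (P m)) \<oplus>\<^bsub>?H\<^esub> g = \<zero>\<^bsub>?H\<^esub>"
      by (auto simp: hom_module_def mod_hom_closed[OF hom] N.M.l_neg)
    then show "\<exists>h\<in>carrier ?H. h \<oplus>\<^bsub>?H\<^esub> g = \<zero>\<^bsub>?H\<^esub>"
      using neg[of g] g by (intro bexI[of _ "restrict (\<lambda>x. \<ominus>\<^bsub>N\<^esub> g x) (carrier (P m))"]) (auto simp: hom_module_def)
  next
    fix g assume g: "g \<in> carrier ?H"
    then have "\<zero>\<^bsub>?H\<^esub> \<oplus>\<^bsub>?H\<^esub> g = restrict (\<lambda>x. \<zero>\<^bsub>N\<^esub> \<oplus>\<^bsub>N\<^esub> g x) (carrier (P m))"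
      by (auto simp: hom_module_def)
    also have "\<dots> = g"
      using g zero add_closed[OF zero, of g]
      by (intro ext) (auto simp: hom_module_def mod_hom_closed[OF hom] cong: restrict_cong)
    finally show "\<zero>\<^bsub>?H\<^esub> \<oplus>\<^bsub>?H\<^esub> g = g" .
  qed (use add_closed zero in \<open>auto simp: hom_module_def mod_hom_closed[OF hom] N.M.a_ac
      intro!: restrict_ext\<close>)
qed

lemma cocycle_smult:
  assumes N: "left_module R N" and g: "g \<in> cocycles R P d m N"
    and a: "a \<in> carrier R" "\<And>b. b \<in> carrier R \<Longrightarrow> a \<otimes>\<^bsub>R\<^esub> b = b \<otimes>\<^bsub>R\<^esub> a"
  shows "restrict (\<lambda>x. a \<odot>\<^bsub>N\<^esub> g x) (carrier (P m)) \<in> cocycles R P d m N"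
proof -
  interpret N: left_module R N by fact
  have hom: "g \<in> mod_hom R (P m) N" using g by (simp add: cocycles_def)
  have "a \<odot>\<^bsub>N\<^esub> (r \<odot>\<^bsub>N\<^esub> y) = r \<odot>\<^bsub>N\<^esub> (a \<odot>\<^bsub>N\<^esub> y)" if "r \<in> carrier R" "y \<in> carrier N" for r y
    using that a by (simp add: N.lsmult_assoc[symmetric])
  then have "restrict (\<lambda>x. a \<odot>\<^bsub>N\<^esub> g x) (carrier (P m)) \<in> mod_hom R (P m) N"
    using hom a
    by (intro left_module_mod_homI[OF P])
      (auto simp: mod_hom_closed mod_hom_add mod_hom_smult N.lsmult_closed N.lsmult_r_distr)
  then show ?thesis
    using g a mod_hom_closed[OF d] by (auto simp: cocycles_def N.smult_zero_r)
qed

lemma cocycle_compose: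
  assumes N: "left_module R N" and g: "g \<in> cocycles R P d m N" and \<phi>: "\<phi> \<in> mod_hom R N N"
  shows "compose (carrier (P m)) \<phi> g \<in> cocycles R P d m N"
  using mod_hom_compose[OF P _ \<phi>, of g m] g mod_hom_closed[OF d] mod_hom_zero[OF N N \<phi>]
  by (auto simp: cocycles_def compose_def)

end

lemma carrier_ring_of_type_algebra [simp]: "carrier ring_of_type_algebra = UNIV"
  by (simp add: ring_of_type_algebra_def)

context periodic_resolution
begin

text \<open>It suffices to find linear coordinates \<open>c\<close> on \<open>N\<close> that map the possible values of cocycles onto \<open>W\<close> and
  vanish exactly on the values of coboundaries: then \<open>W\<close> is \<open>Ext\<^sup>m(M, N)\<close>, and the endomorphisms of \<open>N\<close> act
  on \<open>Ext\<^sup>m(M, N)\<close> as they act on the coordinates.  The isomorphism is directed from \<open>W\<close> to \<open>Ext\<^sup>m(M, N)\<close> because the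
  class with given coordinates is simply a fibre.\<close>

theorem ext_classification:
  fixes N :: "('r, 'e) module" and \<eta> :: "'k::field \<Rightarrow> 'r" and W :: "('k, 'w) module" and c :: "'e \<Rightarrow> 'w"
  defines "Z \<equiv> {v \<in> carrier N. f \<odot>\<^bsub>N\<^esub> v = v \<and> s \<odot>\<^bsub>N\<^esub> v = \<zero>\<^bsub>N\<^esub>}"
  assumes N: "left_module R N"
    and \<eta>: "\<And>k. \<eta> k \<in> carrier R" "\<And>k a. a \<in> carrier R \<Longrightarrow> \<eta> k \<otimes> a = a \<otimes> \<eta> k"
    and W: "left_module ring_of_type_algebra W"
    and add: "\<And>v v'. v \<in> carrier N \<Longrightarrow> v' \<in> carrier N \<Longrightarrow> c (v \<oplus>\<^bsub>N\<^esub> v') = c v \<oplus>\<^bsub>W\<^esub> c v'"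
    and smult: "\<And>k v. v \<in> carrier N \<Longrightarrow> c (\<eta> k \<odot>\<^bsub>N\<^esub> v) = k \<odot>\<^bsub>W\<^esub> c v"
    and surj: "c ` Z = carrier W"
    and kernel: "\<And>v. v \<in> Z \<Longrightarrow> c v = \<zero>\<^bsub>W\<^esub> \<longleftrightarrow>
      (if m = 0 then v = \<zero>\<^bsub>N\<^esub> else \<exists>w\<in>carrier N. v = s \<odot>\<^bsub>N\<^esub> w)"
  obtains \<Phi> where "\<Phi> \<in> mod_hom ring_of_type_algebra W (ext_module \<eta> R P d m N)"
    "bij_betw \<Phi> (carrier W) (carrier (ext_module \<eta> R P d m N))"
    "left_module ring_of_type_algebra (ext_module \<eta> R P d m N)"
    "\<And>\<phi> \<theta> w. \<phi> \<in> mod_hom R N N \<Longrightarrow> (\<And>v. v \<in> Z \<Longrightarrow> c (\<phi> v) = \<theta> (c v)) \<Longrightarrow> w \<in> carrier W \<Longrightarrow>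
      ext_map \<eta> R P d m N \<phi> (\<Phi> w) = \<Phi> (\<theta> w)"
proof -
  interpret N: left_module R N by fact
  obtain x where x: "\<And>n. x n \<in> carrier (P n)"
    and in_Z: "\<And>m (N :: ('r, 'e) module) g. left_module R N \<Longrightarrow> g \<in> cocycles R P d m N \<Longrightarrow>
      f \<odot>\<^bsub>N\<^esub> g (x m) = g (x m) \<and> s \<odot>\<^bsub>N\<^esub> g (x m) = \<zero>\<^bsub>N\<^esub>"
    and onto_Z: "\<And>m (N :: ('r, 'e) module) v. left_module R N \<Longrightarrow> v \<in> carrier N \<Longrightarrow> f \<odot>\<^bsub>N\<^esub> v = v \<Longrightarrow>
      s \<odot>\<^bsub>N\<^esub> v = \<zero>\<^bsub>N\<^esub> \<Longrightarrow> \<exists>g\<in>cocycles R P d m N. g (x m) = v"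
    and cob_0: "\<And>(N :: ('r, 'e) module) g. left_module R N \<Longrightarrow> g \<in> cocycles R P d 0 N \<Longrightarrow>
      g \<in> coboundaries R P d 0 N \<longleftrightarrow> g (x 0) = \<zero>\<^bsub>N\<^esub>"
    and cob_Suc: "\<And>m (N :: ('r, 'e) module) g. left_module R N \<Longrightarrow> g \<in> cocycles R P d (Suc m) N \<Longrightarrow>
      g \<in> coboundaries R P d (Suc m) N \<longleftrightarrow> (\<exists>w\<in>carrier N. g (x (Suc m)) = s \<odot>\<^bsub>N\<^esub> w)"
    using ext_evaluation[where 'e = 'e] by blast
  let ?Z = "cocycles R P d m N" and ?B = "coboundaries R P d m N"
  let ?H = "hom_module \<eta> R (P m) N \<lparr>carrier := ?Z\<rparr>"
  let ?\<Psi> = "\<lambda>g. c (g (x m))"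
  have hom: "g \<in> mod_hom R (P m) N" if "g \<in> ?Z" for g using that by (simp add: cocycles_def)
  have gx: "g (x m) \<in> Z" "g (x m) \<in> carrier N" if "g \<in> ?Z" for g
    using in_Z[OF N that] mod_hom_closed[OF hom[OF that] x] by (auto simp: Z_def)
  have B_sub: "?B \<subseteq> ?Z"
  proof (cases m)
    case 0
    then show ?thesis
      using abelian_group.axioms(1)[OF cocycle_group[OF N, where \<eta> = \<eta> and m = m], THEN abelian_monoid.zero_closed]
      by (simp add: hom_module_def)
  next
    case (Suc n)
    show ?thesis
    proof
      fix g assume "g \<in> ?B"
      then obtain g' where g': "g' \<in> mod_hom R (P n) N" "g = compose (carrier (P m)) g' (d n)"
        using Suc by auto
      then show "g \<in> ?Z"
        using mod_hom_compose[OF P d g'(1)] mod_hom_closed[OF d] d_d mod_hom_zero[OF P N g'(1)] Suc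
        by (auto simp: cocycles_def compose_def)
    qed
  qed
  have "g \<in> ?B \<longleftrightarrow> ?\<Psi> g = \<zero>\<^bsub>W\<^esub>" if g: "g \<in> ?Z" for g
    using kernel[OF gx(1)[OF g]] cob_0[OF N] cob_Suc[OF N] g by (cases m) auto
  then have B: "?B = {g \<in> carrier ?H. ?\<Psi> g = \<zero>\<^bsub>W\<^esub>}" using B_sub by auto
  have \<Psi>_surj: "?\<Psi> ` carrier ?H = carrier W"
  proof
    show "?\<Psi> ` carrier ?H \<subseteq> carrier W"
      unfolding surj[symmetric] using gx by auto
    show "carrier W \<subseteq> ?\<Psi> ` carrier ?H"
    proof
      fix w assume "w \<in> carrier W"
      then obtain v where v: "v \<in> Z" "c v = w" unfolding surj[symmetric] by auto
      then obtain g where "g \<in> ?Z" "g (x m) = v" using onto_Z[OF N, of v m] by (auto simp: Z_def)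
      then show "w \<in> ?\<Psi> ` carrier ?H" using v by auto
    qed
  qed
  have \<Psi>_add: "?\<Psi> (g \<oplus>\<^bsub>?H\<^esub> h) = ?\<Psi> g \<oplus>\<^bsub>W\<^esub> ?\<Psi> h" if "g \<in> carrier ?H" "h \<in> carrier ?H" for g h
    using that gx add x by (simp add: hom_module_def)
  have \<Psi>_smult: "?\<Psi> (k \<odot>\<^bsub>?H\<^esub> g) = k \<odot>\<^bsub>W\<^esub> ?\<Psi> g" if "g \<in> carrier ?H" for k g
    using that gx smult x by (simp add: hom_module_def)
  have smult_closed: "k \<odot>\<^bsub>?H\<^esub> g \<in> carrier ?H" if "g \<in> carrier ?H" for k g
    using that cocycle_smult[OF N _ \<eta>] by (simp add: hom_module_def)
  note quot = quotient_by_kernel[OF cocycle_group[OF N] smult_closed W \<Psi>_surj \<Psi>_add \<Psi>_smult B]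
  let ?fib = "fibre (carrier ?H) ?\<Psi>"
  let ?\<Phi> = "restrict ?fib (carrier W)"
  have ext: "ext_module \<eta> R P d m N = quot_module ?H ?B" by (simp add: ext_module_def)
  have bij: "bij_betw ?fib (carrier W) (carrier (ext_module \<eta> R P d m N))"
    unfolding ext by (rule quot) auto
  show thesis
  proof
    show "?\<Phi> \<in> mod_hom ring_of_type_algebra W (ext_module \<eta> R P d m N)"
      unfolding ext by (rule quot) auto
    show "bij_betw ?\<Phi> (carrier W) (carrier (ext_module \<eta> R P d m N))"
      using bij by (simp cong: bij_betw_cong)
    show "left_module ring_of_type_algebra (ext_module \<eta> R P d m N)"
      unfolding ext by (rule quot) auto
  next
    fix \<phi> \<theta> w
    assume \<phi>: "\<phi> \<in> mod_hom R N N" and \<theta>: "\<And>v. v \<in> Z \<Longrightarrow> c (\<phi> v) = \<theta> (c v)" and w: "w \<in> carrier W"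
    obtain g where g: "g \<in> ?fib w" using w unfolding \<Psi>_surj[symmetric] by (auto simp: fibre_def)
    have "?B +>\<^bsub>hom_module \<eta> R (P m) N\<^esub> compose (carrier (P m)) \<phi> h = ?fib (\<theta> w) \<and> \<theta> w \<in> carrier W"
      if h: "h \<in> ?fib w" for h
    proof -
      have hZ: "h \<in> ?Z" "?\<Psi> h = w" using h by (auto simp: fibre_def)
      have comp: "compose (carrier (P m)) \<phi> h \<in> carrier ?H" using cocycle_compose[OF N hZ(1) \<phi>] by simp
      have \<theta>w: "?\<Psi> (compose (carrier (P m)) \<phi> h) = \<theta> w"
        using \<theta>[OF gx(1)[OF hZ(1)]] hZ(2) x by (simp add: compose_def)
      have "?B +>\<^bsub>hom_module \<eta> R (P m) N\<^esub> compose (carrier (P m)) \<phi> h =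
          ?B +>\<^bsub>?H\<^esub> compose (carrier (P m)) \<phi> h"
        by (simp add: a_r_coset_def' hom_module_def)
      also have "\<dots> = ?fib (?\<Psi> (compose (carrier (P m)) \<phi> h))"
        by (rule quot) (use comp in auto)
      finally show ?thesis using \<theta>w comp unfolding \<Psi>_surj[symmetric] by (simp add: rev_image_eqI)
    qed
    then have "(\<Union>h\<in>?fib w. ?B +>\<^bsub>hom_module \<eta> R (P m) N\<^esub> compose (carrier (P m)) \<phi> h) = ?fib (\<theta> w)"
      and "\<theta> w \<in> carrier W"
      using g by blast+
    moreover have "?fib w \<in> carrier (ext_module \<eta> R P d m N)"
      using bij w by (auto simp: bij_betw_def)
    ultimately show "ext_map \<eta> R P d m N \<phi> (?\<Phi> w) = ?\<Phi> (\<theta> w)" using w by (simp add: ext_map_def)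
  qed
qed

text \<open>Elements \<open>v\<close> with \<open>f v = v\<close> and \<open>s v = 0\<close> correspond to homomorphisms from \<open>M\<close> to \<open>N\<close> with \<open>z \<mapsto> v\<close>:
  whatever annihilates \<open>z\<close> annihilates \<open>v\<close>, since its product with \<open>f\<close> is a multiple of \<open>s\<close>.\<close>

lemma annihilator_invariant:
  assumes N: "left_module R N" and v: "v \<in> carrier N" "f \<odot>\<^bsub>N\<^esub> v = v" "s \<odot>\<^bsub>N\<^esub> v = \<zero>\<^bsub>N\<^esub>"
    and a: "a \<in> carrier R" and b: "b \<in> carrier R" and eq: "a \<odot>\<^bsub>M\<^esub> z = b \<odot>\<^bsub>M\<^esub> z"
  shows "a \<odot>\<^bsub>N\<^esub> v = b \<odot>\<^bsub>N\<^esub> v"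
proof -
  interpret ring R by (rule R)
  interpret M: left_module R M by (rule M)
  interpret N: left_module R N by (rule N)
  have "\<exists>r\<in>carrier R. (a \<ominus> b) \<otimes> f = s \<otimes> r"
  proof (rule annihilator_z)
    show "(a \<ominus> b) \<otimes> f \<in> carrier R" using a b f by simp
    show "f \<otimes> ((a \<ominus> b) \<otimes> f) = (a \<ominus> b) \<otimes> f"
      using a b f f_central[of "(a \<ominus> b) \<otimes> f"] by (simp add: m_assoc f_idem)
    show "((a \<ominus> b) \<otimes> f) \<odot>\<^bsub>M\<^esub> z = \<zero>\<^bsub>M\<^esub>"
      using a b f z M.lsmult_closed[OF b z]
      by (simp add: M.lsmult_assoc f_z M.smult_minus_l eq) (simp add: M.M.minus_eq M.M.r_neg)
  qed
  then obtain r where r: "r \<in> carrier R" "(a \<ominus> b) \<otimes> f = s \<otimes> r" by blast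
  have "(a \<ominus> b) \<odot>\<^bsub>N\<^esub> v = ((a \<ominus> b) \<otimes> f) \<odot>\<^bsub>N\<^esub> v" using a b f v by (simp add: N.lsmult_assoc)
  also have "\<dots> = r \<odot>\<^bsub>N\<^esub> (s \<odot>\<^bsub>N\<^esub> v)"
    using r s v s_central[OF r(1)] by (simp add: N.lsmult_assoc)
  also have "\<dots> = \<zero>\<^bsub>N\<^esub>" using r v by (simp add: N.smult_zero_r)
  finally have "\<zero>\<^bsub>N\<^esub> = (a \<odot>\<^bsub>N\<^esub> v \<ominus>\<^bsub>N\<^esub> b \<odot>\<^bsub>N\<^esub> v) \<ominus>\<^bsub>N\<^esub> \<zero>\<^bsub>N\<^esub>"
    using a b v by (simp add: N.smult_minus_l N.lsmult_closed N.M.minus_zero_right)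
  then have "a \<odot>\<^bsub>N\<^esub> v = b \<odot>\<^bsub>N\<^esub> v \<oplus>\<^bsub>N\<^esub> \<zero>\<^bsub>N\<^esub>"
    using a b v by (intro N.M.eq_add_if_minus_minus_zero) (auto simp: N.lsmult_closed)
  then show ?thesis using b v by (simp add: N.lsmult_closed)
qed

end

section \<open>Representations of the modular group\<close>

lemmas int_2x2 = vec_eq_iff forall_2 matrix_matrix_mult_def matrix_vector_mult_def sum_2 vector_2 mat_def

lemma T_mat_entries: "T_mat $ 1 $ 1 = 1" "T_mat $ 1 $ 2 = 1" "T_mat $ 2 $ 1 = 0" "T_mat $ 2 $ 2 = 1"
  by (simp_all add: T_mat_def)

lemma S_mat_entries: "S_mat $ 1 $ 1 = 0" "S_mat $ 1 $ 2 = -1" "S_mat $ 2 $ 1 = 1" "S_mat $ 2 $ 2 = 0"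
  by (simp_all add: S_mat_def)

lemmas ST_entries = T_mat_entries S_mat_entries

lemma SL2Z_simps [simp]:
  "A \<in> carrier SL2Z \<longleftrightarrow> det A = 1" "A \<otimes>\<^bsub>SL2Z\<^esub> B = A ** B" "\<one>\<^bsub>SL2Z\<^esub> = mat 1"
  by (simp_all add: SL2Z_def)

lemma det_T_mat [simp]: "det T_mat = 1" and det_S_mat [simp]: "det S_mat = 1"
  by (simp_all add: det_2 ST_entries)

definition adjugate_2 :: "int ^ 2 ^ 2 \<Rightarrow> int ^ 2 ^ 2"
  where "adjugate_2 A = vector [vector [A $ 2 $ 2, - (A $ 1 $ 2)], vector [- (A $ 2 $ 1), A $ 1 $ 1]]"

lemma adjugate_2_entries:
  "adjugate_2 A $ 1 $ 1 = A $ 2 $ 2" "adjugate_2 A $ 1 $ 2 = - (A $ 1 $ 2)"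
  "adjugate_2 A $ 2 $ 1 = - (A $ 2 $ 1)" "adjugate_2 A $ 2 $ 2 = A $ 1 $ 1"
  by (simp_all add: adjugate_2_def)

lemma adjugate_2:
  assumes "det A = 1"
  shows "adjugate_2 A ** A = mat 1" "A ** adjugate_2 A = mat 1" "det (adjugate_2 A) = 1"
  using assms by (auto simp: int_2x2 adjugate_2_entries det_2 algebra_simps)

lemma group_SL2Z: "group SL2Z"
proof (rule groupI)
  fix A assume "A \<in> carrier SL2Z"
  then show "\<exists>B\<in>carrier SL2Z. B \<otimes>\<^bsub>SL2Z\<^esub> A = \<one>\<^bsub>SL2Z\<^esub>"
    using adjugate_2 by (intro bexI[of _ "adjugate_2 A"]) auto
qed (auto simp: det_mul matrix_mul_assoc)

definition T_power :: "int \<Rightarrow> int ^ 2 ^ 2"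
  where "T_power k = vector [vector [1, k], vector [0, 1]]"

lemma T_power_entries:
  "T_power k $ 1 $ 1 = 1" "T_power k $ 1 $ 2 = k" "T_power k $ 2 $ 1 = 0" "T_power k $ 2 $ 2 = 1"
  by (simp_all add: T_power_def)

text \<open>The matrices \<open>T_mat\<close> and \<open>S_mat\<close> generate the modular group already as a monoid, because
  \<open>T\<^sup>-\<^sup>1 = S T S T S\<^sup>3\<close>.  The proof is the Euclidean algorithm on the first column.\<close>

lemma SL2Z_induct [consumes 1, case_names one T_mat S_mat]:
  assumes A: "det A = 1"
    and one: "Q (mat 1)"
    and T: "\<And>B. det B = 1 \<Longrightarrow> Q B \<Longrightarrow> Q (T_mat ** B)"
    and S: "\<And>B. det B = 1 \<Longrightarrow> Q B \<Longrightarrow> Q (S_mat ** B)"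
  shows "Q A"
proof -
  let ?S = "\<lambda>B. S_mat ** B" and ?T = "\<lambda>B. T_mat ** B"
  have det_mult: "det (B ** C) = 1" if "det B = 1" "det C = 1" for B C :: "int ^ 2 ^ 2"
    using that by (simp add: det_mul)
  have det_T_power: "det (T_power k) = 1" for k by (simp add: det_2 T_power_entries)
  have T_inv: "Q (T_power (-1) ** B)" if B: "det B = 1" "Q B" for B
  proof -
    have "T_power (-1) ** B = ?S (?T (?S (?T (?S (?S (?S B))))))"
      by (simp add: int_2x2 ST_entries T_power_entries)
    then show ?thesis using B by (simp add: S T det_mult)
  qed
  have T_power: "Q (T_power k ** B)" if B: "det B = 1" "Q B" for k B
  proof (induction k rule: int_induct[where k = 0])
    case base
    have "T_power 0 ** B = B" by (simp add: int_2x2 T_power_entries)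
    then show ?case using B by simp
  next
    case (step1 k)
    have "T_power (k + 1) ** B = ?T (T_power k ** B)"
      by (simp add: int_2x2 ST_entries T_power_entries algebra_simps)
    then show ?case using T step1 B det_mult det_T_power by simp
  next
    case (step2 k)
    have "T_power (k - 1) ** B = T_power (-1) ** (T_power k ** B)"
      by (simp add: int_2x2 ST_entries T_power_entries algebra_simps)
    then show ?case using T_inv step2 B det_mult det_T_power by simp
  qed
  show ?thesis using A
  proof (induction "nat \<bar>A $ 2 $ 1\<bar>" arbitrary: A rule: less_induct)
    case less
    show ?case
    proof (cases "A $ 2 $ 1 = 0")
      case True
      then have "A $ 1 $ 1 * A $ 2 $ 2 = 1" using less.prems by (simp add: det_2)
      then consider "A $ 1 $ 1 = 1" "A $ 2 $ 2 = 1" | "A $ 1 $ 1 = -1" "A $ 2 $ 2 = -1"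
        by (auto simp: zmult_eq_1_iff)
      then show ?thesis
      proof cases
        case 1
        then have "A = T_power (A $ 1 $ 2) ** mat 1"
          using True by (simp add: int_2x2 T_power_entries)
        then show ?thesis using T_power[OF _ one] by (metis det_I)
      next
        case 2
        then have "A = ?S (?S (T_power (- (A $ 1 $ 2)) ** mat 1))"
          using True by (simp add: int_2x2 T_power_entries ST_entries)
        then show ?thesis using S T_power[OF _ one] det_mult det_T_power by (metis det_S_mat det_I)
      qed
    next
      case False
      \<comment> \<open>The lower left entry of \<open>S T\<^sup>-\<^sup>q A\<close> is the remainder of the division of the first column.\<close>
      define q where "q = A $ 1 $ 1 div A $ 2 $ 1"
      define B where "B = ?S (T_power (-q) ** A)"
      have det_B: "det B = 1" unfolding B_def using less.prems det_T_power by (simp add: det_mult)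
      have "B $ 2 $ 1 = A $ 1 $ 1 mod A $ 2 $ 1"
        by (simp add: B_def int_2x2 T_power_entries ST_entries q_def minus_div_mult_eq_mod[symmetric])
      then have "\<bar>B $ 2 $ 1\<bar> < \<bar>A $ 2 $ 1\<bar>" using False by (simp add: abs_mod_less)
      then have "Q B" using less.hyps[of B] det_B by simp
      then have "Q (T_power q ** ?S (?S (?S B)))"
        using det_B det_mult by (intro T_power S) auto
      moreover have "A = T_power q ** ?S (?S (?S B))"
        by (simp add: B_def int_2x2 T_power_entries ST_entries algebra_simps)
      ultimately show ?thesis by simp
    qed
  qed
qed

text \<open>Existence by transport of structure along \<open>\<Phi>\<close>; uniqueness because \<open>\<Phi>\<close> intertwines the actions of the two
  generators and hence of all elements.\<close>

lemma SL2Z_rep_from_generators: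
  fixes V :: "('k::field, 'v) module" and W :: "('k, 'w) module"
  assumes W: "is_rep SL2Z (W, \<sigma>)" and V: "left_module ring_of_type_algebra V"
    and \<Phi>: "\<Phi> \<in> mod_hom ring_of_type_algebra W V" and bij: "bij_betw \<Phi> (carrier W) (carrier V)"
    and T: "t \<in> extensional (carrier V)" "\<And>w. w \<in> carrier W \<Longrightarrow> t (\<Phi> w) = \<Phi> (\<sigma> T_mat w)"
    and S: "s \<in> extensional (carrier V)" "\<And>w. w \<in> carrier W \<Longrightarrow> s (\<Phi> w) = \<Phi> (\<sigma> S_mat w)"
  shows "\<exists>\<rho>. is_rep SL2Z (V, \<rho>) \<and> \<rho> T_mat = t \<and> \<rho> S_mat = s"
    and "\<And>\<rho>. is_rep SL2Z (V, \<rho>) \<Longrightarrow> \<rho> T_mat = t \<Longrightarrow> \<rho> S_mat = s \<Longrightarrow> rep_isomorphic SL2Z (V, \<rho>) (W, \<sigma>)"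
proof -
  let ?K = "ring_of_type_algebra :: 'k ring"
  have Wm: "left_module ?K W" using W by (simp add: is_rep_def)
  interpret V: left_module ?K V by fact
  interpret W: left_module ?K W by fact
  have \<sigma>: "\<sigma> A \<in> mod_hom ?K W W" if "det A = 1" for A using W that by (simp add: is_rep_def)
  have \<sigma>_one: "\<sigma> (mat 1) w = w" if "w \<in> carrier W" for w using W that by (simp add: is_rep_def)
  have \<sigma>_mult: "\<sigma> (A ** B) w = \<sigma> A (\<sigma> B w)" if "det A = 1" "det B = 1" "w \<in> carrier W" for A B w
    using W that by (simp add: is_rep_def)
  define \<Psi> where "\<Psi> = restrict (inv_into (carrier W) \<Phi>) (carrier V)"
  have \<Psi>c: "\<Psi> v \<in> carrier W" and \<Phi>\<Psi>: "\<Phi> (\<Psi> v) = v" if "v \<in> carrier V" for v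
    using that bij bij_betw_imp_surj_on[OF bij]
    by (auto simp: \<Psi>_def inv_into_into f_inv_into_f)
  have \<Phi>c: "\<Phi> w \<in> carrier V" if "w \<in> carrier W" for w using mod_hom_closed[OF \<Phi> that] .
  have \<Psi>\<Phi>: "\<Psi> (\<Phi> w) = w" if "w \<in> carrier W" for w
    using that \<Phi>c bij by (simp add: \<Psi>_def bij_betw_inv_into_left)
  have \<Psi>_add: "\<Psi> (x \<oplus>\<^bsub>V\<^esub> y) = \<Psi> x \<oplus>\<^bsub>W\<^esub> \<Psi> y" if "x \<in> carrier V" "y \<in> carrier V" for x y
    using \<Psi>\<Phi>[of "\<Psi> x \<oplus>\<^bsub>W\<^esub> \<Psi> y"] that by (simp add: mod_hom_add[OF \<Phi>] \<Psi>c \<Phi>\<Psi>)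
  have \<Psi>_smult: "\<Psi> (k \<odot>\<^bsub>V\<^esub> x) = k \<odot>\<^bsub>W\<^esub> \<Psi> x" if "x \<in> carrier V" for k x
    using \<Psi>\<Phi>[of "k \<odot>\<^bsub>W\<^esub> \<Psi> x"] that by (simp add: mod_hom_smult[OF \<Phi>] \<Psi>c \<Phi>\<Psi> W.lsmult_closed)
  show "\<exists>\<rho>. is_rep SL2Z (V, \<rho>) \<and> \<rho> T_mat = t \<and> \<rho> S_mat = s"
  proof -
    define \<rho> where "\<rho> A = restrict (\<lambda>v. \<Phi> (\<sigma> A (\<Psi> v))) (carrier V)" for A
    have "\<rho> A \<in> mod_hom ?K V V" if A: "det A = 1" for A
      unfolding \<rho>_def using \<Psi>c mod_hom_closed[OF \<sigma>[OF A]] \<Phi>c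
      by (intro left_module_mod_homI[OF V])
        (auto simp: \<Psi>_add \<Psi>_smult mod_hom_add[OF \<sigma>[OF A]] mod_hom_smult[OF \<sigma>[OF A]]
          mod_hom_add[OF \<Phi>] mod_hom_smult[OF \<Phi>])
    moreover have "\<rho> (A ** B) v = \<rho> A (\<rho> B v)" if "det A = 1" "det B = 1" "v \<in> carrier V" for A B v
      using that by (simp add: \<rho>_def \<Psi>c \<Phi>c \<Psi>\<Phi> \<sigma>_mult mod_hom_closed[OF \<sigma>])
    moreover have "\<rho> (mat 1) v = v" if "v \<in> carrier V" for v
      using that by (simp add: \<rho>_def \<Psi>c \<Phi>\<Psi> \<sigma>_one)
    ultimately have "is_rep SL2Z (V, \<rho>)" using V by (simp add: is_rep_def)
    moreover have "\<rho> T_mat = t"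
      using T by (intro extensionalityI[of _ "carrier V"]) (auto simp: \<rho>_def \<Psi>c \<Phi>\<Psi> simp flip: T(2))
    moreover have "\<rho> S_mat = s"
      using S by (intro extensionalityI[of _ "carrier V"]) (auto simp: \<rho>_def \<Psi>c \<Phi>\<Psi> simp flip: S(2))
    ultimately show ?thesis by blast
  qed
  fix \<rho> assume \<rho>: "is_rep SL2Z (V, \<rho>)" and \<rho>T: "\<rho> T_mat = t" and \<rho>S: "\<rho> S_mat = s"
  have \<rho>_hom: "\<rho> A \<in> mod_hom ?K V V" if "det A = 1" for A using \<rho> that by (simp add: is_rep_def)
  have \<rho>_mult: "\<rho> (A ** B) v = \<rho> A (\<rho> B v)" if "det A = 1" "det B = 1" "v \<in> carrier V" for A B v
    using \<rho> that by (simp add: is_rep_def)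
  have main: "\<forall>w\<in>carrier W. \<rho> A (\<Phi> w) = \<Phi> (\<sigma> A w)" if "det A = 1" for A
    using that
  proof (induction rule: SL2Z_induct)
    case one
    then show ?case using \<rho> \<Phi>c \<sigma>_one by (simp add: is_rep_def)
  next
    case (T_mat B)
    then show ?case using \<rho>_mult \<sigma>_mult \<Phi>c \<rho>T T mod_hom_closed[OF \<sigma>] by simp
  next
    case (S_mat B)
    then show ?case using \<rho>_mult \<sigma>_mult \<Phi>c \<rho>S S mod_hom_closed[OF \<sigma>] by simp
  qed
  show "rep_isomorphic SL2Z (V, \<rho>) (W, \<sigma>)"
    unfolding rep_isomorphic_def prod.case
  proof (intro bexI conjI ballI)
    have "restrict \<Psi> (carrier V) \<in> mod_hom ?K V W"
      using \<Psi>c \<Psi>_add \<Psi>_smult by (intro left_module_mod_homI[OF V]) auto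
    then show "\<Psi> \<in> mod_hom ?K V W" by (simp add: \<Psi>_def)
    show "bij_betw \<Psi> (carrier V) (carrier W)"
      using \<Psi>c \<Phi>c \<Psi>\<Phi> \<Phi>\<Psi> by (intro bij_betwI[of _ _ _ \<Phi>]) auto
  next
    fix A v assume A: "A \<in> carrier SL2Z" and v: "v \<in> carrier V"
    then have "\<rho> A (\<Phi> (\<Psi> v)) = \<Phi> (\<sigma> A (\<Psi> v))" using main \<Psi>c by simp
    then show "\<Psi> (\<rho> A v) = \<sigma> A (\<Psi> v)"
      using v A by (simp add: \<Phi>\<Psi> \<Psi>\<Phi> \<Psi>c mod_hom_closed[OF \<sigma>])
  qed
qed

lemma is_rep_trivial: "is_rep \<Gamma> (trivial_rep :: ('g, 'k::field, 'k) rep)"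
proof -
  let ?V = "\<lparr>carrier = UNIV, monoid.mult = undefined, one = undefined, zero = 0, add = (+),
    module.smult = (*)\<rparr> :: ('k, 'k) module"
  have "abelian_group ?V"
    by (rule abelian_groupI) (auto simp: algebra_simps intro: exI[of _ "- x" for x])
  then have "left_module ring_of_type_algebra ?V"
    by (intro left_module.intro left_module_axioms.intro ring_from_type_algebra)
      (auto simp: ring_of_type_algebra_def algebra_simps)
  then show ?thesis by (simp add: is_rep_def trivial_rep_def mod_hom_def)
qed

lemma is_rep_sum:
  fixes U :: "('g, 'k::field, 'v) rep" and U' :: "('g, 'k, 'w) rep"
  assumes \<Gamma>: "group \<Gamma>" and U: "is_rep \<Gamma> U" and U': "is_rep \<Gamma> U'"
  shows "is_rep \<Gamma> (U \<oplus>\<^sub>r U')"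
proof -
  obtain V \<rho> W \<sigma> where eq: "U = (V, \<rho>)" "U' = (W, \<sigma>)" by (metis prod.exhaust)
  interpret \<Gamma>: group \<Gamma> by fact
  let ?K = "ring_of_type_algebra :: 'k ring"
  interpret V: left_module ?K V using U by (simp add: eq is_rep_def)
  interpret W: left_module ?K W using U' by (simp add: eq is_rep_def)
  have \<rho>: "\<rho> g \<in> mod_hom ?K V V" and \<sigma>: "\<sigma> g \<in> mod_hom ?K W W" if "g \<in> carrier \<Gamma>" for g
    using U U' that by (simp_all add: eq is_rep_def)
  let ?S = "fst (U \<oplus>\<^sub>r U')"
  have ag: "abelian_group ?S"
  proof (rule abelian_groupI)
    fix x assume "x \<in> carrier ?S"
    then show "\<exists>y\<in>carrier ?S. y \<oplus>\<^bsub>?S\<^esub> x = \<zero>\<^bsub>?S\<^esub>"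
      by (intro bexI[of _ "(\<ominus>\<^bsub>V\<^esub> fst x, \<ominus>\<^bsub>W\<^esub> snd x)"]) (auto simp: eq rep_sum_def V.M.l_neg W.M.l_neg)
  qed (auto simp: eq rep_sum_def V.M.a_ac W.M.a_ac)
  have S: "left_module ?K ?S"
    using ag by (intro left_module.intro left_module_axioms.intro V.R.ring_axioms)
      (auto simp: eq rep_sum_def V.lsmult_closed W.lsmult_closed V.lsmult_l_distr W.lsmult_l_distr
        V.lsmult_r_distr W.lsmult_r_distr V.lsmult_assoc W.lsmult_assoc V.lsmult_one W.lsmult_one)
  have "restrict (\<lambda>(v, w). (\<rho> g v, \<sigma> g w)) (carrier ?S) \<in> mod_hom ?K ?S ?S"
    if g: "g \<in> carrier \<Gamma>" for g
    by (rule left_module_mod_homI[OF S])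
      (auto simp: eq rep_sum_def mod_hom_closed[OF \<rho>[OF g]] mod_hom_closed[OF \<sigma>[OF g]]
        mod_hom_add[OF \<rho>[OF g]] mod_hom_add[OF \<sigma>[OF g]] mod_hom_smult[OF \<rho>[OF g]] mod_hom_smult[OF \<sigma>[OF g]])
  then show ?thesis
    using S U U' by (auto simp: eq rep_sum_def is_rep_def mod_hom_closed[OF \<rho>] mod_hom_closed[OF \<sigma>])
qed

lemma perm_rep_eq_if_finite:
  assumes Y: "finite Y" and v: "\<And>y. y \<notin> Y \<Longrightarrow> v y = 0"
  shows "snd (perm_rep Y act) g v y = (\<Sum>x\<in>Y. v x * unit_at (act g x) y)"
proof -
  have "{x. v x \<noteq> 0} \<subseteq> Y" using v by blast
  moreover from this have "finite {x. v x \<noteq> 0}" using Y finite_subset by blast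
  moreover have "(\<Sum>x | v x \<noteq> 0. v x * unit_at (act g x) y) = (\<Sum>x\<in>Y. v x * unit_at (act g x) y)"
    using Y v by (intro sum.mono_neutral_left) auto
  ultimately show ?thesis by (simp add: perm_rep_def Let_def)
qed

lemma carrier_perm_rep:
  assumes "finite Y"
  shows "carrier (fst (perm_rep Y act)) = {v. \<forall>y. y \<notin> Y \<longrightarrow> v y = 0}"
  using assms by (auto simp: perm_rep_def Let_def intro: finite_subset)

text \<open>In terms of functions on \<open>Y\<close>, permuting the basis is composition with the inverse permutation.\<close>

lemma perm_rep_apply:
  fixes \<Gamma> (structure)
  assumes "group \<Gamma>" and Y: "finite Y"
    and act: "\<And>g y. g \<in> carrier \<Gamma> \<Longrightarrow> y \<in> Y \<Longrightarrow> act g y \<in> Y"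
      "\<And>y. y \<in> Y \<Longrightarrow> act \<one> y = y"
      "\<And>g h y. g \<in> carrier \<Gamma> \<Longrightarrow> h \<in> carrier \<Gamma> \<Longrightarrow> y \<in> Y \<Longrightarrow> act (g \<otimes> h) y = act g (act h y)"
    and v: "\<And>y. y \<notin> Y \<Longrightarrow> v y = 0" and g: "g \<in> carrier \<Gamma>"
  shows "snd (perm_rep Y act) g v y = (if y \<in> Y then v (act (inv g) y) else 0)"
proof -
  interpret group \<Gamma> by fact
  have iff: "y = act g x \<longleftrightarrow> x = act (inv g) y" if "x \<in> Y" "y \<in> Y" for x y
    using that g act by (metis inv_closed l_inv r_inv)
  have "(\<Sum>x\<in>Y. v x * unit_at (act g x) y) = (if y \<in> Y then v (act (inv g) y) else 0)"
  proof (cases "y \<in> Y")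
    case True
    have "(\<Sum>x\<in>Y. v x * unit_at (act g x) y) = (\<Sum>x\<in>Y. if x = act (inv g) y then v x else 0)"
      by (intro sum.cong refl) (simp add: unit_at_def iff[OF _ True])
    then show ?thesis using Y True act(1) g by simp
  next
    case False
    have "(\<Sum>x\<in>Y. v x * unit_at (act g x) y) = 0"
      using False act(1)[OF g] by (intro sum.neutral) (auto simp: unit_at_def)
    then show ?thesis using False by simp
  qed
  moreover have "snd (perm_rep Y act) g v y = (\<Sum>x\<in>Y. v x * unit_at (act g x) y)"
    by (rule perm_rep_eq_if_finite) fact+
  ultimately show ?thesis by (rule trans[rotated])
qed

lemma is_rep_perm:
  fixes \<Gamma> (structure)
  assumes \<Gamma>: "group \<Gamma>" and Y: "finite Y"
    and act: "\<And>g y. g \<in> carrier \<Gamma> \<Longrightarrow> y \<in> Y \<Longrightarrow> act g y \<in> Y"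
      "\<And>y. y \<in> Y \<Longrightarrow> act \<one> y = y"
      "\<And>g h y. g \<in> carrier \<Gamma> \<Longrightarrow> h \<in> carrier \<Gamma> \<Longrightarrow> y \<in> Y \<Longrightarrow> act (g \<otimes> h) y = act g (act h y)"
  shows "is_rep \<Gamma> (perm_rep Y act :: ('g, 'k::field, 'x \<Rightarrow> 'k) rep)"
proof -
  interpret group \<Gamma> by fact
  let ?V = "fst (perm_rep Y act) :: ('k, 'x \<Rightarrow> 'k) module" and ?\<rho> = "snd (perm_rep Y act) :: 'g \<Rightarrow> ('x \<Rightarrow> 'k) \<Rightarrow> _"
  have V: "carrier ?V = {v. \<forall>y. y \<notin> Y \<longrightarrow> v y = 0}" by (rule carrier_perm_rep[OF Y])
  have ops: "\<zero>\<^bsub>?V\<^esub> = (\<lambda>_. 0)" "v \<oplus>\<^bsub>?V\<^esub> w = (\<lambda>x. v x + w x)" "k \<odot>\<^bsub>?V\<^esub> v = (\<lambda>x. k * v x)" for v w k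
    by (simp_all add: perm_rep_def Let_def)
  have \<rho>: "?\<rho> g v = (\<lambda>y. if y \<in> Y then v (act (inv g) y) else 0)" if "v \<in> carrier ?V" "g \<in> carrier \<Gamma>" for v g
    using that V by (intro ext) (rule perm_rep_apply[OF \<Gamma> Y act], auto)
  have ag: "abelian_group ?V"
  proof (rule abelian_groupI)
    fix v assume "v \<in> carrier ?V"
    then show "\<exists>w\<in>carrier ?V. w \<oplus>\<^bsub>?V\<^esub> v = \<zero>\<^bsub>?V\<^esub>"
      by (intro bexI[of _ "\<lambda>y. - v y"]) (auto simp: V ops)
  qed (auto simp: V ops algebra_simps)
  have lm: "left_module ring_of_type_algebra ?V"
    using ag by (intro left_module.intro left_module_axioms.intro ring_from_type_algebra)
      (auto simp: V ops ring_of_type_algebra_def algebra_simps)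
  have "restrict (?\<rho> g) (carrier ?V) \<in> mod_hom ring_of_type_algebra ?V ?V" if g: "g \<in> carrier \<Gamma>" for g
  proof (rule left_module_mod_homI[OF lm])
    fix v w assume vw: "v \<in> carrier ?V" "w \<in> carrier ?V"
    then have "v \<oplus>\<^bsub>?V\<^esub> w \<in> carrier ?V" by (simp add: V ops)
    then show "?\<rho> g (v \<oplus>\<^bsub>?V\<^esub> w) = ?\<rho> g v \<oplus>\<^bsub>?V\<^esub> ?\<rho> g w" using vw g by (auto simp: \<rho>) (auto simp: ops)
  next
    fix v k assume v: "v \<in> carrier ?V"
    then have "k \<odot>\<^bsub>?V\<^esub> v \<in> carrier ?V" by (simp add: V ops)
    then show "?\<rho> g (k \<odot>\<^bsub>?V\<^esub> v) = k \<odot>\<^bsub>?V\<^esub> ?\<rho> g v" using v g by (auto simp: \<rho>) (auto simp: ops)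
  qed (use g in \<open>simp_all add: \<rho>, simp add: V\<close>)
  moreover have "restrict (?\<rho> g) (carrier ?V) = ?\<rho> g" for g
    by (auto simp: perm_rep_def Let_def)
  ultimately have hom: "?\<rho> g \<in> mod_hom ring_of_type_algebra ?V ?V" if "g \<in> carrier \<Gamma>" for g
    using that by metis
  have "?\<rho> (g \<otimes> h) v = ?\<rho> g (?\<rho> h v)" if "g \<in> carrier \<Gamma>" "h \<in> carrier \<Gamma>" "v \<in> carrier ?V" for g h v
    using that \<rho>[OF mod_hom_closed[OF hom], of h v g] by (auto simp: \<rho> inv_mult_group act)
  moreover have "?\<rho> \<one> v = v" if "v \<in> carrier ?V" for v
    using that V by (auto simp: \<rho> act)
  ultimately show ?thesis
    using lm hom by (simp add: is_rep_def case_prod_unfold)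
qed

section \<open>Lines modulo a prime\<close>

definition line_mod :: "int \<Rightarrow> int ^ 2 \<Rightarrow> (int ^ 2) set"
  where "line_mod n v = {vec_mod n (k *s v) | k. k \<in> {0..<n}}"

lemma proj_line_eq: "proj_line n = {line_mod n v | v. v \<in> range (vec_mod n) \<and> v \<noteq> 0}"
  by (simp add: proj_line_def line_mod_def)

lemma vec_mod_nth [simp]: "vec_mod n v $ i = v $ i mod n"
  by (simp add: vec_mod_def)

lemma vec_mod_vec_mod [simp]: "vec_mod n (vec_mod n v) = vec_mod n v"
  by (simp add: vec_eq_iff)

lemma vec_mod_zero [simp]: "vec_mod n 0 = 0"
  by (simp add: vec_eq_iff)

lemma vec_mod_range [simp]: "v \<in> range (vec_mod n) \<longleftrightarrow> vec_mod n v = v"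
  by (metis rangeI rangeE vec_mod_vec_mod)

lemma vec_mod_mult_vec_mod: "vec_mod n (A *v vec_mod n v) = vec_mod n (A *v v)"
proof -
  have "(a * (x mod n) + b * (y mod n)) mod n = (a * x + b * y) mod n" for a b x y :: int
    by (intro mod_add_cong) (simp_all add: mod_simps)
  then show ?thesis by (simp add: int_2x2)
qed

lemma mult_scale_2: "A *v (k *s v) = k *s (A *v v)" for A :: "int ^ 2 ^ 2"
  by (simp add: int_2x2 algebra_simps)

lemma vec_mod_scale_vec_mod: "vec_mod n (k *s vec_mod n v) = vec_mod n (k *s v)"
  by (simp add: vec_eq_iff mod_simps)

lemma proj_line_act_line_mod: "proj_line_act n A (line_mod n v) = line_mod n (vec_mod n (A *v v))"
proof -
  have "vec_mod n (A *v vec_mod n (k *s v)) = vec_mod n (k *s vec_mod n (A *v v))" for k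
    by (simp add: vec_mod_mult_vec_mod vec_mod_scale_vec_mod mult_scale_2)
  then show ?thesis unfolding proj_line_act_def line_mod_def Setcompr_eq_image image_image by (simp only:)
qed

lemma vec_mod_mult_eq_0_iff:
  assumes "det A = 1"
  shows "vec_mod n (A *v v) = 0 \<longleftrightarrow> vec_mod n v = 0"
proof
  assume "vec_mod n (A *v v) = 0"
  then have "vec_mod n (adjugate_2 A *v (A *v v)) = 0"
    by (metis vec_mod_mult_vec_mod vec_mod_zero matrix_vector_mult_0_right)
  then show "vec_mod n v = 0" using adjugate_2[OF assms] by (simp add: matrix_vector_mul_assoc)
next
  assume "vec_mod n v = 0"
  then show "vec_mod n (A *v v) = 0" by (metis vec_mod_mult_vec_mod vec_mod_zero matrix_vector_mult_0_right)
qed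

lemma finite_proj_line:
  assumes "n > 0"
  shows "finite (proj_line n)"
proof -
  have "range (vec_mod n) \<subseteq> (\<lambda>(a, b). vector [a, b]) ` ({0..<n} \<times> {0..<n})"
  proof
    fix v assume "v \<in> range (vec_mod n)"
    then have v: "vec_mod n v = v" by simp
    have "v = (\<lambda>(a, b). vector [a, b]) (v $ 1 mod n, v $ 2 mod n)"
      using v by (simp add: vec_eq_iff forall_2)
    then show "v \<in> (\<lambda>(a, b). vector [a, b]) ` ({0..<n} \<times> {0..<n})"
      using assms by (intro image_eqI[of _ _ "(v $ 1 mod n, v $ 2 mod n)"]) auto
  qed
  then have "finite (range (vec_mod n))" by (rule finite_subset) auto
  moreover have "proj_line n \<subseteq> Pow (range (vec_mod n))"
    by (auto simp: proj_line_eq line_mod_def)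
  ultimately show ?thesis by (metis finite_Pow_iff finite_subset)
qed

lemma proj_line_act_closed:
  assumes "det A = 1" "U \<in> proj_line n"
  shows "proj_line_act n A U \<in> proj_line n"
proof -
  obtain v where v: "U = line_mod n v" "vec_mod n v = v" "v \<noteq> 0"
    using assms(2) by (auto simp: proj_line_eq)
  then have "vec_mod n (A *v v) \<noteq> 0" using vec_mod_mult_eq_0_iff[OF assms(1)] by simp
  then show ?thesis using v by (auto simp: proj_line_eq proj_line_act_line_mod)
qed

lemma proj_line_act_one: "U \<in> proj_line n \<Longrightarrow> proj_line_act n (mat 1) U = U"
  by (auto simp: proj_line_eq proj_line_act_line_mod)

lemma proj_line_act_mult:
  "U \<in> proj_line n \<Longrightarrow> proj_line_act n (A ** B) U = proj_line_act n A (proj_line_act n B U)"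
  by (auto simp: proj_line_eq proj_line_act_line_mod vec_mod_mult_vec_mod matrix_vector_mul_assoc)

lemma is_rep_proj_line:
  assumes "n > 0"
  shows "is_rep SL2Z (perm_rep (proj_line n) (proj_line_act n))"
  using assms
  by (intro is_rep_perm group_SL2Z finite_proj_line)
    (auto simp: proj_line_act_closed proj_line_act_one proj_line_act_mult)

text \<open>Every line contains the zero vector, which therefore has to be avoided.\<close>

definition line_function :: "int \<Rightarrow> (int ^ 2 \<Rightarrow> 'k::zero) \<Rightarrow> ((int ^ 2) set \<Rightarrow> 'k)"
  where "line_function n F U = (if U \<in> proj_line n then F (SOME v. v \<in> U \<and> v \<noteq> 0) else 0)"

text \<open>Modulo 2 and modulo 3 the only nonzero multiples of a vector \<open>v\<close> are \<open>v\<close> and \<open>-v\<close>, so the functions with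
  this property are those that are constant on the nonzero vectors of each line.\<close>

definition even_periodic :: "int \<Rightarrow> (int ^ 2 \<Rightarrow> 'k) \<Rightarrow> bool"
  where "even_periodic n F \<longleftrightarrow> (\<forall>v. F (vec_mod n v) = F v \<and> F (- v) = F v)"

lemma even_periodic_const_on_line:
  assumes n: "n = 2 \<or> n = 3" and F: "even_periodic n F" and u: "u \<in> line_mod n v" "u \<noteq> 0"
  shows "F u = F v"
proof -
  obtain k where k: "k \<in> {0..<n}" "u = vec_mod n (k *s v)" using u by (auto simp: line_mod_def)
  have "k \<noteq> 0" using k(2) u by auto
  then consider "k = 1" | "n = 3" "k = 2" using k(1) n by fastforce
  then show ?thesis
  proof cases
    case 1
    then show ?thesis using k F by (simp add: even_periodic_def)
  next
    case 2
    have "(2 * a) mod 3 = (- a) mod 3" for a :: int by presburger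
    then have "u = vec_mod n (- v)" unfolding k(2) using 2 by (simp add: vec_eq_iff)
    then show ?thesis using F by (simp add: even_periodic_def)
  qed
qed

lemma line_function_line_mod:
  assumes n: "n = 2 \<or> n = 3" and F: "even_periodic n F" and v: "vec_mod n v \<noteq> 0"
  shows "line_function n F (line_mod n (vec_mod n v)) = F v"
proof -
  let ?v = "vec_mod n v"
  have "vec_mod n (1 *s ?v) = ?v" by simp
  then have "?v \<in> line_mod n ?v" unfolding line_mod_def using n by (intro CollectI exI[of _ 1]) auto
  then have "(SOME u. u \<in> line_mod n ?v \<and> u \<noteq> 0) \<in> line_mod n ?v \<and> (SOME u. u \<in> line_mod n ?v \<and> u \<noteq> 0) \<noteq> 0"
    using v by (intro someI[of "\<lambda>u. u \<in> line_mod n ?v \<and> u \<noteq> 0" ?v]) simp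
  then have "F (SOME u. u \<in> line_mod n ?v \<and> u \<noteq> 0) = F ?v"
    using even_periodic_const_on_line[OF n F] by blast
  then show ?thesis using v F by (auto simp: line_function_def proj_line_eq even_periodic_def)
qed

lemma perm_rep_line_function:
  fixes F :: "int ^ 2 \<Rightarrow> 'k::field"
  assumes n: "n = 2 \<or> n = 3" and F: "even_periodic n F" and F': "even_periodic n F'"
    and eq: "\<And>v. F' (A *v v) = F v" and A: "det A = 1"
  shows "snd (perm_rep (proj_line n) (proj_line_act n)) A (line_function n F) = line_function n F'"
proof
  fix U
  interpret group SL2Z by (rule group_SL2Z)
  have A': "A \<in> carrier SL2Z" using A by simp
  have inv: "det (inv\<^bsub>SL2Z\<^esub> A) = 1" "A ** inv\<^bsub>SL2Z\<^esub> A = mat 1"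
    using inv_closed[OF A'] r_inv[OF A'] by simp_all
  have "snd (perm_rep (proj_line n) (proj_line_act n)) A (line_function n F) U =
      (if U \<in> proj_line n then line_function n F (proj_line_act n (inv\<^bsub>SL2Z\<^esub> A) U) else 0)"
    using n finite_proj_line[of n] A
    by (intro perm_rep_apply[OF group_SL2Z])
      (auto simp: proj_line_act_closed proj_line_act_one proj_line_act_mult line_function_def)
  also have "\<dots> = line_function n F' U"
  proof (cases "U \<in> proj_line n")
    case True
    then obtain v where v: "U = line_mod n v" "vec_mod n v = v" "v \<noteq> 0" by (auto simp: proj_line_eq)
    let ?w = "inv\<^bsub>SL2Z\<^esub> A *v v"
    have "vec_mod n ?w \<noteq> 0" using vec_mod_mult_eq_0_iff[OF inv(1)] v by simp
    then have "line_function n F (proj_line_act n (inv\<^bsub>SL2Z\<^esub> A) U) = F ?w"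
      using v line_function_line_mod[OF n F] by (simp add: proj_line_act_line_mod)
    also have "\<dots> = F' v" using eq[of ?w, symmetric] inv by (simp add: matrix_vector_mul_assoc)
    also have "\<dots> = line_function n F' U" using line_function_line_mod[OF n F', of v] v by simp
    finally show ?thesis using True by simp
  qed (simp add: line_function_def)
  finally show "snd (perm_rep (proj_line n) (proj_line_act n)) A (line_function n F) U =
    line_function n F' U" .
qed

section \<open>The Drinfel'd double of a finite group\<close>

locale finite_group = group G for G (structure) +
  assumes finite_carrier: "finite (carrier G)"
begin

lemma cancel_left: "b \<in> carrier G \<Longrightarrow> x \<in> carrier G \<Longrightarrow> b \<otimes> (inv b \<otimes> x) = x"
  "b \<in> carrier G \<Longrightarrow> x \<in> carrier G \<Longrightarrow> inv b \<otimes> (b \<otimes> x) = x"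
  by (simp_all add: m_assoc[symmetric])

lemmas group_word_simps = m_assoc inv_mult_group cancel_left

lemma conjugate_eq_iff:
  assumes "b \<in> carrier G" "c \<in> carrier G" "a \<in> carrier G"
  shows "a = b \<otimes> c \<otimes> inv b \<longleftrightarrow> c = inv b \<otimes> a \<otimes> b"
  using assms by (auto simp: group_word_simps)

lemma mult_eq_iff:
  assumes "b \<in> carrier G" "d \<in> carrier G" "g \<in> carrier G"
  shows "g = b \<otimes> d \<longleftrightarrow> d = inv b \<otimes> g"
  using assms by (auto simp: group_word_simps)

lemma carrier_double: "carrier (drinfeld_double G :: ('a \<times> 'a \<Rightarrow> 'k::field) ring) =
    {x. \<forall>p. p \<notin> carrier G \<times> carrier G \<longrightarrow> x p = 0}"
  and zero_double: "\<zero>\<^bsub>drinfeld_double G\<^esub> = (\<lambda>_. 0 :: 'k)"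
  and add_double: "x \<oplus>\<^bsub>drinfeld_double G\<^esub> y = (\<lambda>p. x p + y p :: 'k)"
  by (simp_all add: drinfeld_double_def)

lemma one_double:
  "(\<one>\<^bsub>drinfeld_double G\<^esub> :: 'a \<times> 'a \<Rightarrow> 'k::field) (a, g) = (if a \<in> carrier G \<and> g = \<one> then 1 else 0)"
proof -
  have "(\<one>\<^bsub>drinfeld_double G\<^esub> :: 'a \<times> 'a \<Rightarrow> 'k) (a, g) =
      (\<Sum>a'\<in>carrier G. unit_at (a', \<one>) (a, g))"
    by (simp add: drinfeld_double_def)
  also have "\<dots> = (\<Sum>a'\<in>carrier G. if a' = a then (if g = \<one> then 1 else 0) else 0)"
    by (intro sum.cong refl) (auto simp: unit_at_def)
  also have "\<dots> = (if a \<in> carrier G \<and> g = \<one> then 1 else 0)"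
    using finite_carrier by (simp add: sum.delta)
  finally show ?thesis .
qed

text \<open>Only \<open>c = b\<^sup>-\<^sup>1 a b\<close> and \<open>d = b\<^sup>-\<^sup>1 g\<close> contribute to the coefficient of \<open>\<delta>\<^sub>a \<otimes> g\<close> in a product of
  \<open>\<delta>\<^sub>a \<otimes> b\<close> and \<open>\<delta>\<^sub>c \<otimes> d\<close>.\<close>

lemma mult_double:
  fixes x y :: "'a \<times> 'a \<Rightarrow> 'k::field"
  shows "(x \<otimes>\<^bsub>drinfeld_double G\<^esub> y) (a, g) = (if a \<in> carrier G \<and> g \<in> carrier G
    then \<Sum>b\<in>carrier G. x (a, b) * y (inv b \<otimes> a \<otimes> b, inv b \<otimes> g) else 0)"
proof -
  let ?C = "carrier G"
  let ?term = "\<lambda>a' b c d. x (a', b) * y (c, d) *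
    (if a' = b \<otimes> c \<otimes> inv b then unit_at (a', b \<otimes> d) (a, g) else 0)"
  have inner: "(\<Sum>(c, d)\<in>?C \<times> ?C. ?term a' b c d) =
      (if a' = a then (if g \<in> ?C then x (a, b) * y (inv b \<otimes> a \<otimes> b, inv b \<otimes> g) else 0) else 0)"
    if ab: "a' \<in> ?C" "b \<in> ?C" for a' b
  proof -
    have "(\<Sum>(c, d)\<in>?C \<times> ?C. ?term a' b c d) =
        (\<Sum>p\<in>?C \<times> ?C. if p = (inv b \<otimes> a \<otimes> b, inv b \<otimes> g)
          then (if a' = a \<and> g \<in> ?C then x (a, b) * y (inv b \<otimes> a \<otimes> b, inv b \<otimes> g) else 0) else 0)"
    proof (intro sum.cong refl)
      fix p assume "p \<in> ?C \<times> ?C"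
      then obtain c d where p: "p = (c, d)" "c \<in> ?C" "d \<in> ?C" by blast
      have iff: "a' = b \<otimes> c \<otimes> inv b \<and> (a, g) = (a', b \<otimes> d) \<longleftrightarrow>
          (c, d) = (inv b \<otimes> a \<otimes> b, inv b \<otimes> g) \<and> a' = a \<and> g \<in> ?C"
        using ab p conjugate_eq_iff[OF ab(2) p(2) ab(1)] mult_eq_iff[OF ab(2) p(3), of g]
        by (metis m_closed prod.inject)
      have "(if a' = b \<otimes> c \<otimes> inv b then unit_at (a', b \<otimes> d) (a, g) else 0 :: 'k) =
          (if a' = b \<otimes> c \<otimes> inv b \<and> (a, g) = (a', b \<otimes> d) then 1 else 0)"
        by (simp add: unit_at_def)
      then show "(case p of (c, d) \<Rightarrow> ?term a' b c d) = (if p = (inv b \<otimes> a \<otimes> b, inv b \<otimes> g)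
          then (if a' = a \<and> g \<in> ?C then x (a, b) * y (inv b \<otimes> a \<otimes> b, inv b \<otimes> g) else 0) else 0)"
        unfolding p(1) prod.case iff by (simp split: if_splits)
    qed
    also have "\<dots> = (if a' = a then (if g \<in> ?C then x (a, b) * y (inv b \<otimes> a \<otimes> b, inv b \<otimes> g) else 0) else 0)"
      using ab finite_carrier by (auto simp: sum.delta)
    finally show ?thesis .
  qed
  have "(x \<otimes>\<^bsub>drinfeld_double G\<^esub> y) (a, g) =
      (\<Sum>a'\<in>?C. \<Sum>b\<in>?C. \<Sum>(c, d)\<in>?C \<times> ?C. ?term a' b c d)"
    by (simp add: drinfeld_double_def) (subst sum.cartesian_product[symmetric], rule refl)
  also have "\<dots> = (\<Sum>a'\<in>?C. if a' = a
      then (if g \<in> ?C then \<Sum>b\<in>?C. x (a, b) * y (inv b \<otimes> a \<otimes> b, inv b \<otimes> g) else 0) else 0)"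
    by (intro sum.cong refl) (simp add: inner)
  finally show ?thesis using finite_carrier by simp
qed

lemma counit_double:
  fixes x :: "'a \<times> 'a \<Rightarrow> 'k::field"
  shows "double_counit G x = (\<Sum>b\<in>carrier G. x (\<one>, b))"
proof -
  have "double_counit G x = (\<Sum>a\<in>carrier G. \<Sum>b\<in>carrier G. if a = \<one> then x (\<one>, b) else 0)"
    unfolding double_counit_def by (subst sum.cartesian_product[symmetric]) (intro sum.cong, auto)
  also have "\<dots> = (\<Sum>a\<in>carrier G. if a = \<one> then \<Sum>b\<in>carrier G. x (\<one>, b) else 0)"
    by (intro sum.cong) auto
  finally show ?thesis using finite_carrier by simp
qed

lemma sum_translate:
  fixes h :: "'a \<Rightarrow> 'k::comm_monoid_add"
  assumes "b \<in> carrier G"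
  shows "(\<Sum>g\<in>carrier G. h (inv b \<otimes> g)) = (\<Sum>g\<in>carrier G. h g)"
  using assms by (intro sum.reindex_bij_witness[of _ "\<lambda>g. b \<otimes> g" "\<lambda>g. inv b \<otimes> g"]) (auto simp: cancel_left)

lemma counit_mult:
  fixes x y :: "'a \<times> 'a \<Rightarrow> 'k::field"
  shows "double_counit G (x \<otimes>\<^bsub>drinfeld_double G\<^esub> y) = double_counit G x * double_counit G y"
proof -
  have "double_counit G (x \<otimes>\<^bsub>drinfeld_double G\<^esub> y) =
      (\<Sum>g\<in>carrier G. \<Sum>b\<in>carrier G. x (\<one>, b) * y (\<one>, inv b \<otimes> g))"
    by (simp add: counit_double mult_double)
  also have "\<dots> = (\<Sum>b\<in>carrier G. x (\<one>, b) * (\<Sum>g\<in>carrier G. y (\<one>, inv b \<otimes> g)))"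
    by (subst sum.swap) (simp add: sum_distrib_left)
  also have "\<dots> = (\<Sum>b\<in>carrier G. x (\<one>, b) * (\<Sum>g\<in>carrier G. y (\<one>, g)))"
    using sum_translate[of _ "\<lambda>g. y (\<one>, g)"] by (intro sum.cong refl) simp
  finally show ?thesis by (simp add: counit_double sum_distrib_right)
qed

lemma counit_add: "double_counit G (x \<oplus>\<^bsub>drinfeld_double G\<^esub> y) = double_counit G x + (double_counit G y :: 'k::field)"
  by (simp add: counit_double add_double sum.distrib)

lemma counit_one: "double_counit G (\<one>\<^bsub>drinfeld_double G\<^esub> :: 'a \<times> 'a \<Rightarrow> 'k::field) = 1"
  using finite_carrier by (simp add: counit_double one_double)

lemma left_module_trivial:
  assumes "ring (drinfeld_double G :: ('a \<times> 'a \<Rightarrow> 'k::field) ring)"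
  shows "left_module (drinfeld_double G :: ('a \<times> 'a \<Rightarrow> 'k) ring) (double_trivial G)"
proof -
  have "abelian_group (double_trivial G :: ('a \<times> 'a \<Rightarrow> 'k, 'k) module)"
    by (rule abelian_groupI) (auto simp: double_trivial_def algebra_simps intro: exI[of _ "- x" for x])
  then show ?thesis using assms
    by (intro left_module.intro left_module_axioms.intro)
      (auto simp: double_trivial_def counit_add counit_mult counit_one algebra_simps)
qed

section \<open>The coadjoint module\<close>

lemma carrier_dual: "carrier (double_dual G :: ('a \<times> 'a \<Rightarrow> 'k::field, 'a \<times> 'a \<Rightarrow> 'k) module) =
    {l. \<forall>p. p \<notin> carrier G \<times> carrier G \<longrightarrow> l p = 0}"
  and zero_dual: "\<zero>\<^bsub>double_dual G\<^esub> = (\<lambda>_. 0 :: 'k)"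
  and add_dual: "l \<oplus>\<^bsub>double_dual G\<^esub> l' = (\<lambda>p. l p + l' p :: 'k)"
  by (simp_all add: double_dual_def)

text \<open>The form \<open>u(a, b)\<close> is homogeneous of degree \<open>b\<^sup>-\<^sup>1 a b a\<^sup>-\<^sup>1\<close>, and \<open>\<delta>\<^sub>h \<otimes> g\<close> conjugates by \<open>g\<close> and projects
  to degree \<open>h\<close>.\<close>

lemma smult_dual:
  fixes x l :: "'a \<times> 'a \<Rightarrow> 'k::field"
  shows "(x \<odot>\<^bsub>double_dual G\<^esub> l) (a, b) = (if a \<in> carrier G \<and> b \<in> carrier G
    then \<Sum>g\<in>carrier G. x (inv b \<otimes> a \<otimes> b \<otimes> inv a, g) * l (inv g \<otimes> a \<otimes> g, inv g \<otimes> b \<otimes> g) else 0)"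
proof -
  let ?C = "carrier G" and ?h = "inv b \<otimes> a \<otimes> b \<otimes> inv a"
  let ?v = "\<lambda>g. if a \<in> ?C \<and> b \<in> ?C then x (?h, g) * l (inv g \<otimes> a \<otimes> g, inv g \<otimes> b \<otimes> g) else 0"
  let ?term = "\<lambda>h g p. x (h, g) * l p * coadjoint_basis G (h, g) p (a, b)"
  have inner: "(\<Sum>p\<in>?C \<times> ?C. ?term h g p) = (if h = ?h then ?v g else 0)"
    if hg: "h \<in> ?C" "g \<in> ?C" for h g
  proof -
    have point: "?term h g (a', b') = (if (a', b') = (inv g \<otimes> a \<otimes> g, inv g \<otimes> b \<otimes> g)
        then (if h = ?h then ?v g else 0) else 0)" if "a' \<in> ?C" "b' \<in> ?C" for a' b'
    proof (cases "a = g \<otimes> a' \<otimes> inv g \<and> b = g \<otimes> b' \<otimes> inv g")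
      case True
      then have "a \<in> ?C" "b \<in> ?C" using that hg by auto
      moreover from this have "(a', b') = (inv g \<otimes> a \<otimes> g, inv g \<otimes> b \<otimes> g)"
        using True that hg by (simp add: group_word_simps)
      ultimately show ?thesis using True
        by (auto simp: coadjoint_basis_def Let_def unit_at_def)
    next
      case False
      then have "coadjoint_basis G (h, g) (a', b') (a, b) = (0 :: 'k)"
        by (auto simp: coadjoint_basis_def Let_def unit_at_def)
      moreover have "\<not> (a \<in> ?C \<and> b \<in> ?C)" if "(a', b') = (inv g \<otimes> a \<otimes> g, inv g \<otimes> b \<otimes> g)"
        using that False hg by (auto simp: group_word_simps)
      ultimately show ?thesis by auto
    qed
    have "(\<Sum>p\<in>?C \<times> ?C. ?term h g p) = (\<Sum>p\<in>?C \<times> ?C.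
        if p = (inv g \<otimes> a \<otimes> g, inv g \<otimes> b \<otimes> g) then (if h = ?h then ?v g else 0) else 0)"
    proof (intro sum.cong refl)
      fix p assume "p \<in> ?C \<times> ?C"
      then obtain a' b' where p: "p = (a', b')" "a' \<in> ?C" "b' \<in> ?C" by blast
      show "?term h g p = (if p = (inv g \<otimes> a \<otimes> g, inv g \<otimes> b \<otimes> g) then (if h = ?h then ?v g else 0) else 0)"
        unfolding p(1) by (rule point[OF p(2,3)])
    qed
    also have "\<dots> = (if h = ?h then ?v g else 0)"
      using finite_carrier hg by simp
    finally show ?thesis .
  qed
  have "(x \<odot>\<^bsub>double_dual G\<^esub> l) (a, b) = (\<Sum>q\<in>?C \<times> ?C. \<Sum>p\<in>?C \<times> ?C. ?term (fst q) (snd q) p)"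
    by (simp add: double_dual_def)
  also have "\<dots> = (\<Sum>h\<in>?C. \<Sum>g\<in>?C. \<Sum>p\<in>?C \<times> ?C. ?term h g p)"
    by (subst sum.cartesian_product) (simp add: case_prod_unfold)
  also have "\<dots> = (\<Sum>h\<in>?C. \<Sum>g\<in>?C. if h = ?h then ?v g else 0)"
    by (intro sum.cong refl inner)
  also have "\<dots> = (\<Sum>h\<in>?C. if h = ?h then (\<Sum>g\<in>?C. ?v g) else 0)"
    by (intro sum.cong) auto
  also have "\<dots> = (if a \<in> ?C \<and> b \<in> ?C then (\<Sum>g\<in>?C. ?v g) else 0)"
    using finite_carrier by (cases "a \<in> ?C \<and> b \<in> ?C") (auto simp: sum.delta)
  finally show ?thesis by simp
qed

lemma left_module_dual:
  assumes ring: "ring (drinfeld_double G :: ('a \<times> 'a \<Rightarrow> 'k::field) ring)"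
  shows "left_module (drinfeld_double G :: ('a \<times> 'a \<Rightarrow> 'k) ring) (double_dual G)"
proof -
  let ?D = "drinfeld_double G :: ('a \<times> 'a \<Rightarrow> 'k) ring" and ?C = "carrier G"
  let ?L = "double_dual G :: ('a \<times> 'a \<Rightarrow> 'k, 'a \<times> 'a \<Rightarrow> 'k) module"
  have "abelian_group ?L"
  proof (rule abelian_groupI)
    fix l assume "l \<in> carrier ?L"
    then show "\<exists>l'\<in>carrier ?L. l' \<oplus>\<^bsub>?L\<^esub> l = \<zero>\<^bsub>?L\<^esub>"
      by (intro bexI[of _ "\<lambda>p. - l p"]) (auto simp: carrier_dual zero_dual add_dual)
  qed (auto simp: carrier_dual zero_dual add_dual algebra_simps)
  moreover have "left_module_axioms ?D ?L"
  proof
    fix x y l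
    show "x \<odot>\<^bsub>?L\<^esub> l \<in> carrier ?L" by (auto simp: carrier_dual smult_dual)
    show "(x \<oplus>\<^bsub>?D\<^esub> y) \<odot>\<^bsub>?L\<^esub> l = x \<odot>\<^bsub>?L\<^esub> l \<oplus>\<^bsub>?L\<^esub> y \<odot>\<^bsub>?L\<^esub> l"
      by (auto simp: fun_eq_iff smult_dual add_dual add_double algebra_simps sum.distrib)
    show "x \<odot>\<^bsub>?L\<^esub> (l \<oplus>\<^bsub>?L\<^esub> l') = x \<odot>\<^bsub>?L\<^esub> l \<oplus>\<^bsub>?L\<^esub> x \<odot>\<^bsub>?L\<^esub> l'" for l'
      by (auto simp: fun_eq_iff smult_dual add_dual algebra_simps sum.distrib)
    show "\<one>\<^bsub>?D\<^esub> \<odot>\<^bsub>?L\<^esub> l = l" if "l \<in> carrier ?L"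
    proof
      fix p :: "'a \<times> 'a" obtain a b where p: "p = (a, b)" by (cases p)
      have "(\<Sum>g\<in>?C. \<one>\<^bsub>?D\<^esub> (inv b \<otimes> a \<otimes> b \<otimes> inv a, g) * l (inv g \<otimes> a \<otimes> g, inv g \<otimes> b \<otimes> g)) =
          (\<Sum>g\<in>?C. if g = \<one> then l (a, b) else 0)" if "a \<in> ?C" "b \<in> ?C"
        using that by (intro sum.cong refl) (auto simp: one_double)
      then show "(\<one>\<^bsub>?D\<^esub> \<odot>\<^bsub>?L\<^esub> l) p = l p"
        using \<open>l \<in> carrier ?L\<close> finite_carrier by (auto simp: p smult_dual carrier_dual)
    qed
    show "(x \<otimes>\<^bsub>?D\<^esub> y) \<odot>\<^bsub>?L\<^esub> l = x \<odot>\<^bsub>?L\<^esub> (y \<odot>\<^bsub>?L\<^esub> l)"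
    proof
      fix p :: "'a \<times> 'a" obtain a b where p: "p = (a, b)" by (cases p)
      show "((x \<otimes>\<^bsub>?D\<^esub> y) \<odot>\<^bsub>?L\<^esub> l) p = (x \<odot>\<^bsub>?L\<^esub> (y \<odot>\<^bsub>?L\<^esub> l)) p"
      proof (cases "a \<in> ?C \<and> b \<in> ?C")
        case True
        define h where "h = inv b \<otimes> a \<otimes> b \<otimes> inv a"
        define F where "F k = l (inv k \<otimes> a \<otimes> k, inv k \<otimes> b \<otimes> k)" for k
        have h: "h \<in> ?C" using True by (simp add: h_def)
        have "((x \<otimes>\<^bsub>?D\<^esub> y) \<odot>\<^bsub>?L\<^esub> l) p =
            (\<Sum>k\<in>?C. (\<Sum>g\<in>?C. x (h, g) * y (inv g \<otimes> h \<otimes> g, inv g \<otimes> k)) * F k)"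
          using True h unfolding p smult_dual h_def[symmetric] F_def by (simp add: mult_double)
        also have "\<dots> = (\<Sum>g\<in>?C. x (h, g) * (\<Sum>k\<in>?C. y (inv g \<otimes> h \<otimes> g, inv g \<otimes> k) * F k))"
          by (simp only: sum_distrib_right sum_distrib_left mult.assoc) (rule sum.swap)
        also have "\<dots> = (\<Sum>g\<in>?C. x (h, g) * (y \<odot>\<^bsub>?L\<^esub> l) (inv g \<otimes> a \<otimes> g, inv g \<otimes> b \<otimes> g))"
        proof (intro sum.cong refl arg_cong2[of _ _ _ _ "(*)"])
          fix g assume g: "g \<in> ?C"
          have "(\<Sum>k\<in>?C. y (inv g \<otimes> h \<otimes> g, inv g \<otimes> k) * F k) =
              (\<Sum>k\<in>?C. y (inv g \<otimes> h \<otimes> g, k) * F (g \<otimes> k))"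
            using sum_translate[OF g, of "\<lambda>k. y (inv g \<otimes> h \<otimes> g, k) * F (g \<otimes> k)"] g
            by (simp add: cancel_left cong: sum.cong)
          also have "\<dots> = (y \<odot>\<^bsub>?L\<^esub> l) (inv g \<otimes> a \<otimes> g, inv g \<otimes> b \<otimes> g)"
            using True g by (simp add: smult_dual) (intro sum.cong refl, simp add: F_def h_def group_word_simps)
          finally show "(\<Sum>k\<in>?C. y (inv g \<otimes> h \<otimes> g, inv g \<otimes> k) * F k) =
            (y \<odot>\<^bsub>?L\<^esub> l) (inv g \<otimes> a \<otimes> g, inv g \<otimes> b \<otimes> g)" .
        qed
        also have "\<dots> = (x \<odot>\<^bsub>?L\<^esub> (y \<odot>\<^bsub>?L\<^esub> l)) p"
          using True by (simp add: p h_def smult_dual[of x])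
        finally show ?thesis .
      qed (auto simp: p smult_dual)
    qed
  qed
  ultimately show ?thesis using ring by (intro left_module.intro)
qed

lemma T_tilde_apply:
  fixes l :: "'a \<times> 'a \<Rightarrow> 'k::field"
  assumes "l \<in> carrier (double_dual G)"
  shows "T_tilde G l (a, b) = (if a \<in> carrier G \<and> b \<in> carrier G then l (a, inv a \<otimes> b) else 0)"
proof -
  let ?C = "carrier G"
  have "T_tilde G l (a, b) = (\<Sum>(c, d)\<in>?C \<times> ?C. l (c, d) * unit_at (c, c \<otimes> d) (a, b))"
    using assms by (simp add: T_tilde_def)
  also have "\<dots> = (\<Sum>p\<in>?C \<times> ?C. if p = (a, inv a \<otimes> b)
      then (if a \<in> ?C \<and> b \<in> ?C then l (a, inv a \<otimes> b) else 0) else 0)"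
    by (intro sum.cong refl) (auto simp: unit_at_def cancel_left split: prod.splits)
  also have "\<dots> = (if a \<in> ?C \<and> b \<in> ?C then l (a, inv a \<otimes> b) else 0)"
    using finite_carrier by simp
  finally show ?thesis .
qed

lemma S_tilde_apply:
  fixes l :: "'a \<times> 'a \<Rightarrow> 'k::field"
  assumes "l \<in> carrier (double_dual G)"
  shows "S_tilde G l (a, b) = (if a \<in> carrier G \<and> b \<in> carrier G then l (a \<otimes> inv b \<otimes> inv a, a) else 0)"
proof -
  let ?C = "carrier G"
  have "S_tilde G l (a, b) = (\<Sum>(c, d)\<in>?C \<times> ?C. l (c, d) * unit_at (d, inv d \<otimes> inv c \<otimes> d) (a, b))"
    using assms by (simp add: S_tilde_def)
  also have "\<dots> = (\<Sum>p\<in>?C \<times> ?C. if p = (a \<otimes> inv b \<otimes> inv a, a)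
      then (if a \<in> ?C \<and> b \<in> ?C then l (a \<otimes> inv b \<otimes> inv a, a) else 0) else 0)"
    by (intro sum.cong refl) (auto simp: unit_at_def group_word_simps split: prod.splits)
  also have "\<dots> = (if a \<in> ?C \<and> b \<in> ?C then l (a \<otimes> inv b \<otimes> inv a, a) else 0)"
    using finite_carrier by simp
  finally show ?thesis .
qed

lemma T_tilde_extensional: "T_tilde G \<in> extensional (carrier (double_dual G))"
  and S_tilde_extensional: "S_tilde G \<in> extensional (carrier (double_dual G))"
  by (simp_all add: T_tilde_def S_tilde_def)

text \<open>A substitution of pairs is linear over the double if it preserves the degree and commutes with simultaneous
  conjugation.\<close>

lemma substitution_hom:
  fixes t :: "('a \<times> 'a \<Rightarrow> 'k::field) \<Rightarrow> 'a \<times> 'a \<Rightarrow> 'k"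
  assumes ring: "ring (drinfeld_double G :: ('a \<times> 'a \<Rightarrow> 'k) ring)"
    and t: "\<And>l a b. l \<in> carrier (double_dual G) \<Longrightarrow>
      t l (a, b) = (if a \<in> carrier G \<and> b \<in> carrier G then l (\<alpha> a b, \<beta> a b) else 0)"
    and closed: "\<And>a b. a \<in> carrier G \<Longrightarrow> b \<in> carrier G \<Longrightarrow> \<alpha> a b \<in> carrier G \<and> \<beta> a b \<in> carrier G"
    and degree: "\<And>a b. a \<in> carrier G \<Longrightarrow> b \<in> carrier G \<Longrightarrow>
      inv (\<beta> a b) \<otimes> \<alpha> a b \<otimes> \<beta> a b \<otimes> inv (\<alpha> a b) = inv b \<otimes> a \<otimes> b \<otimes> inv a"
    and conj: "\<And>a b g. a \<in> carrier G \<Longrightarrow> b \<in> carrier G \<Longrightarrow> g \<in> carrier G \<Longrightarrow>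
      \<alpha> (inv g \<otimes> a \<otimes> g) (inv g \<otimes> b \<otimes> g) = inv g \<otimes> \<alpha> a b \<otimes> g \<and>
      \<beta> (inv g \<otimes> a \<otimes> g) (inv g \<otimes> b \<otimes> g) = inv g \<otimes> \<beta> a b \<otimes> g"
    and ext: "t \<in> extensional (carrier (double_dual G))"
  shows "t \<in> mod_hom (drinfeld_double G) (double_dual G) (double_dual G)"
proof -
  let ?L = "double_dual G :: ('a \<times> 'a \<Rightarrow> 'k, 'a \<times> 'a \<Rightarrow> 'k) module"
  note L = left_module_dual[OF ring]
  have "restrict t (carrier ?L) \<in> mod_hom (drinfeld_double G) ?L ?L"
  proof (rule left_module_mod_homI[OF L])
    fix l assume l: "l \<in> carrier ?L"
    then show "t l \<in> carrier ?L" by (auto simp: carrier_dual t)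
    fix l' assume l': "l' \<in> carrier ?L"
    have "l \<oplus>\<^bsub>?L\<^esub> l' \<in> carrier ?L" using L l l' by (rule left_module_add_closed)
    then show "t (l \<oplus>\<^bsub>?L\<^esub> l') = t l \<oplus>\<^bsub>?L\<^esub> t l'" using l l' by (auto simp: t fun_eq_iff add_dual)
  next
    fix x :: "'a \<times> 'a \<Rightarrow> 'k" and l
    assume x: "x \<in> carrier (drinfeld_double G)" and l: "l \<in> carrier ?L"
    have "x \<odot>\<^bsub>?L\<^esub> l \<in> carrier ?L" using left_module.lsmult_closed[OF L x l] .
    then show "t (x \<odot>\<^bsub>?L\<^esub> l) = x \<odot>\<^bsub>?L\<^esub> t l"
      using l by (auto simp: fun_eq_iff t smult_dual closed degree conj intro!: sum.cong)
  qed
  moreover have "restrict t (carrier ?L) = t" using ext by (rule extensional_restrict)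
  ultimately show ?thesis by simp
qed

lemma T_tilde_hom:
  assumes "ring (drinfeld_double G :: ('a \<times> 'a \<Rightarrow> 'k::field) ring)"
  shows "T_tilde G \<in> mod_hom (drinfeld_double G) (double_dual G) (double_dual G :: ('a \<times> 'a \<Rightarrow> 'k, _) module)"
  by (rule substitution_hom[OF assms, where \<alpha> = "\<lambda>a b. a" and \<beta> = "\<lambda>a b. inv a \<otimes> b"])
    (auto simp: T_tilde_apply group_word_simps T_tilde_extensional)

lemma S_tilde_hom:
  assumes "ring (drinfeld_double G :: ('a \<times> 'a \<Rightarrow> 'k::field) ring)"
  shows "S_tilde G \<in> mod_hom (drinfeld_double G) (double_dual G) (double_dual G :: ('a \<times> 'a \<Rightarrow> 'k, _) module)"
  by (rule substitution_hom[OF assms, where \<alpha> = "\<lambda>a b. a \<otimes> inv b \<otimes> inv a" and \<beta> = "\<lambda>a b. a"])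
    (auto simp: S_tilde_apply group_word_simps S_tilde_extensional)

section \<open>Scalars and the integral\<close>

lemma double_scalar: "double_scalar G k (a, g) = (if a \<in> carrier G \<and> g = \<one> then k else 0 :: 'k::field)"
  by (simp add: double_scalar_def one_double)

lemma double_scalar_closed: "double_scalar G k \<in> carrier (drinfeld_double G :: ('a \<times> 'a \<Rightarrow> 'k::field) ring)"
  by (auto simp: carrier_double double_scalar)

lemma double_scalar_mult:
  fixes x :: "'a \<times> 'a \<Rightarrow> 'k::field"
  assumes x: "x \<in> carrier (drinfeld_double G)"
  shows "double_scalar G k \<otimes>\<^bsub>drinfeld_double G\<^esub> x = (\<lambda>p. k * x p)"
    and "x \<otimes>\<^bsub>drinfeld_double G\<^esub> double_scalar G k = (\<lambda>p. k * x p)"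
proof -
  let ?C = "carrier G"
  have 1: "(\<Sum>b\<in>?C. double_scalar G k (a, b) * x (inv b \<otimes> a \<otimes> b, inv b \<otimes> g)) = k * x (a, g)"
    if "a \<in> ?C" "g \<in> ?C" for a g
  proof -
    have "(\<Sum>b\<in>?C. double_scalar G k (a, b) * x (inv b \<otimes> a \<otimes> b, inv b \<otimes> g)) =
        (\<Sum>b\<in>?C. if b = \<one> then k * x (a, g) else 0)"
      using that by (intro sum.cong refl) (auto simp: double_scalar)
    then show ?thesis using finite_carrier by simp
  qed
  have 2: "(\<Sum>b\<in>?C. x (a, b) * double_scalar G k (inv b \<otimes> a \<otimes> b, inv b \<otimes> g)) = k * x (a, g)"
    if "a \<in> ?C" "g \<in> ?C" for a g
  proof -
    have "(\<Sum>b\<in>?C. x (a, b) * double_scalar G k (inv b \<otimes> a \<otimes> b, inv b \<otimes> g)) =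
        (\<Sum>b\<in>?C. if b = g then k * x (a, g) else 0)"
    proof (intro sum.cong refl)
      fix b assume b: "b \<in> ?C"
      have "\<one> = inv b \<otimes> g \<longleftrightarrow> b = g" using mult_eq_iff[OF b one_closed that(2)] b by auto
      then show "x (a, b) * double_scalar G k (inv b \<otimes> a \<otimes> b, inv b \<otimes> g) = (if b = g then k * x (a, g) else 0)"
        using that b by (simp add: double_scalar eq_commute[of _ \<one>])
    qed
    then show ?thesis using finite_carrier that by simp
  qed
  show "double_scalar G k \<otimes>\<^bsub>drinfeld_double G\<^esub> x = (\<lambda>p. k * x p)"
    using x by (auto simp: fun_eq_iff mult_double 1 carrier_double)
  show "x \<otimes>\<^bsub>drinfeld_double G\<^esub> double_scalar G k = (\<lambda>p. k * x p)"
    using x by (auto simp: fun_eq_iff mult_double 2 carrier_double)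
qed

lemma double_scalar_smult:
  fixes l :: "'a \<times> 'a \<Rightarrow> 'k::field"
  assumes l: "l \<in> carrier (double_dual G)"
  shows "double_scalar G k \<odot>\<^bsub>double_dual G\<^esub> l = (\<lambda>p. k * l p)"
proof -
  let ?C = "carrier G"
  have "(\<Sum>g\<in>?C. double_scalar G k (h, g) * l (inv g \<otimes> a \<otimes> g, inv g \<otimes> b \<otimes> g)) = k * l (a, b)"
    if "a \<in> ?C" "b \<in> ?C" "h \<in> ?C" for a b h
  proof -
    have "(\<Sum>g\<in>?C. double_scalar G k (h, g) * l (inv g \<otimes> a \<otimes> g, inv g \<otimes> b \<otimes> g)) =
        (\<Sum>g\<in>?C. if g = \<one> then k * l (a, b) else 0)"
      using that by (intro sum.cong refl) (auto simp: double_scalar)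
    then show ?thesis using finite_carrier by simp
  qed
  then show ?thesis using l by (auto simp: fun_eq_iff smult_dual carrier_dual)
qed

text \<open>The element \<open>\<delta>\<^sub>e \<otimes> \<Sum>h\<close>, with \<open>h\<close> ranging over \<open>H\<close>.\<close>

definition subset_sum :: "'a set \<Rightarrow> ('a \<times> 'a \<Rightarrow> 'k::field)"
  where "subset_sum H = (\<lambda>(a, b). if a = \<one> \<and> b \<in> H then 1 else 0)"

lemma subset_sum_apply: "subset_sum H (a, b) = (if a = \<one> \<and> b \<in> H then 1 else 0 :: 'k::field)"
  by (simp add: subset_sum_def)

lemma subset_sum_closed: "H \<subseteq> carrier G \<Longrightarrow> subset_sum H \<in> carrier (drinfeld_double G :: ('a \<times> 'a \<Rightarrow> 'k::field) ring)"
  by (auto simp: carrier_double subset_sum_apply)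

lemma counit_subset_sum:
  "H \<subseteq> carrier G \<Longrightarrow> double_counit G (subset_sum H :: 'a \<times> 'a \<Rightarrow> 'k::field) = of_nat (card H)"
  using finite_carrier by (auto simp: counit_double subset_sum_apply sum.If_cases Int_absorb1)

lemma subset_sum_mult:
  fixes x :: "'a \<times> 'a \<Rightarrow> 'k::field"
  assumes "H \<subseteq> carrier G"
  shows "(subset_sum H \<otimes>\<^bsub>drinfeld_double G\<^esub> x) (a, g) =
    (if a = \<one> \<and> g \<in> carrier G then \<Sum>b\<in>H. x (\<one>, inv b \<otimes> g) else 0)"
proof -
  have "(\<Sum>b\<in>carrier G. subset_sum H (\<one>, b) * x (inv b \<otimes> \<one> \<otimes> b, inv b \<otimes> g)) =
      (\<Sum>b\<in>H. x (\<one>, inv b \<otimes> g))"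
    using assms finite_carrier
    by (intro sum.mono_neutral_cong_right) (auto simp: subset_sum_apply)
  moreover have "(\<Sum>b\<in>carrier G. subset_sum H (a, b) * x (inv b \<otimes> a \<otimes> b, inv b \<otimes> g)) = 0" if "a \<noteq> \<one>"
    using that by (intro sum.neutral) (auto simp: subset_sum_apply)
  ultimately show ?thesis by (simp add: mult_double)
qed

lemma mult_subset_sum:
  fixes x :: "'a \<times> 'a \<Rightarrow> 'k::field"
  assumes "H \<subseteq> carrier G"
  shows "(x \<otimes>\<^bsub>drinfeld_double G\<^esub> subset_sum H) (a, g) =
    (if a = \<one> \<and> g \<in> carrier G then \<Sum>b\<in>H. x (\<one>, g \<otimes> inv b) else 0)"
proof -
  let ?C = "carrier G"
  have "(\<Sum>b\<in>?C. x (\<one>, b) * subset_sum H (inv b \<otimes> \<one> \<otimes> b, inv b \<otimes> g)) =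
      (\<Sum>b\<in>{b\<in>?C. inv b \<otimes> g \<in> H}. x (\<one>, b))"
    using assms finite_carrier
    by (intro sum.mono_neutral_cong_right) (auto simp: subset_sum_apply)
  also have "\<dots> = (\<Sum>b\<in>H. x (\<one>, g \<otimes> inv b))" if "g \<in> ?C"
    using that assms
    by (intro sum.reindex_bij_witness[of _ "\<lambda>b. g \<otimes> inv b" "\<lambda>b. inv b \<otimes> g"])
      (auto simp: group_word_simps subset_iff)
  finally have "(\<Sum>b\<in>?C. x (\<one>, b) * subset_sum H (inv b \<otimes> \<one> \<otimes> b, inv b \<otimes> g)) =
      (\<Sum>b\<in>H. x (\<one>, g \<otimes> inv b))" if "g \<in> ?C" using that .
  moreover have "(\<Sum>b\<in>?C. x (a, b) * subset_sum H (inv b \<otimes> a \<otimes> b, inv b \<otimes> g)) = 0"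
    if "a \<noteq> \<one>" "a \<in> ?C"
  proof (rule sum.neutral, rule ballI)
    fix b assume "b \<in> ?C"
    then have "inv b \<otimes> a \<otimes> b \<noteq> \<one>"
      using that by (metis conjugate_eq_iff l_one one_closed r_inv m_closed inv_closed r_one)
    then show "x (a, b) * subset_sum H (inv b \<otimes> a \<otimes> b, inv b \<otimes> g) = 0" by (simp add: subset_sum_apply)
  qed
  ultimately show ?thesis by (simp add: mult_double)
qed

text \<open>Multiplication by a group element permutes the summands, so the sum over the whole group is a two-sided
  integral of the double.\<close>

lemma integral_mult:
  fixes x :: "'a \<times> 'a \<Rightarrow> 'k::field"
  shows "subset_sum (carrier G) \<otimes>\<^bsub>drinfeld_double G\<^esub> x = (\<lambda>p. double_counit G x * subset_sum (carrier G) p)"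
    and "x \<otimes>\<^bsub>drinfeld_double G\<^esub> subset_sum (carrier G) = (\<lambda>p. double_counit G x * subset_sum (carrier G) p)"
proof -
  let ?C = "carrier G"
  have "(\<Sum>b\<in>?C. x (\<one>, inv b \<otimes> g)) = (\<Sum>b\<in>?C. x (\<one>, b))" if "g \<in> ?C" for g
    using that by (intro sum.reindex_bij_witness[of _ "\<lambda>b. g \<otimes> inv b" "\<lambda>b. inv b \<otimes> g"])
      (auto simp: group_word_simps)
  then show "subset_sum ?C \<otimes>\<^bsub>drinfeld_double G\<^esub> x = (\<lambda>p. double_counit G x * subset_sum ?C p)"
    by (auto simp: fun_eq_iff subset_sum_mult counit_double subset_sum_apply)
  have "(\<Sum>b\<in>?C. x (\<one>, g \<otimes> inv b)) = (\<Sum>b\<in>?C. x (\<one>, b))" if "g \<in> ?C" for g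
    using that by (intro sum.reindex_bij_witness[of _ "\<lambda>b. inv b \<otimes> g" "\<lambda>b. g \<otimes> inv b"])
      (auto simp: group_word_simps)
  then show "x \<otimes>\<^bsub>drinfeld_double G\<^esub> subset_sum ?C = (\<lambda>p. double_counit G x * subset_sum ?C p)"
    by (auto simp: fun_eq_iff mult_subset_sum counit_double subset_sum_apply)
qed

lemma subset_sum_smult:
  fixes l :: "'a \<times> 'a \<Rightarrow> 'k::field"
  assumes "H \<subseteq> carrier G"
  shows "(subset_sum H \<odot>\<^bsub>double_dual G\<^esub> l) (a, b) =
    (if a \<in> carrier G \<and> b \<in> carrier G \<and> a \<otimes> b = b \<otimes> a
     then \<Sum>g\<in>H. l (inv g \<otimes> a \<otimes> g, inv g \<otimes> b \<otimes> g) else 0)"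
proof (cases "a \<in> carrier G \<and> b \<in> carrier G")
  case True
  then have comm: "inv b \<otimes> a \<otimes> b \<otimes> inv a = \<one> \<longleftrightarrow> a \<otimes> b = b \<otimes> a"
  proof -
    have "a \<otimes> b = b \<otimes> (inv b \<otimes> a \<otimes> b \<otimes> inv a) \<otimes> a"
      using True by (simp add: group_word_simps)
    moreover have "inv b \<otimes> a \<otimes> b \<otimes> inv a = inv b \<otimes> (a \<otimes> b) \<otimes> inv a"
      using True by (simp add: group_word_simps)
    moreover have "inv b \<otimes> (b \<otimes> a) \<otimes> inv a = \<one>"
      using True by (simp add: group_word_simps)
    ultimately show ?thesis using True by (metis r_one)
  qed
  have "(\<Sum>g\<in>carrier G. subset_sum H (inv b \<otimes> a \<otimes> b \<otimes> inv a, g) * l (inv g \<otimes> a \<otimes> g, inv g \<otimes> b \<otimes> g)) =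
      (\<Sum>g\<in>H. if a \<otimes> b = b \<otimes> a then l (inv g \<otimes> a \<otimes> g, inv g \<otimes> b \<otimes> g) else 0)"
    using assms finite_carrier
    by (intro sum.mono_neutral_cong_right) (auto simp: subset_sum_apply comm)
  then show ?thesis using True by (simp add: smult_dual)
qed (auto simp: smult_dual)

end

section \<open>The symmetric group on three letters\<close>

abbreviation S3 :: "(nat \<Rightarrow> nat) monoid"
  where "S3 \<equiv> sym_group 3"

abbreviation conj3 :: "(nat \<Rightarrow> nat) \<Rightarrow> (nat \<Rightarrow> nat) \<Rightarrow> (nat \<Rightarrow> nat)"
  where "conj3 g x \<equiv> inv\<^bsub>S3\<^esub> g \<otimes>\<^bsub>S3\<^esub> x \<otimes>\<^bsub>S3\<^esub> g"

type_synonym perm_pair = "(nat \<Rightarrow> nat) \<times> (nat \<Rightarrow> nat)"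

text \<open>The elements of the symmetric group on three letters are the affine maps \<open>x \<mapsto> e x + k\<close> modulo 3 with
  \<open>e = 1\<close> (rotations) or \<open>e = -1\<close> (reflections), the residues being represented by \<open>1, 2, 3\<close>.  In this form the
  multiplication table consists of four rules, and the powers of a 3-cycle are parametrised by integers.\<close>

definition affine_3 :: "int \<Rightarrow> int \<Rightarrow> nat \<Rightarrow> nat"
  where "affine_3 e k x = (if x \<in> {1..3} then nat (1 + (e * int x + k - 1) mod 3) else x)"

definition rot :: "int \<Rightarrow> nat \<Rightarrow> nat"
  where "rot = affine_3 1"

definition mirror :: "int \<Rightarrow> nat \<Rightarrow> nat"
  where "mirror = affine_3 (-1)"

lemma affine_3_inside: "x \<in> {1..3} \<Longrightarrow> affine_3 e k x = nat (1 + (e * int x + k - 1) mod 3)"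
  and affine_3_outside: "x \<notin> {1..3} \<Longrightarrow> affine_3 e k x = x"
  unfolding affine_3_def by (simp_all only: if_True if_False)

lemma affine_3_range: "x \<in> {1..3} \<Longrightarrow> affine_3 e k x \<in> {1..3}"
proof -
  have "0 \<le> (e * int x + k - 1) mod 3" "(e * int x + k - 1) mod 3 < 3" by simp_all
  then show "affine_3 e k x \<in> {1..3}" if "x \<in> {1..3}" using that unfolding affine_3_def by auto
qed

lemma affine_3_comp: "affine_3 e k \<circ> affine_3 e' k' = affine_3 (e * e') (e * k' + k)"
proof
  fix x
  show "(affine_3 e k \<circ> affine_3 e' k') x = affine_3 (e * e') (e * k' + k) x"
  proof (cases "x \<in> {1..3}")
    case True
    have int: "int (affine_3 e' k' x) = 1 + (e' * int x + k' - 1) mod 3"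
      by (simp add: affine_3_inside[OF True])
    have "(e * (1 + (e' * int x + k' - 1) mod 3) + k - 1) mod 3 =
        (e * (1 + (e' * int x + k' - 1)) + k - 1) mod 3"
      by (intro mod_diff_cong mod_add_cong mod_mult_cong) (simp_all add: mod_simps)
    then have "(e * int (affine_3 e' k' x) + k - 1) mod 3 = (e * e' * int x + (e * k' + k) - 1) mod 3"
      unfolding int by (simp add: algebra_simps)
    then show ?thesis
      unfolding o_apply affine_3_inside[OF affine_3_range[OF True]] affine_3_inside[OF True, of "e * e'"]
      by simp
  next
    case False
    show ?thesis unfolding o_apply affine_3_outside[OF False] ..
  qed
qed

lemma affine_3_eq_iff: "affine_3 e k = affine_3 e k' \<longleftrightarrow> k mod 3 = k' mod 3"
proof
  assume "affine_3 e k = affine_3 e k'"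
  then have "affine_3 e k 1 = affine_3 e k' 1" by simp
  then have "(e + k - 1) mod 3 = (e + k' - 1) mod 3"
    using pos_mod_sign[of 3 "e + k - 1"] pos_mod_sign[of 3 "e + k' - 1"] by (simp add: affine_3_def)
  then have "(e + k - 1 - (e - 1)) mod 3 = (e + k' - 1 - (e - 1)) mod 3" by (rule mod_diff_cong) (rule refl)
  then show "k mod 3 = k' mod 3" by simp
next
  assume "k mod 3 = k' mod 3"
  then have "(e * int x + k - 1) mod 3 = (e * int x + k' - 1) mod 3" for x
    by (intro mod_diff_cong mod_add_cong) simp_all
  then show "affine_3 e k = affine_3 e k'" by (simp add: affine_3_def fun_eq_iff)
qed

lemma affine_3_id: "affine_3 1 0 = id"
proof
  fix x show "affine_3 1 0 x = id x"
  proof (cases "x \<in> {1..3}")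
    case True
    then have "x = 1 \<or> x = 2 \<or> x = 3" by auto
    then show ?thesis by (auto simp: affine_3_def)
  qed (simp add: affine_3_def)
qed

lemma affine_3_closed: "e * e = 1 \<Longrightarrow> affine_3 e k \<in> carrier S3"
proof -
  assume e: "e * e = 1"
  have "affine_3 e k \<circ> affine_3 e (- e * k) = id"
    using e by (simp add: affine_3_comp affine_3_id mult.assoc[symmetric])
  moreover have "affine_3 e (- e * k) \<circ> affine_3 e k = id"
    using e by (simp add: affine_3_comp affine_3_id)
  ultimately have "bij (affine_3 e k)" by (metis o_bij)
  then show "affine_3 e k \<in> carrier S3"
    by (auto simp: sym_group_carrier permutes_def bij_iff affine_3_def)
qed

lemma rot_closed [simp]: "rot i \<in> carrier S3" and mirror_closed [simp]: "mirror i \<in> carrier S3"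
  by (simp_all add: rot_def mirror_def affine_3_closed)

lemma S3_mult [simp]:
  "rot i \<otimes>\<^bsub>S3\<^esub> rot j = rot (i + j)" "rot i \<otimes>\<^bsub>S3\<^esub> mirror j = mirror (i + j)"
  "mirror i \<otimes>\<^bsub>S3\<^esub> rot j = mirror (i - j)" "mirror i \<otimes>\<^bsub>S3\<^esub> mirror j = rot (i - j)"
  by (simp_all add: rot_def mirror_def sym_group_mult affine_3_comp algebra_simps)

lemma S3_one [simp]: "\<one>\<^bsub>S3\<^esub> = rot 0"
  by (simp add: rot_def affine_3_id sym_group_one)

declare sym_group_inv_equality [simp del]

interpretation S3: group S3
  by (rule sym_group_is_group)

lemma S3_inv [simp]: "inv\<^bsub>S3\<^esub> rot i = rot (- i)" "inv\<^bsub>S3\<^esub> mirror i = mirror i"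
  by (rule S3.inv_equality; simp)+

lemma rot_eq_iff: "rot i = rot j \<longleftrightarrow> i mod 3 = j mod 3"
  and mirror_eq_iff: "mirror i = mirror j \<longleftrightarrow> i mod 3 = j mod 3"
  by (simp_all add: rot_def mirror_def affine_3_eq_iff)

lemma rot_neq_mirror [simp]: "rot i \<noteq> mirror j" "mirror j \<noteq> rot i"
proof -
  have "rot i \<noteq> mirror j"
  proof
    assume "rot i = mirror j"
    then have "rot i \<otimes>\<^bsub>S3\<^esub> rot 1 = mirror j \<otimes>\<^bsub>S3\<^esub> rot 1" "rot 1 \<otimes>\<^bsub>S3\<^esub> rot i = rot 1 \<otimes>\<^bsub>S3\<^esub> mirror j" by simp_all
    moreover have "rot i \<otimes>\<^bsub>S3\<^esub> rot 1 = rot 1 \<otimes>\<^bsub>S3\<^esub> rot i" by (simp add: add.commute)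
    ultimately have "mirror (j - 1) = mirror (1 + j)" by simp
    then show False unfolding mirror_eq_iff by presburger
  qed
  then show "rot i \<noteq> mirror j" "mirror j \<noteq> rot i" by auto
qed

definition A3 :: "(nat \<Rightarrow> nat) set"
  where "A3 = rot ` {0, 1, 2}"

lemma rot_normalize [simp]:
  "rot (-1) = rot 2" "rot (-2) = rot 1" "rot (-3) = rot 0" "rot (-4) = rot 2" "rot 3 = rot 0" "rot 4 = rot 1"
  "mirror (-1) = mirror 2" "mirror (-2) = mirror 1" "mirror (-3) = mirror 0" "mirror (-4) = mirror 2" "mirror 3 = mirror 0" "mirror 4 = mirror 1"
  by (simp_all add: rot_eq_iff mirror_eq_iff)

lemma rot_cases: obtains "rot i = rot 0" | "rot i = rot 1" | "rot i = rot 2"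
proof -
  have "i mod 3 = 0 \<or> i mod 3 = 1 \<or> i mod 3 = 2" by presburger
  then show thesis using that by (auto simp: rot_eq_iff)
qed

lemma mirror_cases: obtains "mirror i = mirror 0" | "mirror i = mirror 1" | "mirror i = mirror 2"
proof -
  have "i mod 3 = 0 \<or> i mod 3 = 1 \<or> i mod 3 = 2" by presburger
  then show thesis using that by (auto simp: mirror_eq_iff)
qed

lemma rot_in_A3 [simp]: "rot i \<in> A3" and mirror_notin_A3 [simp]: "mirror i \<notin> A3"
  by (cases rule: rot_cases[of i]) (auto simp: A3_def)

lemma S3_carrier: "carrier S3 = rot ` {0, 1, 2} \<union> mirror ` {0, 1, 2}"
proof -
  let ?B = "rot ` {0, 1, 2} \<union> mirror ` {0, 1, 2}"
  have "card ?B = 6" by (simp add: rot_eq_iff mirror_eq_iff card_insert_if image_iff)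
  moreover have "card (carrier S3) = 6"
    using card_permutations[of "{1..3 :: nat}" 3] by (simp add: sym_group_def fact_numeral)
  moreover have "finite (carrier S3)"
    using finite_permutations[of "{1..3 :: nat}"] by (simp add: sym_group_def)
  ultimately show ?thesis by (intro card_subset_eq[symmetric]) auto
qed

lemma S3_cases:
  assumes "g \<in> carrier S3"
  obtains i where "g = rot i" | i where "g = mirror i"
  using assms unfolding S3_carrier by blast

interpretation S3: finite_group S3
  by standard (simp add: S3_carrier)

lemma A3_subset: "A3 \<subseteq> carrier S3"
  by (auto simp: A3_def)

lemma sum_A3: "sum h A3 = h (rot 0) + h (rot 1) + (h (rot 2) :: 'k::comm_monoid_add)"
  by (simp add: A3_def rot_eq_iff image_iff add.assoc)

lemma sum_S3: "sum h (carrier S3) =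
    h (rot 0) + h (rot 1) + h (rot 2) + h (mirror 0) + h (mirror 1) + (h (mirror 2) :: 'k::comm_monoid_add)"
  by (simp add: S3_carrier rot_eq_iff mirror_eq_iff image_iff add_ac)

lemma card_A3: "card A3 = 3"
  using sum_A3[of "\<lambda>_. 1 :: nat"] by simp

lemma card_S3: "card (carrier S3) = 6"
  using sum_S3[of "\<lambda>_. 1 :: nat"] by simp

section \<open>The trivial module of the double of the symmetric group in characteristic two\<close>

lemma char_2_numerals:
  assumes "CHAR('k::field) = 2"
  shows "(2 :: 'k) = 0" "(3 :: 'k) = 1" "(6 :: 'k) = 0" "x + x = (0 :: 'k)" "- x = (x :: 'k)"
proof -
  have two: "(2 :: 'k) = 0"
    using of_nat_CHAR[where 'a = 'k] assms by simp
  have "(3 :: 'k) = 2 + 1" "(6 :: 'k) = 2 * 3" by simp_all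
  then show "(3 :: 'k) = 1" "(6 :: 'k) = 0" using two by simp_all
  have "x + x = 2 * x" by simp
  then show "x + x = 0" using two by simp
  then show "- x = x" by (simp add: eq_neg_iff_add_eq_0 minus_equation_iff)
  show "(2 :: 'k) = 0" by (rule two)
qed

abbreviation D3 :: "(perm_pair \<Rightarrow> 'k::field) ring"
  where "D3 \<equiv> drinfeld_double S3"

abbreviation L3 :: "(perm_pair \<Rightarrow> 'k::field, perm_pair \<Rightarrow> 'k) module"
  where "L3 \<equiv> double_dual S3"

text \<open>The elements \<open>f\<close> and \<open>\<Lambda>\<close> of the introduction.\<close>

abbreviation idem3 :: "perm_pair \<Rightarrow> 'k::field"
  where "idem3 \<equiv> S3.subset_sum A3"

abbreviation integral3 :: "perm_pair \<Rightarrow> 'k::field"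
  where "integral3 \<equiv> S3.subset_sum (carrier S3)"

text \<open>The equation \<open>f a = a\<close> says that \<open>a\<close> is supported on \<open>\<delta>\<^sub>e \<otimes> S\<^sub>3\<close> with coefficients constant on the two cosets
  of \<open>A\<^sub>3\<close>, say \<open>\<alpha>\<close> and \<open>\<beta>\<close>.  Its counit is \<open>3 (\<alpha> + \<beta>) = \<alpha> + \<beta>\<close>.  If this vanishes then
  \<open>\<beta> = - \<alpha> = \<alpha>\<close>, and \<open>a\<close> is a multiple of the integral.  Both exactness conditions reduce to
  this, since \<open>\<Lambda> a = \<epsilon>(a) \<Lambda>\<close>.\<close>

lemma S3_periodic_resolution:
  fixes P :: "nat \<Rightarrow> (perm_pair \<Rightarrow> 'k::field, 'p) module"
  assumes char: "CHAR('k) = 2" and res: "projective_resolution D3 P d aug (double_trivial S3)"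
  shows "periodic_resolution D3 P d aug (double_trivial S3) 1 idem3 integral3"
proof -
  note char = char_2_numerals[OF char]
  have ring: "ring (D3 :: (_ \<Rightarrow> 'k) ring)"
  proof (rule left_module_ring)
    have "projective_module D3 (P 0)" using res by (simp add: projective_resolution_def)
    then show "left_module D3 (P 0)" by (simp add: projective_module_def)
  qed
  have trivial: "a \<odot>\<^bsub>double_trivial S3\<^esub> x = double_counit S3 a * (x :: 'k)" for a x
    by (simp add: double_trivial_def)
  have counit_idem: "double_counit S3 idem3 = (1 :: 'k)"
    by (simp add: S3.counit_subset_sum A3_subset card_A3 char)
  have counit_integral: "double_counit S3 integral3 = (0 :: 'k)"
    by (simp add: S3.counit_subset_sum card_S3 char)
  have counit_scalar: "double_counit S3 (double_scalar S3 k) = k" for k :: 'k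
    by (simp add: S3.counit_double S3.double_scalar sum_S3 rot_eq_iff)
  have idem_mult: "(idem3 \<otimes>\<^bsub>D3\<^esub> a) (h, g) = (if h = rot 0 \<and> g \<in> carrier S3
      then \<Sum>b\<in>A3. a (rot 0, inv\<^bsub>S3\<^esub> b \<otimes>\<^bsub>S3\<^esub> g) else 0)" for a :: "_ \<Rightarrow> 'k" and h g
    using S3.subset_sum_mult[OF A3_subset, of a h g] by simp
  have ann: "\<exists>b\<in>carrier D3. a = integral3 \<otimes>\<^bsub>D3\<^esub> b"
    if fixed: "idem3 \<otimes>\<^bsub>D3\<^esub> a = a" and counit: "double_counit S3 a = 0" for a :: "_ \<Rightarrow> 'k"
  proof -
    define \<alpha> where "\<alpha> = a (rot 0, rot 0) + a (rot 0, rot 1) + a (rot 0, rot 2)"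
    define \<beta> where "\<beta> = a (rot 0, mirror 0) + a (rot 0, mirror 1) + a (rot 0, mirror 2)"
    have zero: "a (h, g) = 0" if "\<not> (h = rot 0 \<and> g \<in> carrier S3)" for h g
      using arg_cong[OF fixed, of "\<lambda>x. x (h, g)"] that by (auto simp: idem_mult)
    have rot: "a (rot 0, rot i) = \<alpha>" for i
    proof -
      have "(idem3 \<otimes>\<^bsub>D3\<^esub> a) (rot 0, rot 0) = \<alpha>" "(idem3 \<otimes>\<^bsub>D3\<^esub> a) (rot 0, rot 1) = \<alpha>"
        "(idem3 \<otimes>\<^bsub>D3\<^esub> a) (rot 0, rot 2) = \<alpha>"
        unfolding idem_mult by (simp_all add: sum_A3 \<alpha>_def \<beta>_def add_ac)
      then show ?thesis unfolding fixed by (cases rule: rot_cases[of i]) simp_all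
    qed
    have mirror: "a (rot 0, mirror i) = \<beta>" for i
    proof -
      have "(idem3 \<otimes>\<^bsub>D3\<^esub> a) (rot 0, mirror 0) = \<beta>" "(idem3 \<otimes>\<^bsub>D3\<^esub> a) (rot 0, mirror 1) = \<beta>"
        "(idem3 \<otimes>\<^bsub>D3\<^esub> a) (rot 0, mirror 2) = \<beta>"
        unfolding idem_mult by (simp_all add: sum_A3 \<alpha>_def \<beta>_def add_ac)
      then show ?thesis unfolding fixed by (cases rule: mirror_cases[of i]) simp_all
    qed
    have "\<alpha> + \<beta> = 0" using counit by (simp add: S3.counit_double sum_S3 \<alpha>_def \<beta>_def add_ac)
    then have "\<beta> = \<alpha>" using char(5)[of \<alpha>] by (metis add_eq_0_iff)
    then have "a (h, g) = \<alpha> * integral3 (h, g)" for h g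
      using zero[of h g] rot mirror
      by (cases "h = rot 0 \<and> g \<in> carrier S3") (auto simp: S3.subset_sum_apply elim!: S3_cases)
    then have "a = integral3 \<otimes>\<^bsub>D3\<^esub> double_scalar S3 \<alpha>"
      by (auto simp: fun_eq_iff S3.integral_mult counit_scalar)
    then show ?thesis using S3.double_scalar_closed by blast
  qed
  show ?thesis
  proof (intro periodic_resolution.intro resolved_module.intro periodic_resolution_axioms.intro)
    show "left_module (D3 :: (_ \<Rightarrow> 'k) ring) (double_trivial S3)" by (rule S3.left_module_trivial[OF ring])
    show "projective_resolution D3 P d aug (double_trivial S3)" by (rule res)
    show "(1 :: 'k) \<in> carrier (double_trivial S3)" by (simp add: double_trivial_def)
    show "\<exists>a\<in>carrier D3. y = a \<odot>\<^bsub>double_trivial S3\<^esub> 1" for y :: 'k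
      using S3.double_scalar_closed counit_scalar by (intro bexI[of _ "double_scalar S3 y"]) (simp_all add: trivial)
    show "idem3 \<in> carrier (D3 :: (_ \<Rightarrow> 'k) ring)" by (rule S3.subset_sum_closed[OF A3_subset])
    show "integral3 \<in> carrier (D3 :: (_ \<Rightarrow> 'k) ring)" by (rule S3.subset_sum_closed) simp
    show "idem3 \<otimes>\<^bsub>D3\<^esub> a = a \<otimes>\<^bsub>D3\<^esub> idem3" for a :: "_ \<Rightarrow> 'k"
    proof -
      have "(\<Sum>b\<in>A3. a (rot 0, inv\<^bsub>S3\<^esub> b \<otimes>\<^bsub>S3\<^esub> g)) = (\<Sum>b\<in>A3. a (rot 0, g \<otimes>\<^bsub>S3\<^esub> inv\<^bsub>S3\<^esub> b))"
        if "g \<in> carrier S3" for g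
        using that
      proof (cases rule: S3_cases)
        case (2 i)
        have "mirror (i - 1) = mirror (i + 2)" "mirror (i - 2) = mirror (i + 1)"
          unfolding mirror_eq_iff by presburger+
        then show ?thesis unfolding 2 sum_A3 S3_inv S3_mult by simp
      next
        case (1 i)
        show ?thesis unfolding 1 sum_A3 S3_inv S3_mult by (simp add: add.commute)
      qed
      then show ?thesis
        by (intro ext) (simp add: idem_mult S3.mult_subset_sum[OF A3_subset] split_paired_all)
    qed
    show "idem3 \<otimes>\<^bsub>D3\<^esub> idem3 = (idem3 :: _ \<Rightarrow> 'k)"
    proof -
      have "(idem3 \<otimes>\<^bsub>D3\<^esub> idem3) (h, g) = (idem3 (h, g) :: 'k)" for h g
      proof (cases "g \<in> carrier S3")
        case True
        then show ?thesis
          by (cases rule: S3_cases) (simp_all add: idem_mult sum_A3 S3.subset_sum_apply char)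
      qed (use A3_subset in \<open>auto simp: idem_mult S3.subset_sum_apply\<close>)
      then show ?thesis by auto
    qed
    show "idem3 \<odot>\<^bsub>double_trivial S3\<^esub> 1 = (1 :: 'k)" by (simp add: trivial counit_idem)
    show "integral3 \<odot>\<^bsub>double_trivial S3\<^esub> 1 = \<zero>\<^bsub>double_trivial S3 :: (_ \<Rightarrow> 'k, 'k) module\<^esub>"
      by (simp add: trivial counit_integral) (simp add: double_trivial_def)
    show "integral3 \<otimes>\<^bsub>D3\<^esub> a = a \<otimes>\<^bsub>D3\<^esub> integral3" for a :: "_ \<Rightarrow> 'k" by (simp add: S3.integral_mult)
    show "idem3 \<otimes>\<^bsub>D3\<^esub> integral3 = (integral3 :: _ \<Rightarrow> 'k)" by (simp add: S3.integral_mult counit_idem)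
    show "integral3 \<otimes>\<^bsub>D3\<^esub> integral3 = \<zero>\<^bsub>D3 :: (_ \<Rightarrow> 'k) ring\<^esub>"
      by (simp add: S3.integral_mult counit_integral S3.zero_double)
    show "\<exists>b\<in>carrier D3. a = integral3 \<otimes>\<^bsub>D3\<^esub> b"
      if "idem3 \<otimes>\<^bsub>D3\<^esub> a = a" "a \<odot>\<^bsub>double_trivial S3\<^esub> 1 = \<zero>\<^bsub>double_trivial S3\<^esub>" for a :: "_ \<Rightarrow> 'k"
      using that by (intro ann) (simp_all add: trivial, simp add: double_trivial_def)
    show "\<exists>b\<in>carrier D3. a = integral3 \<otimes>\<^bsub>D3\<^esub> b"
      if "idem3 \<otimes>\<^bsub>D3\<^esub> a = a" "integral3 \<otimes>\<^bsub>D3\<^esub> a = \<zero>\<^bsub>D3\<^esub>" for a :: "_ \<Rightarrow> 'k"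
    proof (rule ann)
      have "double_counit S3 a * integral3 (rot 0, rot 0) = 0"
        using fun_cong[OF that(2), of "(rot 0, rot 0)"] by (simp add: S3.integral_mult S3.zero_double)
      then show "double_counit S3 a = 0" by (simp add: S3.subset_sum_apply)
    qed (rule that)
  qed
qed

section \<open>Class functions on commuting pairs\<close>

definition class_function :: "(perm_pair \<Rightarrow> 'k::field) \<Rightarrow> bool"
  where "class_function v \<longleftrightarrow>
    (\<forall>a b. \<not> (a \<in> carrier S3 \<and> b \<in> carrier S3 \<and> a \<otimes>\<^bsub>S3\<^esub> b = b \<otimes>\<^bsub>S3\<^esub> a) \<longrightarrow> v (a, b) = 0) \<and>
    (\<forall>g\<in>carrier S3. \<forall>a\<in>carrier S3. \<forall>b\<in>carrier S3.
      v (conj3 g a, conj3 g b) = v (a, b))"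

lemma class_function_conj:
  "class_function v \<Longrightarrow> g \<in> carrier S3 \<Longrightarrow> a \<in> carrier S3 \<Longrightarrow> b \<in> carrier S3 \<Longrightarrow>
    v (conj3 g a, conj3 g b) = v (a, b)"
  by (simp add: class_function_def)

lemma class_function_zero:
  "class_function v \<Longrightarrow> \<not> (a \<in> carrier S3 \<and> b \<in> carrier S3 \<and> a \<otimes>\<^bsub>S3\<^esub> b = b \<otimes>\<^bsub>S3\<^esub> a) \<Longrightarrow> v (a, b) = 0"
  unfolding class_function_def by blast

lemma class_function_rot_uminus: "class_function v \<Longrightarrow> v (rot (- i), rot (- j)) = v (rot i, rot j)"
  using class_function_conj[of v "mirror 0" "rot i" "rot j"] by simp

text \<open>A reflection commutes with a rotation or with another reflection only if \<open>2 i = 0\<close> modulo 3 for the exponent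
  \<open>i\<close> of the rotation, or of the product of the two reflections, and then \<open>i = 0\<close> modulo 3.\<close>

lemma S3_commuting_cases:
  assumes "a \<in> carrier S3" "b \<in> carrier S3" "a \<otimes>\<^bsub>S3\<^esub> b = b \<otimes>\<^bsub>S3\<^esub> a"
  obtains (rot) i j where "a = rot i" "b = rot j"
    | (mirror) j where "(a, b) \<in> {(rot 0, mirror j), (mirror j, rot 0), (mirror j, mirror j)}"
proof -
  have eq: "i mod 3 = j mod 3" if "(i - j) mod 3 = (j - i) mod 3" for i j :: int using that by presburger
  have eq0: "i mod 3 = 0" if "(i + j) mod 3 = (j - i) mod 3" for i j :: int using that by presburger
  from assms(1) show thesis
  proof (cases rule: S3_cases)
    case a: (1 i)
    from assms(2) show thesis
    proof (cases rule: S3_cases)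
      case b: (1 j)
      then show thesis using a that by blast
    next
      case b: (2 j)
      then have "i mod 3 = 0" using assms(3) a by (intro eq0[of i j]) (simp add: mirror_eq_iff)
      then have "rot i = rot 0" by (simp add: rot_eq_iff)
      then show thesis using a b that by blast
    qed
  next
    case a: (2 i)
    from assms(2) show thesis
    proof (cases rule: S3_cases)
      case b: (1 j)
      then have "j mod 3 = 0" using assms(3) a by (intro eq0[of j i]) (simp add: mirror_eq_iff)
      then have "rot j = rot 0" by (simp add: rot_eq_iff)
      then show thesis using a b that by blast
    next
      case b: (2 j)
      then have "i mod 3 = j mod 3" using assms(3) a by (intro eq[of i j]) (simp add: rot_eq_iff)
      then have "mirror i = mirror j" by (simp add: mirror_eq_iff)
      then show thesis using a b that by blast
    qed
  qed
qed

lemma mirror_conjugate: "\<exists>g\<in>carrier S3. conj3 g (mirror 0) = mirror j"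
proof (intro bexI)
  show "inv\<^bsub>S3\<^esub> rot j \<otimes>\<^bsub>S3\<^esub> mirror 0 \<otimes>\<^bsub>S3\<^esub> rot j = mirror j"
    by (simp add: mirror_eq_iff) presburger
qed simp

text \<open>On class functions a sum over \<open>H\<close> acts as multiplication by the order of \<open>H\<close>, and \<open>3 = 1\<close> and
  \<open>6 = 0\<close> in \<open>K\<close>.\<close>

lemma class_function_fixed:
  fixes v :: "_ \<Rightarrow> 'k::field"
  assumes char: "CHAR('k) = 2" and v: "class_function v"
  shows "idem3 \<odot>\<^bsub>L3\<^esub> v = v" "integral3 \<odot>\<^bsub>L3\<^esub> v = \<zero>\<^bsub>L3\<^esub>"
proof -
  note char = char_2_numerals[OF char]
  have "(S3.subset_sum H \<odot>\<^bsub>L3\<^esub> v) (a, b) = of_nat (card H) * v (a, b)" if H: "H \<subseteq> carrier S3" for H a b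
  proof (cases "a \<in> carrier S3 \<and> b \<in> carrier S3 \<and> a \<otimes>\<^bsub>S3\<^esub> b = b \<otimes>\<^bsub>S3\<^esub> a")
    case True
    have "(\<Sum>g\<in>H. v (conj3 g a, conj3 g b)) = (\<Sum>g\<in>H. v (a, b))"
      using H True by (intro sum.cong refl class_function_conj[OF v]) auto
    then show ?thesis using True by (simp add: S3.subset_sum_smult[OF H])
  qed (use class_function_zero[OF v] in \<open>auto simp: S3.subset_sum_smult[OF H]\<close>)
  then show "idem3 \<odot>\<^bsub>L3\<^esub> v = v" "integral3 \<odot>\<^bsub>L3\<^esub> v = \<zero>\<^bsub>L3\<^esub>"
    using A3_subset by (auto simp: fun_eq_iff card_A3 card_S3 char S3.zero_dual)
qed

text \<open>An invariant vector is fixed by all elements of counit 1.  The element \<open>\<delta>\<^sub>e \<otimes> e\<close> restricts functions to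
  commuting pairs, and \<open>\<epsilon> \<otimes> g\<close> conjugates by \<open>g\<close>.\<close>

lemma class_functionI:
  fixes P :: "nat \<Rightarrow> (perm_pair \<Rightarrow> 'k::field, 'p) module"
  assumes "periodic_resolution D3 P d aug (double_trivial S3) 1 idem3 integral3"
    and v: "v \<in> carrier L3" "idem3 \<odot>\<^bsub>L3\<^esub> v = v" "integral3 \<odot>\<^bsub>L3\<^esub> v = \<zero>\<^bsub>L3 :: (_ \<Rightarrow> 'k, _) module\<^esub>"
  shows "class_function v"
proof -
  interpret periodic_resolution D3 P d aug "double_trivial S3" 1 idem3 integral3 by fact
  have L: "left_module (D3 :: (_ \<Rightarrow> 'k) ring) L3" by (rule S3.left_module_dual[OF R])
  have one: "\<one>\<^bsub>D3\<^esub> \<in> carrier (D3 :: (_ \<Rightarrow> 'k) ring)" using R by (rule ring.ring_simprules)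
  have act: "a \<odot>\<^bsub>L3\<^esub> v = v" if a: "a \<in> carrier D3" "double_counit S3 a = 1" for a :: "_ \<Rightarrow> 'k"
  proof -
    have "a \<odot>\<^bsub>L3\<^esub> v = \<one>\<^bsub>D3\<^esub> \<odot>\<^bsub>L3\<^esub> v"
      using a by (intro annihilator_invariant[OF L v _ one]) (simp_all add: double_trivial_def S3.counit_one)
    then show ?thesis using left_module.lsmult_one[OF L v(1)] by simp
  qed
  have unit: "S3.subset_sum {rot 0} \<odot>\<^bsub>L3\<^esub> v = v"
    by (intro act S3.subset_sum_closed) (simp_all add: S3.counit_subset_sum)
  \<comment> \<open>The element \<open>\<epsilon> \<otimes> g\<close>.\<close>
  define grouplike :: "(nat \<Rightarrow> nat) \<Rightarrow> _ \<Rightarrow> 'k"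
    where "grouplike g = (\<lambda>(a, b). if a \<in> carrier S3 \<and> b = g then 1 else 0)" for g
  have grouplike: "grouplike g \<odot>\<^bsub>L3\<^esub> v = v" if "g \<in> carrier S3" for g
  proof (rule act)
    show "grouplike g \<in> carrier D3" using that by (auto simp: grouplike_def S3.carrier_double)
    have "double_counit S3 (grouplike g) = (\<Sum>b\<in>carrier S3. if b = g then 1 else 0)"
      by (simp add: S3.counit_double grouplike_def)
    then show "double_counit S3 (grouplike g) = 1" using that S3.finite_carrier by simp
  qed
  have "v (a, b) = 0" if "\<not> (a \<in> carrier S3 \<and> b \<in> carrier S3 \<and> a \<otimes>\<^bsub>S3\<^esub> b = b \<otimes>\<^bsub>S3\<^esub> a)" for a b
    using fun_cong[OF unit, of "(a, b)"] that by (auto simp: S3.subset_sum_smult)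
  moreover have "v (conj3 g a, conj3 g b) = v (a, b)"
    if gab: "g \<in> carrier S3" "a \<in> carrier S3" "b \<in> carrier S3" for g a b
  proof -
    have "v (a, b) = (\<Sum>k\<in>carrier S3. grouplike g (conj3 b a \<otimes>\<^bsub>S3\<^esub> inv\<^bsub>S3\<^esub> a, k) *
        v (conj3 k a, conj3 k b))"
      using fun_cong[OF grouplike[OF gab(1)], of "(a, b)"] gab by (simp add: S3.smult_dual)
    also have "\<dots> = (\<Sum>k\<in>carrier S3. if k = g
        then v (conj3 g a, conj3 g b) else 0)"
      using gab by (intro sum.cong) (auto simp: grouplike_def)
    finally show ?thesis using gab S3.finite_carrier by simp
  qed
  ultimately show ?thesis unfolding class_function_def by blast
qed

section \<open>Coordinates on class functions\<close>

text \<open>For a homomorphism \<open>\<kappa>\<close> from the integers, the value at \<open>(x, y)\<close> is the value of \<open>v\<close> at the pair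
  \<open>(\<kappa> y, \<kappa> x)\<close>.  With the exponents interchanged in this way, the maps \<open>T_tilde\<close> and \<open>S_tilde\<close> become the
  matrices \<open>T_mat\<close> and \<open>S_mat\<close> acting on column vectors.\<close>

definition pair_values :: "(int \<Rightarrow> (nat \<Rightarrow> nat)) \<Rightarrow> (perm_pair \<Rightarrow> 'k) \<Rightarrow> int ^ 2 \<Rightarrow> 'k"
  where "pair_values \<kappa> v u = v (\<kappa> (u $ 2), \<kappa> (u $ 1))"

definition mirror_power :: "int \<Rightarrow> (nat \<Rightarrow> nat)"
  where "mirror_power i = (if even i then rot 0 else mirror 0)"

lemma mirror_power_hom: "mirror_power (i + j) = mirror_power i \<otimes>\<^bsub>S3\<^esub> mirror_power j" "mirror_power (- i) = inv\<^bsub>S3\<^esub> mirror_power i"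
    "mirror_power i \<in> carrier S3"
  by (auto simp: mirror_power_def)

lemma even_periodic_mirror_power: "even_periodic 2 (pair_values mirror_power v)"
  by (auto simp: even_periodic_def pair_values_def mirror_power_def even_mod_2_iff)

lemma even_periodic_rot: "class_function v \<Longrightarrow> even_periodic 3 (pair_values rot v)"
proof -
  have "rot (i mod 3) = rot i" for i by (simp add: rot_eq_iff)
  then show "class_function v \<Longrightarrow> even_periodic 3 (pair_values rot v)"
    by (simp add: even_periodic_def pair_values_def class_function_rot_uminus)
qed

lemma pair_values_T_tilde:
  assumes v: "v \<in> carrier L3"
    and \<kappa>: "\<And>i j. \<kappa> (i + j) = \<kappa> i \<otimes>\<^bsub>S3\<^esub> \<kappa> j" "\<And>i. \<kappa> i \<in> carrier S3"
  shows "pair_values \<kappa> (T_tilde S3 v) (T_mat *v u) = pair_values \<kappa> v u"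
proof -
  have "(T_mat *v u) $ 1 = u $ 2 + u $ 1" "(T_mat *v u) $ 2 = u $ 2"
    by (simp_all add: int_2x2 ST_entries)
  then show ?thesis
    using \<kappa> by (simp add: pair_values_def S3.T_tilde_apply[OF v] S3.cancel_left)
qed

lemma pair_values_S_tilde:
  assumes v: "v \<in> carrier L3"
    and \<kappa>: "\<And>i j. \<kappa> (i + j) = \<kappa> i \<otimes>\<^bsub>S3\<^esub> \<kappa> j" "\<And>i. \<kappa> (- i) = inv\<^bsub>S3\<^esub> \<kappa> i" "\<And>i. \<kappa> i \<in> carrier S3"
  shows "pair_values \<kappa> (S_tilde S3 v) (S_mat *v u) = pair_values \<kappa> v u"
proof -
  have "(S_mat *v u) $ 1 = - u $ 2" "(S_mat *v u) $ 2 = u $ 1"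
    by (simp_all add: int_2x2 ST_entries)
  moreover have "\<kappa> (u $ 1) \<otimes>\<^bsub>S3\<^esub> \<kappa> (u $ 2) \<otimes>\<^bsub>S3\<^esub> inv\<^bsub>S3\<^esub> \<kappa> (u $ 1) = \<kappa> (u $ 2)"
    unfolding \<kappa>(1,2)[symmetric] by simp
  ultimately show ?thesis
    using \<kappa> by (simp add: pair_values_def S3.S_tilde_apply[OF v])
qed

lemma proj_line_cases:
  assumes "U \<in> proj_line n"
  obtains u where "U = line_mod n (vec_mod n u)" "vec_mod n u \<noteq> 0"
proof -
  obtain v where "U = line_mod n v" "vec_mod n v = v" "v \<noteq> 0"
    using assms by (auto simp: proj_line_eq)
  then show thesis using that[of v] by simp
qed

lemma line_function_zero_iff:
  assumes n: "n = 2 \<or> n = 3" and F: "even_periodic n F"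
  shows "line_function n F = (\<lambda>_. 0) \<longleftrightarrow> (\<forall>u. vec_mod n u \<noteq> 0 \<longrightarrow> F u = 0)"
proof
  assume "line_function n F = (\<lambda>_. 0)"
  then show "\<forall>u. vec_mod n u \<noteq> 0 \<longrightarrow> F u = 0" using line_function_line_mod[OF n F] by metis
next
  assume *: "\<forall>u. vec_mod n u \<noteq> 0 \<longrightarrow> F u = 0"
  show "line_function n F = (\<lambda>_. 0)"
  proof
    fix U show "line_function n F U = 0"
    proof (cases "U \<in> proj_line n")
      case True
      then obtain u where "U = line_mod n (vec_mod n u)" "vec_mod n u \<noteq> 0" by (rule proj_line_cases)
      then show ?thesis using * line_function_line_mod[OF n F] by simp
    qed (simp add: line_function_def)
  qed
qed

lemma line_function_eqI:
  assumes n: "n = 2 \<or> n = 3" and F: "even_periodic n F" and w: "\<And>U. U \<notin> proj_line n \<Longrightarrow> w U = 0"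
    and eq: "\<And>u. vec_mod n u \<noteq> 0 \<Longrightarrow> F u = w (line_mod n (vec_mod n u))"
  shows "line_function n F = w"
proof
  fix U show "line_function n F U = w U"
  proof (cases "U \<in> proj_line n")
    case True
    then obtain u where u: "U = line_mod n (vec_mod n u)" "vec_mod n u \<noteq> 0" by (rule proj_line_cases)
    then show ?thesis using line_function_line_mod[OF n F u(2)] eq by simp
  qed (simp add: line_function_def w)
qed

text \<open>Every commuting pair that involves a reflection is conjugate to one whose entries are powers of
  \<open>mirror 0\<close>.\<close>

lemma class_function_determined:
  assumes v: "class_function v" and one: "v (rot 0, rot 0) = 0"
    and two: "line_function 2 (pair_values mirror_power v) = (\<lambda>_. 0)"
    and ab: "\<not> (a \<in> A3 \<and> b \<in> A3 \<and> (a, b) \<noteq> (rot 0, rot 0))"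
  shows "v (a, b) = 0"
proof (cases "a \<in> carrier S3 \<and> b \<in> carrier S3 \<and> a \<otimes>\<^bsub>S3\<^esub> b = b \<otimes>\<^bsub>S3\<^esub> a")
  case True
  have F: "pair_values mirror_power v u = 0" if "vec_mod 2 u \<noteq> 0" for u
    using two that line_function_zero_iff[OF _ even_periodic_mirror_power] by blast
  have "v (rot 0, mirror 0) = 0" "v (mirror 0, rot 0) = 0" "v (mirror 0, mirror 0) = 0"
    using F[of "vector [1, 0]"] F[of "vector [0, 1]"] F[of "vector [1, 1]"]
    by (simp_all add: vec_eq_iff forall_2 pair_values_def mirror_power_def)
  then have base: "v (a, b) = 0" if "(a, b) \<in> {(rot 0, mirror 0), (mirror 0, rot 0), (mirror 0, mirror 0)}" for a b
    using that by auto
  from True have "a \<in> carrier S3" "b \<in> carrier S3" "a \<otimes>\<^bsub>S3\<^esub> b = b \<otimes>\<^bsub>S3\<^esub> a" by simp_all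
  then show ?thesis
  proof (cases rule: S3_commuting_cases)
    case (rot i j)
    then show ?thesis using ab one by auto
  next
    case (mirror j)
    obtain g where g: "g \<in> carrier S3" "conj3 g (mirror 0) = mirror j"
      using mirror_conjugate by blast
    have "conj3 g (rot 0) = rot 0" using g(1) by (auto elim!: S3_cases)
    then show ?thesis using mirror base
      class_function_conj[OF v g(1), of "rot 0" "mirror 0"] class_function_conj[OF v g(1), of "mirror 0" "rot 0"]
      class_function_conj[OF v g(1), of "mirror 0" "mirror 0"] g(2) by auto
  qed
qed (rule class_function_zero[OF v])

lemma line_mod_uminus: "n > 0 \<Longrightarrow> line_mod n (vec_mod n (- u)) = line_mod n (vec_mod n u)"
proof -
  assume n: "n > 0"
  have sub: "line_mod n (vec_mod n (- u)) \<subseteq> line_mod n (vec_mod n u)" for u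
  proof
    fix w assume "w \<in> line_mod n (vec_mod n (- u))"
    then obtain k where k: "w = vec_mod n (k *s vec_mod n (- u))" by (auto simp: line_mod_def)
    have "w = vec_mod n ((- k mod n) *s vec_mod n u)"
      unfolding k vec_mod_scale_vec_mod by (simp add: vec_eq_iff mod_simps)
    then show "w \<in> line_mod n (vec_mod n u)" using n by (auto simp: line_mod_def)
  qed
  from sub[of u] sub[of "- u"] show ?thesis by simp
qed

text \<open>The exponent of a rotation: \<open>rot i\<close> sends 3, which represents the residue 0, to the representative of \<open>i\<close>.\<close>

definition rot_log :: "(nat \<Rightarrow> nat) \<Rightarrow> int"
  where "rot_log g = int (g 3)"

lemma rot_log_rot: "rot_log (rot i) mod 3 = i mod 3"
proof -
  have "rot_log (rot i) = 1 + (3 + i - 1) mod 3"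
    using affine_3_inside[of 3 1 i] by (simp add: rot_log_def rot_def)
  then show ?thesis by (simp add: mod_simps)
qed

text \<open>The class function with prescribed coordinates.  The line of a pair is read off from the exponents of its
  entries, in reversed order as in \<open>pair_values\<close>; for pairs that involve a reflection the exponents are the parities.\<close>

definition class_function_of :: "'k::field \<Rightarrow> ((int ^ 2) set \<Rightarrow> 'k) \<Rightarrow> ((int ^ 2) set \<Rightarrow> 'k)
    \<Rightarrow> perm_pair \<Rightarrow> 'k"
  where "class_function_of w1 w2 w3 = (\<lambda>(a, b).
    if \<not> (a \<in> carrier S3 \<and> b \<in> carrier S3 \<and> a \<otimes>\<^bsub>S3\<^esub> b = b \<otimes>\<^bsub>S3\<^esub> a) then 0
    else if a = rot 0 \<and> b = rot 0 then w1
    else if a \<in> A3 \<and> b \<in> A3 then w3 (line_mod 3 (vec_mod 3 (vector [rot_log b, rot_log a])))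
    else w2 (line_mod 2 (vector [if b \<in> A3 then 0 else 1, if a \<in> A3 then 0 else 1])))"

lemma class_function_of_rot:
  "class_function_of w1 w2 w3 (rot i, rot j) =
    (if vec_mod 3 (vector [j, i]) = 0 then w1 else w3 (line_mod 3 (vec_mod 3 (vector [j, i]))))"
proof -
  have "vec_mod 3 (vector [rot_log (rot j), rot_log (rot i)]) = vec_mod 3 (vector [j, i])"
    by (simp add: vec_eq_iff forall_2 rot_log_rot)
  moreover have "vec_mod 3 (vector [j, i] :: int ^ 2) = 0 \<longleftrightarrow> rot i = rot 0 \<and> rot j = rot 0"
    by (auto simp: rot_eq_iff vec_eq_iff forall_2)
  moreover have "class_function_of w1 w2 w3 (rot i, rot j) = (if rot i = rot 0 \<and> rot j = rot 0 then w1
      else w3 (line_mod 3 (vec_mod 3 (vector [rot_log (rot j), rot_log (rot i)]))))"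
    by (simp add: class_function_of_def add.commute)
  ultimately show ?thesis by simp
qed

lemma class_function_class_function_of: "class_function (class_function_of w1 w2 w3)"
proof -
  let ?v = "class_function_of w1 w2 w3"
  have conj: "?v (conj3 g a, conj3 g b) = ?v (a, b)"
    if g: "g \<in> carrier S3" and a: "a \<in> carrier S3" and b: "b \<in> carrier S3" for g a b
  proof -
    let ?c = "\<lambda>x. conj3 g x"
    have A3: "?c x \<in> A3 \<longleftrightarrow> x \<in> A3" if "x \<in> carrier S3" for x
      using g that by (auto elim!: S3_cases)
    have comm: "?c a \<otimes>\<^bsub>S3\<^esub> ?c b = ?c b \<otimes>\<^bsub>S3\<^esub> ?c a \<longleftrightarrow> a \<otimes>\<^bsub>S3\<^esub> b = b \<otimes>\<^bsub>S3\<^esub> a"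
    proof -
      have "?c a \<otimes>\<^bsub>S3\<^esub> ?c b = ?c (a \<otimes>\<^bsub>S3\<^esub> b)" "?c b \<otimes>\<^bsub>S3\<^esub> ?c a = ?c (b \<otimes>\<^bsub>S3\<^esub> a)"
        using g a b by (simp_all add: S3.group_word_simps)
      moreover have "?c x = ?c y \<longleftrightarrow> x = y" if "x \<in> carrier S3" "y \<in> carrier S3" for x y
        using g that by simp
      ultimately show ?thesis using a b by simp
    qed
    show ?thesis
    proof (cases "a \<in> A3 \<and> b \<in> A3")
      case True
      then obtain i j where ij: "a = rot i" "b = rot j" by (auto simp: A3_def)
      have "vec_mod 3 (vector [- j, - i] :: int ^ 2) = vec_mod 3 (- vector [j, i])"
        by (simp add: vec_eq_iff forall_2)
      moreover have "vec_mod 3 (- u) = 0 \<longleftrightarrow> vec_mod 3 u = 0" for u :: "int ^ 2"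
      proof -
        have "(- x) mod 3 = 0 \<longleftrightarrow> x mod 3 = 0" for x :: int by presburger
        then show ?thesis by (simp add: vec_eq_iff)
      qed
      ultimately have "?v (rot (- i), rot (- j)) = ?v (rot i, rot j)"
        by (simp add: class_function_of_rot line_mod_uminus)
      then show ?thesis using g ij by (auto elim!: S3_cases)
    next
      case False
      then show ?thesis using A3[OF a] A3[OF b] comm g a b
        by (auto simp: class_function_of_def)
    qed
  qed
  show ?thesis
    unfolding class_function_def
  proof (intro conjI allI impI ballI)
    fix a b assume "\<not> (a \<in> carrier S3 \<and> b \<in> carrier S3 \<and> a \<otimes>\<^bsub>S3\<^esub> b = b \<otimes>\<^bsub>S3\<^esub> a)"
    then show "?v (a, b) = 0" unfolding class_function_of_def by simp
  qed (rule conj)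
qed

lemma class_function_of_coordinates:
  fixes w1 :: "'k::field"
  assumes w2: "\<And>U. U \<notin> proj_line 2 \<Longrightarrow> w2 U = 0" and w3: "\<And>U. U \<notin> proj_line 3 \<Longrightarrow> w3 U = 0"
  defines "v \<equiv> class_function_of w1 w2 w3"
  shows "v (rot 0, rot 0) = w1" "line_function 2 (pair_values mirror_power v) = w2"
    "line_function 3 (pair_values rot v) = w3"
proof -
  show "v (rot 0, rot 0) = w1" by (simp add: v_def class_function_of_def)
  have vec: "vector [u $ 1, u $ 2] = u" for u :: "int ^ 2" by (simp add: vec_eq_iff forall_2)
  show "line_function 3 (pair_values rot v) = w3"
    using even_periodic_rot[OF class_function_class_function_of] w3
    by (intro line_function_eqI) (simp_all add: v_def pair_values_def class_function_of_rot vec)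
  show "line_function 2 (pair_values mirror_power v) = w2"
  proof (intro line_function_eqI even_periodic_mirror_power w2)
    fix u :: "int ^ 2" assume u: "vec_mod 2 u \<noteq> 0"
    have "vec_mod 2 u = vector [if even (u $ 1) then 0 else 1, if even (u $ 2) then 0 else 1]"
      by (simp add: vec_eq_iff forall_2 mod_2_eq_odd)
    moreover from this u have "\<not> (even (u $ 1) \<and> even (u $ 2))" by (auto simp: vec_eq_iff forall_2)
    ultimately show "pair_values mirror_power v u = w2 (line_mod 2 (vec_mod 2 u))"
      by (auto simp: pair_values_def v_def class_function_of_def mirror_power_def)
  qed auto
qed

text \<open>The integral sends \<open>w\<close> to its sum over each orbit with multiplicities.  At a pair with entries in the group
  generated by \<open>mirror 0\<close> each value occurs an even number of times.  At a pair \<open>(a, b)\<close> of rotations, other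
  than the neutral one, the values at \<open>(a, b)\<close> and \<open>(a\<^sup>-\<^sup>1, b\<^sup>-\<^sup>1)\<close> occur three times each, so a suitable \<open>w\<close> is
  obtained by restricting \<open>v\<close> to one pair out of each such couple.\<close>

lemma integral_multiple_iff:
  fixes v :: "_ \<Rightarrow> 'k::field"
  assumes char: "CHAR('k) = 2" and v: "class_function v"
  shows "(v (rot 0, rot 0) = 0 \<and> line_function 2 (pair_values mirror_power v) = (\<lambda>_. 0)) \<longleftrightarrow>
    (\<exists>w\<in>carrier L3. v = integral3 \<odot>\<^bsub>L3\<^esub> w)"
proof
  note char = char_2_numerals[OF char]
  have int: "(integral3 \<odot>\<^bsub>L3\<^esub> w) (a, b) = (if a \<in> carrier S3 \<and> b \<in> carrier S3 \<and> a \<otimes>\<^bsub>S3\<^esub> b = b \<otimes>\<^bsub>S3\<^esub> a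
    then \<Sum>g\<in>carrier S3. w (conj3 g a, conj3 g b) else 0)"
    for w :: "_ \<Rightarrow> 'k" and a b
    by (rule S3.subset_sum_smult) simp
  {
    assume one: "v (rot 0, rot 0) = 0 \<and> line_function 2 (pair_values mirror_power v) = (\<lambda>_. 0)"
    \<comment> \<open>One of \<open>(y, x)\<close> and \<open>(-y, -x)\<close> for each nonzero vector modulo 3.\<close>
    define w where "w = (\<lambda>(a, b). if (a = rot 1 \<and> b \<in> A3) \<or> (a = rot 0 \<and> b = rot 1) then v (a, b) else 0)"
    have w: "w \<in> carrier L3" using A3_subset by (auto simp: S3.carrier_dual w_def)
    have "v (a, b) = (integral3 \<odot>\<^bsub>L3\<^esub> w) (a, b)" for a b
    proof (cases "a \<in> A3 \<and> b \<in> A3")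
      case True
      have w_rot: "w (rot i, rot j) = (if i mod 3 = 1 \<or> i mod 3 = 0 \<and> j mod 3 = 1 then v (rot i, rot j) else 0)" for i j
        by (simp add: w_def rot_eq_iff)
      have minus: "v (rot 2, rot 2) = v (rot 1, rot 1)" "v (rot 2, rot 1) = v (rot 1, rot 2)"
        "v (rot 2, rot 0) = v (rot 1, rot 0)" "v (rot 0, rot 2) = v (rot 0, rot 1)"
        using class_function_rot_uminus[OF v, of 1 1] class_function_rot_uminus[OF v, of 1 2]
          class_function_rot_uminus[OF v, of 1 0] class_function_rot_uminus[OF v, of 0 1] by simp_all
      have three: "x + x + x = x" for x :: 'k by (simp only: char(4) add_0_left)
      from True show ?thesis
        using one minus by (auto simp: A3_def int sum_S3 w_rot three char add_ac)
    next
      case False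
      then have "v (a, b) = 0" using class_function_determined[OF v, of a b] one by blast
      moreover have "w (conj3 g a, conj3 g b) = 0"
        if "g \<in> carrier S3" "a \<in> carrier S3" "b \<in> carrier S3" for g
        using False that by (auto simp: w_def elim!: S3_cases)
      ultimately show ?thesis by (simp add: int)
    qed
    then show "\<exists>w\<in>carrier L3. v = integral3 \<odot>\<^bsub>L3\<^esub> w" using w by (intro bexI[of _ w]) auto
  }
  assume "\<exists>w\<in>carrier L3. v = integral3 \<odot>\<^bsub>L3\<^esub> w"
  then obtain w where w: "v = integral3 \<odot>\<^bsub>L3\<^esub> w" by blast
  have "v (mirror_power i, mirror_power j) = 0" for i j
  proof -
    have four: "x + (y + (z + (x + (y + z)))) = 0" for x y z :: 'k
      using char(4)[of "x + y + z"] by (simp add: add_ac)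
    show ?thesis using four char unfolding w by (auto simp: mirror_power_def int sum_S3 add_ac)
  qed
  then show "v (rot 0, rot 0) = 0 \<and> line_function 2 (pair_values mirror_power v) = (\<lambda>_. 0)"
    using line_function_zero_iff[OF _ even_periodic_mirror_power, of v] 
    by (auto simp: pair_values_def) (metis even_zero mirror_power_def)
qed

section \<open>The block spaces as representations of the modular group\<close>

text \<open>The reduction of the main result to coordinates on class functions.\<close>

lemma torus_block_space_rep:
  fixes P :: "nat \<Rightarrow> (perm_pair \<Rightarrow> 'k::field, 'p) module"
    and W :: "('k, 'w) module" and c :: "(perm_pair \<Rightarrow> 'k) \<Rightarrow> 'w"
  assumes char: "CHAR('k) = 2"
    and res: "projective_resolution D3 P d aug (double_trivial S3)"
    and W: "is_rep SL2Z (W, \<sigma>)"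
    and add: "\<And>v v'. v \<in> carrier L3 \<Longrightarrow> v' \<in> carrier L3 \<Longrightarrow> c (\<lambda>p. v p + v' p) = c v \<oplus>\<^bsub>W\<^esub> c v'"
    and smult: "\<And>k v. v \<in> carrier L3 \<Longrightarrow> c (\<lambda>p. k * v p) = k \<odot>\<^bsub>W\<^esub> c v"
    and surj: "c ` {v \<in> carrier L3. class_function v} = carrier W"
    and kernel: "\<And>v. v \<in> carrier L3 \<Longrightarrow> class_function v \<Longrightarrow> c v = \<zero>\<^bsub>W\<^esub> \<longleftrightarrow>
      (if m = 0 then v = (\<lambda>_. 0) else \<exists>w\<in>carrier L3. v = integral3 \<odot>\<^bsub>L3\<^esub> w)"
    and T: "\<And>v. v \<in> carrier L3 \<Longrightarrow> class_function v \<Longrightarrow> class_function (T_tilde S3 v) \<Longrightarrow>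
      c (T_tilde S3 v) = \<sigma> T_mat (c v)"
    and S: "\<And>v. v \<in> carrier L3 \<Longrightarrow> class_function v \<Longrightarrow> class_function (S_tilde S3 v) \<Longrightarrow>
      c (S_tilde S3 v) = \<sigma> S_mat (c v)"
  shows "(\<exists>\<rho>. mapping_class_action S3 P d m \<rho>) \<and>
    (\<forall>\<rho>. mapping_class_action S3 P d m \<rho> \<longrightarrow>
      rep_isomorphic SL2Z (torus_block_space S3 P d m, \<rho>) (W, \<sigma>))"
proof -
  have periodic: "periodic_resolution D3 P d aug (double_trivial S3) 1 idem3 integral3"
    using char res by (rule S3_periodic_resolution)
  interpret periodic_resolution D3 P d aug "double_trivial S3" 1 idem3 integral3 by (rule periodic)
  let ?D = "D3 :: (perm_pair \<Rightarrow> 'k) ring"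
  let ?L = "L3 :: (perm_pair \<Rightarrow> 'k, _) module"
  let ?V = "torus_block_space S3 P d m"
  let ?ext = "ext_map (double_scalar S3) D3 P d m ?L"
  have L: "left_module ?D ?L" by (rule S3.left_module_dual[OF R])
  have Wm: "left_module ring_of_type_algebra W" using W by (simp add: is_rep_def)
  define Z where "Z = {v \<in> carrier ?L. idem3 \<odot>\<^bsub>?L\<^esub> v = v \<and> integral3 \<odot>\<^bsub>?L\<^esub> v = \<zero>\<^bsub>?L\<^esub>}"
  have Z: "Z = {v \<in> carrier ?L. class_function v}"
    using class_functionI[OF periodic] class_function_fixed[OF char] by (auto simp: Z_def)
  have closed: "t v \<in> Z" if t: "t \<in> mod_hom ?D ?L ?L" and v: "v \<in> Z" for t v
    using v mod_hom_closed[OF t] mod_hom_smult[OF t f, of v] mod_hom_smult[OF t s, of v] mod_hom_zero[OF L L t]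
    by (simp add: Z_def)
  note T_hom = S3.T_tilde_hom[OF R] and S_hom = S3.S_tilde_hom[OF R]
  obtain \<Phi> where \<Phi>: "\<Phi> \<in> mod_hom ring_of_type_algebra W ?V"
    and bij: "bij_betw \<Phi> (carrier W) (carrier ?V)" and V: "left_module ring_of_type_algebra ?V"
    and ext: "\<And>\<phi> \<theta> w. \<phi> \<in> mod_hom ?D ?L ?L \<Longrightarrow> (\<And>v. v \<in> Z \<Longrightarrow> c (\<phi> v) = \<theta> (c v)) \<Longrightarrow>
      w \<in> carrier W \<Longrightarrow> ?ext \<phi> (\<Phi> w) = \<Phi> (\<theta> w)"
  proof (rule ext_classification[OF L _ _ Wm, where \<eta> = "double_scalar S3" and c = c and m = m])
    show "double_scalar S3 k \<in> carrier ?D" for k by (rule S3.double_scalar_closed)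
    show "double_scalar S3 k \<otimes>\<^bsub>?D\<^esub> a = a \<otimes>\<^bsub>?D\<^esub> double_scalar S3 k" if "a \<in> carrier ?D" for k a
      using that by (simp add: S3.double_scalar_mult)
    show "c (v \<oplus>\<^bsub>?L\<^esub> v') = c v \<oplus>\<^bsub>W\<^esub> c v'" if "v \<in> carrier ?L" "v' \<in> carrier ?L" for v v'
      using add[OF that] by (simp add: S3.add_dual)
    show "c (double_scalar S3 k \<odot>\<^bsub>?L\<^esub> v) = k \<odot>\<^bsub>W\<^esub> c v" if "v \<in> carrier ?L" for k v
      using smult[OF that] by (simp add: S3.double_scalar_smult[OF that])
    show "c ` {v \<in> carrier ?L. idem3 \<odot>\<^bsub>?L\<^esub> v = v \<and> integral3 \<odot>\<^bsub>?L\<^esub> v = \<zero>\<^bsub>?L\<^esub>} = carrier W"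
      unfolding Z_def[symmetric] Z by (rule surj)
    show "c v = \<zero>\<^bsub>W\<^esub> \<longleftrightarrow> (if m = 0 then v = \<zero>\<^bsub>?L\<^esub> else \<exists>w\<in>carrier ?L. v = integral3 \<odot>\<^bsub>?L\<^esub> w)"
      if "v \<in> {v \<in> carrier ?L. idem3 \<odot>\<^bsub>?L\<^esub> v = v \<and> integral3 \<odot>\<^bsub>?L\<^esub> v = \<zero>\<^bsub>?L\<^esub>}" for v
      using that kernel[of v] unfolding Z_def[symmetric] Z by (simp add: S3.zero_dual)
  qed (unfold Z_def[symmetric] torus_block_space_def[symmetric], rule that, assumption+, blast)
  have extensional: "?ext \<phi> \<in> extensional (carrier ?V)" for \<phi>
    by (simp add: ext_map_def torus_block_space_def)
  have T_ext: "?ext (T_tilde S3) (\<Phi> w) = \<Phi> (\<sigma> T_mat w)" if "w \<in> carrier W" for w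
    using T closed[OF T_hom] that by (intro ext T_hom) (auto simp: Z)
  have S_ext: "?ext (S_tilde S3) (\<Phi> w) = \<Phi> (\<sigma> S_mat w)" if "w \<in> carrier W" for w
    using S closed[OF S_hom] that by (intro ext S_hom) (auto simp: Z)
  note rep = SL2Z_rep_from_generators[OF W V \<Phi> bij extensional T_ext extensional S_ext]
  show ?thesis
    unfolding mapping_class_action_def using rep by blast
qed

lemma line_function_add: "line_function n (\<lambda>u. F u + F' u) = (\<lambda>U. line_function n F U + (line_function n F' U :: 'k::field))"
  by (simp add: line_function_def fun_eq_iff)

lemma line_function_smult: "line_function n (\<lambda>u. k * F u) = (\<lambda>U. k * (line_function n F U :: 'k::field))"
  by (simp add: line_function_def fun_eq_iff)

lemma pair_values_add: "pair_values \<kappa> (\<lambda>p. v p + v' p) = (\<lambda>u. pair_values \<kappa> v u + pair_values \<kappa> v' u)"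
  by (simp add: pair_values_def fun_eq_iff)

lemma pair_values_smult: "pair_values \<kappa> (\<lambda>p. k * v p) = (\<lambda>u. k * pair_values \<kappa> v u)"
  by (simp add: pair_values_def fun_eq_iff)

lemma line_function_closed:
  assumes "n > 0"
  shows "line_function n F \<in> carrier (fst (perm_rep (proj_line n) (proj_line_act n)))"
  by (simp add: carrier_perm_rep finite_proj_line assms line_function_def)

lemma perm_rep_ops:
  "\<zero>\<^bsub>fst (perm_rep Y act)\<^esub> = (\<lambda>_. 0)" "v \<oplus>\<^bsub>fst (perm_rep Y act)\<^esub> w = (\<lambda>x. v x + w x)"
  "k \<odot>\<^bsub>fst (perm_rep Y act)\<^esub> v = (\<lambda>x. k * v x)"
  by (simp_all add: perm_rep_def Let_def)

lemma trivial_rep_ops: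
  "carrier (fst trivial_rep) = UNIV" "\<zero>\<^bsub>fst trivial_rep\<^esub> = 0" "v \<oplus>\<^bsub>fst trivial_rep\<^esub> w = v + w"
  "k \<odot>\<^bsub>fst trivial_rep\<^esub> v = k * v" "snd trivial_rep g v = v"
  by (simp_all add: trivial_rep_def)

lemma rep_sum_ops:
  "carrier (fst (U \<oplus>\<^sub>r U')) = carrier (fst U) \<times> carrier (fst U')"
  "\<zero>\<^bsub>fst (U \<oplus>\<^sub>r U')\<^esub> = (\<zero>\<^bsub>fst U\<^esub>, \<zero>\<^bsub>fst U'\<^esub>)"
  "(v, v') \<oplus>\<^bsub>fst (U \<oplus>\<^sub>r U')\<^esub> (w, w') = (v \<oplus>\<^bsub>fst U\<^esub> w, v' \<oplus>\<^bsub>fst U'\<^esub> w')"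
  "k \<odot>\<^bsub>fst (U \<oplus>\<^sub>r U')\<^esub> (v, v') = (k \<odot>\<^bsub>fst U\<^esub> v, k \<odot>\<^bsub>fst U'\<^esub> v')"
  "v \<in> carrier (fst U) \<Longrightarrow> v' \<in> carrier (fst U') \<Longrightarrow> snd (U \<oplus>\<^sub>r U') g (v, v') = (snd U g v, snd U' g v')"
  by (simp_all add: rep_sum_def case_prod_unfold)

theorem theorem7p3:
  fixes P :: "nat \<Rightarrow> ((nat \<Rightarrow> nat) \<times> (nat \<Rightarrow> nat) \<Rightarrow> 'k::alg_closed_field, 'p) module"
    and d :: "nat \<Rightarrow> 'p \<Rightarrow> 'p" and aug :: "'p \<Rightarrow> 'k" and m :: nat
  assumes "CHAR('k) = 2"
    and "projective_resolution (drinfeld_double (sym_group 3)) P d aug (double_trivial (sym_group 3))"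
  shows "(\<exists>\<rho>. mapping_class_action (sym_group 3) P d m \<rho>) \<and>
    (\<forall>\<rho>. mapping_class_action (sym_group 3) P d m \<rho> \<longrightarrow>
      (m = 0 \<longrightarrow>
        rep_isomorphic SL2Z (torus_block_space (sym_group 3) P d m, \<rho>)
          (trivial_rep \<oplus>\<^sub>r perm_rep (proj_line 2) (proj_line_act 2)
                       \<oplus>\<^sub>r perm_rep (proj_line 3) (proj_line_act 3))) \<and>
      (m \<noteq> 0 \<longrightarrow>
        rep_isomorphic SL2Z (torus_block_space (sym_group 3) P d m, \<rho>)
          (trivial_rep \<oplus>\<^sub>r perm_rep (proj_line 2) (proj_line_act 2))))"
proof -
  let ?L = "L3 :: (perm_pair \<Rightarrow> 'k, _) module"
  let ?U2 = "perm_rep (proj_line 2) (proj_line_act 2) :: (int ^ 2 ^ 2, 'k, _) rep"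
  let ?U3 = "perm_rep (proj_line 3) (proj_line_act 3) :: (int ^ 2 ^ 2, 'k, _) rep"
  let ?c2 = "\<lambda>v :: _ \<Rightarrow> 'k. line_function 2 (pair_values mirror_power v)"
  let ?c3 = "\<lambda>v :: _ \<Rightarrow> 'k. line_function 3 (pair_values rot v)"
  note linear = line_function_add line_function_smult pair_values_add pair_values_smult
  note ops = rep_sum_ops trivial_rep_ops perm_rep_ops
  have c2: "?c2 v \<in> carrier (fst ?U2)" and c3: "?c3 v \<in> carrier (fst ?U3)" for v
    by (simp_all add: line_function_closed)
  have c2_T: "?c2 (T_tilde S3 v) = snd ?U2 T_mat (?c2 v)" if "v \<in> carrier ?L" for v
    by (rule perm_rep_line_function[symmetric])
      (simp_all add: even_periodic_mirror_power pair_values_T_tilde[OF that] mirror_power_hom)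
  have c2_S: "?c2 (S_tilde S3 v) = snd ?U2 S_mat (?c2 v)" if "v \<in> carrier ?L" for v
    by (rule perm_rep_line_function[symmetric])
      (simp_all add: even_periodic_mirror_power pair_values_S_tilde[OF that] mirror_power_hom)
  have c3_T: "?c3 (T_tilde S3 v) = snd ?U3 T_mat (?c3 v)"
    if "v \<in> carrier ?L" "class_function v" "class_function (T_tilde S3 v)" for v
    by (rule perm_rep_line_function[symmetric])
      (simp_all add: even_periodic_rot that pair_values_T_tilde)
  have c3_S: "?c3 (S_tilde S3 v) = snd ?U3 S_mat (?c3 v)"
    if "v \<in> carrier ?L" "class_function v" "class_function (S_tilde S3 v)" for v
    by (rule perm_rep_line_function[symmetric])
      (simp_all add: even_periodic_rot that pair_values_S_tilde)
  have one: "T_tilde S3 v (rot 0, rot 0) = v (rot 0, rot 0)" "S_tilde S3 v (rot 0, rot 0) = v (rot 0, rot 0)"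
    if "v \<in> carrier ?L" for v
    using that by (simp_all add: S3.T_tilde_apply S3.S_tilde_apply)
  have onto: "\<exists>v\<in>carrier ?L. class_function v \<and> v (rot 0, rot 0) = w1 \<and> ?c2 v = w2 \<and> ?c3 v = w3"
    if "w2 \<in> carrier (fst ?U2)" "w3 \<in> carrier (fst ?U3)" for w1 w2 w3
  proof (intro bexI conjI)
    show "class_function_of w1 w2 w3 \<in> carrier ?L"
      by (auto simp: S3.carrier_dual class_function_of_def)
  qed (use that class_function_of_coordinates[of w2 w3 w1] class_function_class_function_of
      in \<open>auto simp: carrier_perm_rep finite_proj_line\<close>)
  have zero: "class_function v \<Longrightarrow> v (rot 0, rot 0) = 0 \<and> ?c2 v = (\<lambda>_. 0) \<and> ?c3 v = (\<lambda>_. 0) \<longleftrightarrow> v = (\<lambda>_. 0)"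
    for v :: "_ \<Rightarrow> 'k"
  proof
    assume v: "class_function v" and c: "v (rot 0, rot 0) = 0 \<and> ?c2 v = (\<lambda>_. 0) \<and> ?c3 v = (\<lambda>_. 0)"
    have "v (a, b) = 0" for a b
    proof (cases "a \<in> A3 \<and> b \<in> A3 \<and> (a, b) \<noteq> (rot 0, rot 0)")
      case True
      then obtain i j where ij: "a = rot i" "b = rot j" by (auto simp: A3_def)
      have "vec_mod 3 (vector [j, i] :: int ^ 2) \<noteq> 0"
        using True ij by (auto simp: vec_eq_iff forall_2 rot_eq_iff)
      then have "pair_values rot v (vector [j, i]) = 0"
        using c line_function_zero_iff[OF _ even_periodic_rot[OF v]] by blast
      then show ?thesis using ij by (simp add: pair_values_def)
    qed (use class_function_determined[OF v] c in blast)
    then show "v = (\<lambda>_. 0)" by auto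
  qed (simp add: line_function_def pair_values_def fun_eq_iff)
  show ?thesis
  proof (cases "m = 0")
    case True
    let ?W = "trivial_rep \<oplus>\<^sub>r ?U2 \<oplus>\<^sub>r ?U3"
    let ?c = "\<lambda>v. (v (rot 0, rot 0), ?c2 v, ?c3 v)"
    have "(\<exists>\<rho>. mapping_class_action S3 P d m \<rho>) \<and> (\<forall>\<rho>. mapping_class_action S3 P d m \<rho> \<longrightarrow>
        rep_isomorphic SL2Z (torus_block_space S3 P d m, \<rho>) (fst ?W, snd ?W))"
    proof (rule torus_block_space_rep[OF assms, where c = ?c])
      show "is_rep SL2Z (fst ?W, snd ?W)"
        unfolding prod.collapse
        by (intro is_rep_sum is_rep_trivial is_rep_proj_line group_SL2Z) simp_all
      show "?c ` {v \<in> carrier ?L. class_function v} = carrier (fst ?W)"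
      proof
        show "?c ` {v \<in> carrier ?L. class_function v} \<subseteq> carrier (fst ?W)"
          using c2 c3 by (auto simp: ops)
        show "carrier (fst ?W) \<subseteq> ?c ` {v \<in> carrier ?L. class_function v}"
        proof
          fix w assume "w \<in> carrier (fst ?W)"
          then obtain w1 w2 w3 where w: "w = (w1, w2, w3)" "w2 \<in> carrier (fst ?U2)" "w3 \<in> carrier (fst ?U3)"
            by (auto simp: ops)
          then show "w \<in> ?c ` {v \<in> carrier ?L. class_function v}"
            using onto[OF w(2,3), of w1] by (auto simp: image_iff)
        qed
      qed
      show "?c v = \<zero>\<^bsub>fst ?W\<^esub> \<longleftrightarrow> (if m = 0 then v = (\<lambda>_. 0) else \<exists>w\<in>carrier L3. v = integral3 \<odot>\<^bsub>L3\<^esub> w)"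
        if "class_function v" for v
        using zero[OF that] True by (simp add: ops)
    qed (use c2_T c2_S c3_T c3_S one c2 c3 in \<open>simp_all add: ops linear\<close>)
    then show ?thesis using True by simp
  next
    case False
    let ?W = "trivial_rep \<oplus>\<^sub>r ?U2"
    let ?c = "\<lambda>v. (v (rot 0, rot 0), ?c2 v)"
    have "(\<exists>\<rho>. mapping_class_action S3 P d m \<rho>) \<and> (\<forall>\<rho>. mapping_class_action S3 P d m \<rho> \<longrightarrow>
        rep_isomorphic SL2Z (torus_block_space S3 P d m, \<rho>) (fst ?W, snd ?W))"
    proof (rule torus_block_space_rep[OF assms, where c = ?c])
      show "is_rep SL2Z (fst ?W, snd ?W)"
        unfolding prod.collapse
        by (intro is_rep_sum is_rep_trivial is_rep_proj_line group_SL2Z) simp_all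
      show "?c ` {v \<in> carrier ?L. class_function v} = carrier (fst ?W)"
      proof
        show "?c ` {v \<in> carrier ?L. class_function v} \<subseteq> carrier (fst ?W)"
          using c2 by (auto simp: ops)
        show "carrier (fst ?W) \<subseteq> ?c ` {v \<in> carrier ?L. class_function v}"
        proof
          fix w assume "w \<in> carrier (fst ?W)"
          then obtain w1 w2 where w: "w = (w1, w2)" "w2 \<in> carrier (fst ?U2)" by (auto simp: ops)
          then show "w \<in> ?c ` {v \<in> carrier ?L. class_function v}"
            using onto[OF w(2) c3[of "\<lambda>_. 0"], of w1] by (auto simp: image_iff)
        qed
      qed
      show "?c v = \<zero>\<^bsub>fst ?W\<^esub> \<longleftrightarrow> (if m = 0 then v = (\<lambda>_. 0) else \<exists>w\<in>carrier L3. v = integral3 \<odot>\<^bsub>L3\<^esub> w)"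
        if "class_function v" for v
        using integral_multiple_iff[OF assms(1) that] False by (simp add: ops)
    qed (use c2_T c2_S one c2 in \<open>simp_all add: ops linear\<close>)
    then show ?thesis using False by simp
  qed
qed

end
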